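(* Let $L>0$, $h>0$, and let $\alpha\in\mathbb{R}$, $\beta>0$ satisfy $0<2\alpha^2+\frac32\beta<\frac12$. Then there exist $r>0$ and two constants $\kappa_0,\lambda_0>0$ such that for any $(u_0,v_0,z_0)\in H$ satisfying $\|(u_0,v_0,z_0)\|_H\le r$, the energy $E(t)$ of the solution of the Hirota-Satsuma system (see context) with this initial data satisfies $$E(t)\le\kappa_0E(0)e^{-\lambda_0t},\qquad\forall t\ge0.$$
   Context: All functions are real valued. The Hirota-Satsuma system with boundary time-delay feedback (delay $h>0$, feedback gains $\alpha,\beta$) on $(0,L)$ is $$\begin{cases}u_t-\frac12u_{xxx}-3uu_x-3vv_x=0,& x\in(0,L),\ t>0,\\ v_t+v_{xxx}+3uv_x=0,& x\in(0,L),\ t>0,\\ u(t,0)=u(t,L)=v(t,0)=v(t,L)=u_x(t,0)=0,& t>0,\\ v_x(t,L)=\alpha u_x(t,L)+\beta u_x(t-h,L),& t>0,\\ u(0,x)=u_0(x),\ v(0,x)=v_0(x),& x\in(0,L),\\ u_x(t-h,L)=z_0(t-h),& t\in(0,h).\end{cases}$$ The delay is represented by $z(t,\rho)=u_x(t-h\rho,L)$, $\rho\in(0,1)$, which satisfies $hz_t+z_\rho=0$, $z(t,0)=u_x(t,L)$, $z(0,\rho)=z_0(-h\rho)$. Spaces: $X_0=[L^2(0,L)]^2$, $H=X_0\times L^2(0,1)$, with $\|(u,v,z)\|_H^2=\|(u,v)\|_{X_0}^2+\beta h\|z\|_{L^2(0,1)}^2$. The notation $(u_0,v_0,z_0)\in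 H$ means $(u_0,v_0,z_0(-h\,\cdot))\in H$, and $\|(u_0,v_0,z_0)\|_H$ is the norm of this element. Solutions are mild solutions, with $(u,v,z)\in C([0,T];H)$ and $(u,v)\in C([0,T];X_0)\cap L^2(0,T;[H^1(0,L)]^2)$ for every $T>0$; they exist globally for small data. The energy is $$E(t)=\frac12\int_0^L\big(u^2(t,x)+v^2(t,x)\big)\,dx+\frac{\beta h}{2}\int_0^1u_x^2(t-h\rho,L)\,d\rho.$$ *)

theory Defs
  imports "HOL-Analysis.Analysis"
begin

section \<open>The real Hilbert space $L^2(\mathbb{R})$\<close>

definition square_integrable :: "(real \<Rightarrow> real) \<Rightarrow> bool" where
  "square_integrable f \<longleftrightarrow> f \<in> borel_measurable lebesgue \<and> integrable lebesgue (\<lambda>x. (f x)\<^sup>2)"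

lemma square_integrable_zero [simp]: "square_integrable (\<lambda>x. 0)"
  by (simp add: square_integrable_def)

lemma square_integrable_mult:
  assumes "square_integrable f" "square_integrable g"
  shows "integrable lebesgue (\<lambda>x. f x * g x)"
proof (rule Bochner_Integration.integrable_bound)
  show "integrable lebesgue (\<lambda>x. (f x)\<^sup>2 + (g x)\<^sup>2)"
    using assms by (auto simp: square_integrable_def)
  show "(\<lambda>x. f x * g x) \<in> borel_measurable lebesgue"
    using assms by (auto simp: square_integrable_def)
  have "\<bar>a * b\<bar> \<le> a\<^sup>2 + b\<^sup>2" for a b :: real
  proof -
    have "2 * (\<bar>a\<bar> * \<bar>b\<bar>) \<le> \<bar>a\<bar>\<^sup>2 + \<bar>b\<bar>\<^sup>2"
      using sum_squares_bound[of "\<bar>a\<bar>" "\<bar>b\<bar>"] by (simp add: mult.assoc)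
    moreover have "0 \<le> \<bar>a\<bar> * \<bar>b\<bar>" by simp
    ultimately have "\<bar>a\<bar> * \<bar>b\<bar> \<le> \<bar>a\<bar>\<^sup>2 + \<bar>b\<bar>\<^sup>2" by linarith
    then show ?thesis by (simp add: abs_mult)
  qed
  then show "AE x in lebesgue. norm (f x * g x) \<le> norm ((f x)\<^sup>2 + (g x)\<^sup>2)"
    by (auto intro!: AE_I2 simp: order_trans[OF _ abs_ge_self])
qed

lemma square_integrable_add:
  assumes "square_integrable f" "square_integrable g"
  shows "square_integrable (\<lambda>x. f x + g x)"
  using assms square_integrable_mult[OF assms]
  by (auto simp: square_integrable_def power2_sum mult.assoc)

lemma square_integrable_scale:
  assumes "square_integrable f"
  shows "square_integrable (\<lambda>x. c * f x)"
  using assms by (auto simp: square_integrable_def power_mult_distrib)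

lemma square_integrable_uminus:
  assumes "square_integrable f"
  shows "square_integrable (\<lambda>x. - f x)"
  using assms by (auto simp: square_integrable_def)

lemma square_integrable_diff:
  assumes "square_integrable f" "square_integrable g"
  shows "square_integrable (\<lambda>x. f x - g x)"
  using square_integrable_add[OF assms(1) square_integrable_uminus[OF assms(2)]] by simp

lemma square_integrable_bound:
  assumes "f \<in> borel_measurable lebesgue" "square_integrable w"
    "AE x in lebesgue. \<bar>f x\<bar> \<le> \<bar>w x\<bar>"
  shows "square_integrable f"
  unfolding square_integrable_def
proof
  show "integrable lebesgue (\<lambda>x. (f x)\<^sup>2)"
  proof (rule Bochner_Integration.integrable_bound)
    show "integrable lebesgue (\<lambda>x. (w x)\<^sup>2)" using assms by (simp add: square_integrable_def)
    show "AE x in lebesgue. norm ((f x)\<^sup>2) \<le> norm ((w x)\<^sup>2)"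
      using assms(3) by eventually_elim (simp add: abs_le_square_iff)
  qed (use assms in simp)
qed fact

quotient_type L2 = "real \<Rightarrow> real" /
  partial: "\<lambda>f g. square_integrable f \<and> square_integrable g \<and> (AE x in lebesgue. f x = g x)"
proof (rule part_equivpI)
  show "\<exists>f. square_integrable f \<and> square_integrable f \<and> (AE x in lebesgue. f x = f x)"
    by (rule exI[of _ "\<lambda>x. 0"]) simp
  show "symp (\<lambda>f g. square_integrable f \<and> square_integrable g \<and> (AE x in lebesgue. f x = g x))"
    by (auto simp: symp_def)
  show "transp (\<lambda>f g. square_integrable f \<and> square_integrable g \<and> (AE x in lebesgue. f x = g x))"
    by (rule transpI) (auto elim: AE_mp)
qed

text \<open>A chosen representative of the class; only its almost-everywhere properties matter.\<close>
abbreviation fun_of :: "L2 \<Rightarrow> real \<Rightarrow> real" where "fun_of \<equiv> rep_L2"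

text \<open>The class of \<open>f\<close>, with the default value 0 when \<open>f\<close> is not square integrable.\<close>
definition to_L2 :: "(real \<Rightarrow> real) \<Rightarrow> L2" where
  "to_L2 f = (if square_integrable f then abs_L2 f else abs_L2 (\<lambda>x. 0))"

lemma square_integrable_fun_of [simp]: "square_integrable (fun_of F)"
  using Quotient_rep_reflp[OF Quotient_L2] by blast

lemma abs_L2_fun_of [simp]: "abs_L2 (fun_of F) = F"
  by (rule Quotient_abs_rep[OF Quotient_L2])

lemma to_L2_fun_of [simp]: "to_L2 (fun_of F) = F"
  by (simp add: to_L2_def)

lemma fun_of_measurable [measurable]: "fun_of F \<in> borel_measurable lebesgue"
  using square_integrable_fun_of[of F] by (simp add: square_integrable_def)

lemma abs_L2_eq_iff:
  assumes "square_integrable f" "square_integrable g"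
  shows "abs_L2 f = abs_L2 g \<longleftrightarrow> (AE x in lebesgue. f x = g x)"
  using Quotient_rel[OF Quotient_L2, of f g] assms by auto

lemma fun_of_abs_L2:
  assumes "square_integrable f"
  shows "AE x in lebesgue. fun_of (abs_L2 f) x = f x"
  using abs_L2_eq_iff[of "fun_of (abs_L2 f)" f] assms by simp

lemma fun_of_to_L2:
  assumes "square_integrable f"
  shows "AE x in lebesgue. fun_of (to_L2 f) x = f x"
  using fun_of_abs_L2[OF assms] assms by (simp add: to_L2_def)

lemma L2_eq_iff: "F = G \<longleftrightarrow> (AE x in lebesgue. fun_of F x = fun_of G x)"
  using abs_L2_eq_iff[of "fun_of F" "fun_of G"] by simp

instantiation L2 :: real_vector
begin

lift_definition zero_L2 :: L2 is "\<lambda>x. 0" by simp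

lift_definition plus_L2 :: "L2 \<Rightarrow> L2 \<Rightarrow> L2" is "\<lambda>f g x. f x + g x"
  by (auto simp: square_integrable_add elim!: eventually_elim2)

lift_definition uminus_L2 :: "L2 \<Rightarrow> L2" is "\<lambda>f x. - f x"
  by (auto simp: square_integrable_uminus)

lift_definition minus_L2 :: "L2 \<Rightarrow> L2 \<Rightarrow> L2" is "\<lambda>f g x. f x - g x"
  by (auto simp: square_integrable_diff elim!: eventually_elim2)

lift_definition scaleR_L2 :: "real \<Rightarrow> L2 \<Rightarrow> L2" is "\<lambda>c f x. c * f x"
  by (auto simp: square_integrable_scale elim!: eventually_mono)

instance
  by standard
    (transfer; auto simp: square_integrable_add square_integrable_diff square_integrable_uminus
      square_integrable_scale algebra_simps)+

end

lemma fun_of_zero: "AE x in lebesgue. fun_of 0 x = 0"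
  unfolding zero_L2_def by (simp add: fun_of_abs_L2)

lemma fun_of_add: "AE x in lebesgue. fun_of (F + G) x = fun_of F x + fun_of G x"
  unfolding plus_L2_def by (simp add: fun_of_abs_L2 square_integrable_add)

lemma fun_of_uminus: "AE x in lebesgue. fun_of (- F) x = - fun_of F x"
  unfolding uminus_L2_def by (simp add: fun_of_abs_L2 square_integrable_uminus)

lemma fun_of_diff: "AE x in lebesgue. fun_of (F - G) x = fun_of F x - fun_of G x"
  unfolding minus_L2_def by (simp add: fun_of_abs_L2 square_integrable_diff)

lemma fun_of_scaleR: "AE x in lebesgue. fun_of (c *\<^sub>R F) x = c * fun_of F x"
  unfolding scaleR_L2_def by (simp add: fun_of_abs_L2 square_integrable_scale)

instantiation L2 :: real_inner
begin

definition inner_L2 :: "L2 \<Rightarrow> L2 \<Rightarrow> real" where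
  "inner_L2 F G = (LINT x|lebesgue. fun_of F x * fun_of G x)"

definition norm_L2 :: "L2 \<Rightarrow> real" where
  "norm_L2 F = sqrt (F \<bullet> F)"

definition dist_L2 :: "L2 \<Rightarrow> L2 \<Rightarrow> real" where
  "dist_L2 F G = norm (F - G)"

definition sgn_L2 :: "L2 \<Rightarrow> L2" where
  "sgn_L2 F = F /\<^sub>R norm F"

definition uniformity_L2 :: "(L2 \<times> L2) filter" where
  "uniformity_L2 = (INF e\<in>{0<..}. principal {(x, y). dist x y < e})"

definition open_L2 :: "L2 set \<Rightarrow> bool" where
  "open_L2 U = (\<forall>x\<in>U. eventually (\<lambda>(x', y). x' = x \<longrightarrow> y \<in> U) uniformity)"

instance
proof
  fix F G K :: L2 and r :: real
  note int = square_integrable_mult[OF square_integrable_fun_of square_integrable_fun_of]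
  show "dist F G = norm (F - G)" by (rule dist_L2_def)
  show "sgn F = F /\<^sub>R norm F" by (rule sgn_L2_def)
  show "uniformity = (INF e\<in>{0<..}. principal {(x, y). dist x (y::L2) < e})"
    by (rule uniformity_L2_def)
  show "open U = (\<forall>x\<in>U. eventually (\<lambda>(x', y). x' = x \<longrightarrow> y \<in> U) uniformity)" for U :: "L2 set"
    by (rule open_L2_def)
  show "F \<bullet> G = G \<bullet> F" by (simp add: inner_L2_def mult.commute)
  have "(F + G) \<bullet> K = (LINT x|lebesgue. fun_of F x * fun_of K x + fun_of G x * fun_of K x)"
    unfolding inner_L2_def
    by (rule integral_cong_AE) (use fun_of_add[of F G] in \<open>auto simp: algebra_simps\<close>)
  then show "(F + G) \<bullet> K = F \<bullet> K + G \<bullet> K"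
    by (simp add: inner_L2_def int)
  have "(r *\<^sub>R F) \<bullet> G = (LINT x|lebesgue. r * (fun_of F x * fun_of G x))"
    unfolding inner_L2_def
    by (rule integral_cong_AE) (use fun_of_scaleR[of r F] in \<open>auto simp: algebra_simps\<close>)
  then show "(r *\<^sub>R F) \<bullet> G = r * (F \<bullet> G)"
    by (simp add: inner_L2_def)
  show "0 \<le> F \<bullet> F" by (simp add: inner_L2_def)
  have "F \<bullet> F = 0 \<longleftrightarrow> (AE x in lebesgue. fun_of F x * fun_of F x = 0)"
    unfolding inner_L2_def by (rule integral_nonneg_eq_0_iff_AE) (auto simp: int)
  also have "\<dots> \<longleftrightarrow> F = 0"
    unfolding L2_eq_iff[of F 0] using fun_of_zero by (auto elim: eventually_elim2)
  finally show "F \<bullet> F = 0 \<longleftrightarrow> F = 0" .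
  show "norm F = sqrt (F \<bullet> F)" by (rule norm_L2_def)
qed

end

lemma norm_L2_sq: "(norm (F :: L2))\<^sup>2 = (LINT x|lebesgue. (fun_of F x)\<^sup>2)"
  unfolding power2_norm_eq_inner inner_L2_def by (simp add: power2_eq_square)

lemma norm_to_L2_sq:
  assumes "square_integrable f"
  shows "(norm (to_L2 f))\<^sup>2 = (LINT x|lebesgue. (f x)\<^sup>2)"
  unfolding norm_L2_sq
  by (rule integral_cong_AE)
    (use assms fun_of_to_L2[OF assms] in \<open>auto simp: square_integrable_def\<close>)

lemma nn_integral_to_L2:
  assumes "square_integrable f"
  shows "(\<integral>\<^sup>+x. ennreal ((f x)\<^sup>2) \<partial>lebesgue) = ennreal ((norm (to_L2 f))\<^sup>2)"
  unfolding norm_to_L2_sq[OF assms]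
  by (rule nn_integral_eq_integral) (use assms in \<open>auto simp: square_integrable_def\<close>)

lemma to_L2_cong:
  assumes "AE x in lebesgue. f x = g x" "square_integrable f" "square_integrable g"
  shows "to_L2 f = to_L2 g"
  using assms by (simp add: to_L2_def abs_L2_eq_iff)

lemma to_L2_zero [simp]: "to_L2 (\<lambda>x. 0) = 0"
  by (simp add: to_L2_def zero_L2_def)

lemma to_L2_add:
  assumes "square_integrable f" "square_integrable g"
  shows "to_L2 (\<lambda>x. f x + g x) = to_L2 f + to_L2 g"
proof -
  have "AE x in lebesgue. fun_of (to_L2 (\<lambda>x. f x + g x)) x = fun_of (to_L2 f + to_L2 g) x"
    using fun_of_to_L2[OF square_integrable_add[OF assms]] fun_of_to_L2[OF assms(1)]
      fun_of_to_L2[OF assms(2)] fun_of_add[of "to_L2 f" "to_L2 g"] by eventually_elim simp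
  then show ?thesis by (simp only: L2_eq_iff)
qed

lemma to_L2_scale:
  assumes "square_integrable f"
  shows "to_L2 (\<lambda>x. c * f x) = c *\<^sub>R to_L2 f"
proof -
  have "AE x in lebesgue. fun_of (to_L2 (\<lambda>x. c * f x)) x = fun_of (c *\<^sub>R to_L2 f) x"
    using fun_of_to_L2[OF square_integrable_scale[OF assms]] fun_of_to_L2[OF assms(1)]
      fun_of_scaleR[of c "to_L2 f"] by eventually_elim simp
  then show ?thesis by (simp only: L2_eq_iff)
qed

lemma to_L2_diff:
  assumes "square_integrable f" "square_integrable g"
  shows "to_L2 (\<lambda>x. f x - g x) = to_L2 f - to_L2 g"
  using to_L2_add[OF assms(1) square_integrable_scale[OF assms(2), of "-1"]]
    to_L2_scale[OF assms(2), of "-1"] by simp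

text \<open>The Riesz--Fischer theorem.\<close>

instance L2 :: banach
proof
  fix X :: "nat \<Rightarrow> L2"
  assume X: "Cauchy X"
  have "\<exists>M. \<forall>m\<ge>M. \<forall>n\<ge>M. norm (X m - X n) < (1/2) ^ k" for k
    using X by (simp add: Cauchy_iff)
  then obtain M where M: "\<And>k m n. M k \<le> m \<Longrightarrow> M k \<le> n \<Longrightarrow> norm (X m - X n) < (1/2) ^ k"
    by metis
  define s where "s k = k + (\<Sum>i\<le>k. M i)" for k
  have s_ge: "M k \<le> s k" for k
    unfolding s_def by (intro trans_le_add2 member_le_sum) auto
  have s_mono: "s j \<le> s k" if "j \<le> k" for j k
    unfolding s_def using that by (intro add_mono sum_mono2) auto
  define Y where "Y k = X (s k)" for k
  have Y: "norm (Y m - Y n) < (1/2) ^ k" if "k \<le> m" "k \<le> n" for k m n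
    unfolding Y_def using that
    by (intro M) (meson order_trans s_ge s_mono)+
  define d where "d k x = \<bar>fun_of (Y (Suc k)) x - fun_of (Y k) x\<bar>" for k x
  have d_sq: "square_integrable (d k)" for k
    by (rule square_integrable_bound[where w = "\<lambda>x. fun_of (Y (Suc k)) x - fun_of (Y k) x"])
      (auto simp: d_def[abs_def] square_integrable_diff)
  have norm_d: "norm (to_L2 (d k)) = norm (Y (Suc k) - Y k)" for k
  proof -
    have "(norm (to_L2 (d k)))\<^sup>2 = (norm (Y (Suc k) - Y k))\<^sup>2"
      unfolding norm_to_L2_sq[OF d_sq] norm_L2_sq[of "Y (Suc k) - Y k"]
      by (rule integral_cong_AE)
        (use fun_of_diff[of "Y (Suc k)" "Y k"] d_sq in \<open>auto simp: d_def square_integrable_def\<close>)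
    then show ?thesis by simp
  qed
  define p where "p N x = (\<Sum>k<N. d k x)" for N x
  have p: "square_integrable (p N) \<and> norm (to_L2 (p N)) \<le> (\<Sum>k<N. (1/2) ^ k)" for N
  proof (induction N)
    case 0
    then show ?case by (simp add: p_def)
  next
    case (Suc N)
    have eq: "p (Suc N) = (\<lambda>x. p N x + d N x)" by (simp add: p_def fun_eq_iff)
    have "norm (to_L2 (p (Suc N))) \<le> norm (to_L2 (p N)) + norm (to_L2 (d N))"
      unfolding eq using Suc d_sq by (simp add: to_L2_add norm_triangle_ineq)
    moreover have "norm (to_L2 (d N)) \<le> (1/2) ^ N"
      unfolding norm_d using Y[of N "Suc N" N] by simp
    ultimately show ?case
      using Suc d_sq by (simp add: eq square_integrable_add)
  qed
  have p_meas [measurable]: "p N \<in> borel_measurable lebesgue" for N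
    using p by (simp add: square_integrable_def)
  have p_nonneg: "0 \<le> p N x" for N x unfolding p_def d_def by (simp add: sum_nonneg)
  have p_mono: "p N x \<le> p N' x" if "N \<le> N'" for N N' x
    unfolding p_def using that by (intro sum_mono2) (auto simp: d_def)
  have p_bound: "(\<integral>\<^sup>+x. ennreal ((p N x)\<^sup>2) \<partial>lebesgue) \<le> 4" for N
  proof -
    have "(\<Sum>k<N. (1/2::real) ^ k) \<le> (\<Sum>k. (1/2) ^ k)"
      by (rule sum_le_suminf) auto
    then have "norm (to_L2 (p N)) \<le> 2"
      using p[of N] by (simp add: suminf_geometric)
    then have "(norm (to_L2 (p N)))\<^sup>2 \<le> 2\<^sup>2" by (intro power_mono) auto
    then have "ennreal ((norm (to_L2 (p N)))\<^sup>2) \<le> ennreal 4" by (intro ennreal_leI) simp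
    then show ?thesis using nn_integral_to_L2[of "p N"] p by simp
  qed
  have "(\<integral>\<^sup>+x. (SUP N. ennreal ((p N x)\<^sup>2)) \<partial>lebesgue) = (SUP N. \<integral>\<^sup>+x. ennreal ((p N x)\<^sup>2) \<partial>lebesgue)"
    by (rule nn_integral_monotone_convergence_SUP)
      (auto intro!: incseq_SucI le_funI ennreal_leI power_mono p_mono p_nonneg)
  also have "\<dots> \<le> 4" by (rule SUP_least) (rule p_bound)
  finally have "(\<integral>\<^sup>+x. (SUP N. ennreal ((p N x)\<^sup>2)) \<partial>lebesgue) \<noteq> \<infinity>"
    by (auto simp: top_unique)
  then have fin: "AE x in lebesgue. (SUP N. ennreal ((p N x)\<^sup>2)) \<noteq> \<infinity>"
    by (intro nn_integral_PInf_AE) auto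
  define g where "g x = lim (\<lambda>k. fun_of (Y k) x)" for x
  have lim: "AE x in lebesgue. (\<lambda>k. fun_of (Y k) x) \<longlonglongrightarrow> g x"
    using fin
  proof eventually_elim
    case (elim x)
    then obtain B where B: "0 \<le> B" "(SUP N. ennreal ((p N x)\<^sup>2)) = ennreal B"
      by (cases "SUP N. ennreal ((p N x)\<^sup>2)") auto
    have "(p N x)\<^sup>2 \<le> B" for N
    proof -
      have "ennreal ((p N x)\<^sup>2) \<le> ennreal B"
        unfolding B(2)[symmetric] by (rule SUP_upper) simp
      then show ?thesis using B(1) by simp
    qed
    then have "p N x \<le> sqrt B" for N
      by (meson real_le_rsqrt)
    then have "summable (\<lambda>k. d k x)"
      by (intro summableI_nonneg_bounded[where x = "sqrt B"]) (auto simp: d_def p_def)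
    then have "summable (\<lambda>k. fun_of (Y (Suc k)) x - fun_of (Y k) x)"
      unfolding d_def by (rule summable_rabs_cancel)
    then have "convergent (\<lambda>n. (\<Sum>k<n. fun_of (Y (Suc k)) x - fun_of (Y k) x))"
      by (simp add: summable_iff_convergent)
    then have "convergent (\<lambda>n. fun_of (Y n) x - fun_of (Y 0) x)"
      by (simp add: sum_lessThan_telescope[of "\<lambda>n. fun_of (Y n) x"])
    then have "convergent (\<lambda>n. (fun_of (Y n) x - fun_of (Y 0) x) + fun_of (Y 0) x)"
      by (rule convergent_add) (rule convergent_const)
    then show ?case by (simp add: g_def convergent_LIMSEQ_iff)
  qed
  have g_meas [measurable]: "g \<in> borel_measurable lebesgue"
    unfolding g_def by measurable
  have fatou: "(\<integral>\<^sup>+x. ennreal ((g x - fun_of (Y k) x)\<^sup>2) \<partial>lebesgue) \<le> ennreal (((1/2) ^ k)\<^sup>2)" for k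
  proof -
    have "(\<integral>\<^sup>+x. ennreal ((g x - fun_of (Y k) x)\<^sup>2) \<partial>lebesgue)
        = (\<integral>\<^sup>+x. liminf (\<lambda>m. ennreal ((fun_of (Y m) x - fun_of (Y k) x)\<^sup>2)) \<partial>lebesgue)"
    proof (rule nn_integral_cong_AE, use lim in eventually_elim)
      case (elim x)
      have "(\<lambda>m. ennreal ((fun_of (Y m) x - fun_of (Y k) x)\<^sup>2))
          \<longlonglongrightarrow> ennreal ((g x - fun_of (Y k) x)\<^sup>2)"
        by (intro tendsto_intros elim tendsto_ennrealI)
      then show ?case
        by (metis lim_imp_Liminf sequentially_bot)
    qed
    also have "\<dots> \<le> liminf (\<lambda>m. \<integral>\<^sup>+x. ennreal ((fun_of (Y m) x - fun_of (Y k) x)\<^sup>2) \<partial>lebesgue)"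
      by (rule nn_integral_liminf) measurable
    also have "\<dots> \<le> limsup (\<lambda>m. \<integral>\<^sup>+x. ennreal ((fun_of (Y m) x - fun_of (Y k) x)\<^sup>2) \<partial>lebesgue)"
      by (rule Liminf_le_Limsup) simp
    also have "\<dots> \<le> ennreal (((1/2) ^ k)\<^sup>2)"
    proof (rule Limsup_bounded, rule eventually_sequentiallyI[of k])
      fix m assume "k \<le> m"
      have "(\<integral>\<^sup>+x. ennreal ((fun_of (Y m) x - fun_of (Y k) x)\<^sup>2) \<partial>lebesgue)
          = ennreal ((norm (to_L2 (\<lambda>x. fun_of (Y m) x - fun_of (Y k) x)))\<^sup>2)"
        by (rule nn_integral_to_L2) (simp add: square_integrable_diff)
      also have "\<dots> = ennreal ((norm (Y m - Y k))\<^sup>2)"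
        by (simp add: to_L2_diff)
      also have "\<dots> \<le> ennreal (((1/2) ^ k)\<^sup>2)"
        using Y[of k m k] \<open>k \<le> m\<close> by (intro ennreal_leI power_mono) auto
      finally show "(\<integral>\<^sup>+x. ennreal ((fun_of (Y m) x - fun_of (Y k) x)\<^sup>2) \<partial>lebesgue)
          \<le> ennreal (((1/2) ^ k)\<^sup>2)" .
    qed
    finally show ?thesis .
  qed
  have diff_sq: "square_integrable (\<lambda>x. g x - fun_of (Y k) x)" for k
    unfolding square_integrable_def
  proof (intro conjI integrableI_nonneg)
    show "(\<integral>\<^sup>+x. ennreal ((g x - fun_of (Y k) x)\<^sup>2) \<partial>lebesgue) < \<infinity>"
      by (rule le_less_trans[OF fatou]) simp
  qed auto
  have g_sq: "square_integrable g"
    using square_integrable_add[OF diff_sq[of 0] square_integrable_fun_of[of "Y 0"]] by simp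
  have conv: "norm (to_L2 g - Y k) \<le> (1/2) ^ k" for k
  proof -
    have "ennreal ((norm (to_L2 (\<lambda>x. g x - fun_of (Y k) x)))\<^sup>2) \<le> ennreal (((1/2) ^ k)\<^sup>2)"
      using fatou[of k] nn_integral_to_L2[OF diff_sq[of k]] by simp
    then have "(norm (to_L2 g - Y k))\<^sup>2 \<le> ((1/2) ^ k)\<^sup>2"
      by (simp add: to_L2_diff g_sq)
    then show ?thesis by (rule power2_le_imp_le) simp
  qed
  have "X \<longlonglongrightarrow> to_L2 g"
  proof (rule LIMSEQ_I)
    fix e :: real assume "0 < e"
    then obtain k where k: "(1/2) ^ k < e / 2"
      using real_arch_pow_inv[of "e/2" "1/2"] by auto
    have "norm (X n - to_L2 g) < e" if "M k \<le> n" for n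
    proof -
      have "norm (X n - to_L2 g) \<le> norm (X n - Y k) + norm (Y k - to_L2 g)"
        using norm_triangle_ineq[of "X n - Y k" "Y k - to_L2 g"] by simp
      moreover have "norm (X n - Y k) < (1/2) ^ k"
        unfolding Y_def by (rule M) (use that s_ge in auto)
      ultimately show ?thesis using conv[of k] k by (simp add: norm_minus_commute)
    qed
    then show "\<exists>N. \<forall>n\<ge>N. norm (X n - to_L2 g) < e" by blast
  qed
  then show "convergent X" by (rule convergentI)
qed

lemma L2_dominated_convergence:
  assumes "\<And>n. f n \<in> borel_measurable lebesgue" "g \<in> borel_measurable lebesgue"
    and w: "square_integrable w"
    and bd: "\<And>n. AE x in lebesgue. \<bar>f n x\<bar> \<le> \<bar>w x\<bar>"
    and lim: "AE x in lebesgue. (\<lambda>n. f n x) \<longlonglongrightarrow> g x"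
  shows "(\<lambda>n. to_L2 (f n)) \<longlonglongrightarrow> to_L2 g"
proof -
  have [measurable]: "f n \<in> borel_measurable lebesgue" "g \<in> borel_measurable lebesgue" for n
    by fact+
  have f_sq: "square_integrable (f n)" for n
    by (rule square_integrable_bound[OF _ w bd]) simp
  have gbd: "AE x in lebesgue. \<bar>g x\<bar> \<le> \<bar>w x\<bar>"
  proof -
    have "AE x in lebesgue. \<forall>n. \<bar>f n x\<bar> \<le> \<bar>w x\<bar>" using bd by (simp add: AE_all_countable)
    then show ?thesis using lim
    proof eventually_elim
      case (elim x)
      then show ?case by (intro LIMSEQ_le_const2[OF tendsto_rabs[OF elim(2)]]) auto
    qed
  qed
  have g_sq: "square_integrable g"
    by (rule square_integrable_bound[OF _ w gbd]) simp
  have "(\<lambda>n. LINT x|lebesgue. (f n x - g x)\<^sup>2) \<longlonglongrightarrow> (LINT x|(lebesgue :: real measure). 0)"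
  proof (rule integral_dominated_convergence)
    show "integrable lebesgue (\<lambda>x. 4 * (w x)\<^sup>2)" using w by (simp add: square_integrable_def)
    show "AE x in lebesgue. (\<lambda>n. (f n x - g x)\<^sup>2) \<longlonglongrightarrow> 0"
      using lim
    proof eventually_elim
      case (elim x)
      have "(\<lambda>n. (f n x - g x)\<^sup>2) \<longlonglongrightarrow> (g x - g x)\<^sup>2" by (intro tendsto_intros elim)
      then show ?case by simp
    qed
    fix n
    show "AE x in lebesgue. norm ((f n x - g x)\<^sup>2) \<le> 4 * (w x)\<^sup>2"
      using bd[of n] gbd
    proof eventually_elim
      case (elim x)
      then have "\<bar>f n x - g x\<bar> \<le> 2 * \<bar>w x\<bar>" by linarith
      then have "\<bar>f n x - g x\<bar>\<^sup>2 \<le> (2 * \<bar>w x\<bar>)\<^sup>2" by (intro power_mono) auto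
      then show ?case by (simp add: power_mult_distrib)
    qed
  qed auto
  moreover have "(LINT x|lebesgue. (f n x - g x)\<^sup>2) = (norm (to_L2 (f n) - to_L2 g))\<^sup>2" for n
    using norm_to_L2_sq[OF square_integrable_diff[OF f_sq g_sq]] by (simp add: to_L2_diff f_sq g_sq)
  ultimately have "(\<lambda>n. (norm (to_L2 (f n) - to_L2 g))\<^sup>2) \<longlonglongrightarrow> 0" by simp
  then have "(\<lambda>n. sqrt ((norm (to_L2 (f n) - to_L2 g))\<^sup>2)) \<longlonglongrightarrow> sqrt 0"
    by (rule tendsto_real_sqrt)
  then have "(\<lambda>n. norm (to_L2 (f n) - to_L2 g)) \<longlonglongrightarrow> 0" by simp
  then show ?thesis by (simp add: tendsto_norm_zero_iff LIM_zero_iff)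
qed

text \<open>Separability: needed for the Bochner integral of functions with values in \<open>L2\<close>.\<close>

lemma L2_separable: "\<exists>D :: L2 set. countable D \<and> closure D = UNIV"
proof -
  obtain B :: "real set set" where B: "countable B" "topological_basis B"
    using ex_countable_basis by blast
  define P where "P = Inter ` {F. finite F \<and> F \<subseteq> B}"
  have P_count: "countable P"
    unfolding P_def by (intro countable_image countable_Collect_finite_subset B)
  have P_borel: "P \<subseteq> sets borel"
    unfolding P_def using topological_basis_open[OF B(2)]
    by (auto intro!: borel_open open_Inter)
  have P_UNIV: "UNIV \<in> P" unfolding P_def by (rule image_eqI[of _ _ "{}"]) auto
  have B_sub_P: "B \<subseteq> P"
    unfolding P_def
  proof
    fix b assume "b \<in> B"
    then show "b \<in> Inter ` {F. finite F \<and> F \<subseteq> B}" by (intro image_eqI[of _ _ "{b}"]) auto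
  qed
  have P_Int: "Int_stable P"
  proof (rule Int_stableI)
    fix a b assume "a \<in> P" "b \<in> P"
    then obtain F G where "finite F" "F \<subseteq> B" "a = \<Inter>F" "finite G" "G \<subseteq> B" "b = \<Inter>G"
      unfolding P_def by blast
    then show "a \<inter> b \<in> P" unfolding P_def by (intro image_eqI[of _ _ "F \<union> G"]) auto
  qed
  have P_gen: "sets borel = sigma_sets UNIV P"
  proof
    have "sets borel = sigma_sets UNIV B"
      by (simp add: borel_eq_countable_basis[OF B])
    also have "\<dots> \<subseteq> sigma_sets UNIV P" by (rule sigma_sets_mono') (rule B_sub_P)
    finally show "sets borel \<subseteq> sigma_sets UNIV P" .
    show "sigma_sets UNIV P \<subseteq> sets borel"
      using sets.sigma_sets_subset[OF P_borel] by simp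
  qed
  define I where "I n A = (indicator (A \<inter> {- real n..real n}) :: real \<Rightarrow> real)" for n :: nat and A
  have I_sq: "square_integrable (I n A)" if "A \<in> sets borel" for n A
  proof -
    have [measurable]: "A \<in> sets lebesgue" using that by simp
    have "integrable lebesgue (I n A)"
      unfolding I_def
    proof (rule integrable_real_indicator)
      have "emeasure lebesgue (A \<inter> {- real n..real n}) \<le> emeasure lebesgue {- real n..real n}"
        by (rule emeasure_mono) auto
      also have "\<dots> < \<infinity>" by simp
      finally show "emeasure lebesgue (A \<inter> {- real n..real n}) < \<infinity>" .
      show "A \<inter> {- real n..real n} \<in> sets lebesgue"
        using that by (intro sets_completionI_sets) auto
    qed
    moreover have "(\<lambda>x. (I n A x)\<^sup>2) = I n A"
      by (auto simp: I_def indicator_def fun_eq_iff)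
    ultimately show ?thesis by (auto simp: square_integrable_def)
  qed
  define G where "G = (\<lambda>(n, A). to_L2 (I n A)) ` (UNIV \<times> P)"
  define D where
    "D = (\<lambda>xs. sum_list (map (\<lambda>(q, g). q *\<^sub>R g) xs)) ` lists (\<rat> \<times> G)"
  have D_count: "countable D"
    unfolding D_def G_def by (intro countable_image countable_lists countable_SIGMA P_count countable_rat) auto
  have D_add: "x + y \<in> D" if "x \<in> D" "y \<in> D" for x y
  proof -
    from that obtain xs ys where "xs \<in> lists (\<rat> \<times> G)" "ys \<in> lists (\<rat> \<times> G)"
      "x = sum_list (map (\<lambda>(q, g). q *\<^sub>R g) xs)" "y = sum_list (map (\<lambda>(q, g). q *\<^sub>R g) ys)"
      unfolding D_def image_iff by metis
    then show ?thesis unfolding D_def by (intro image_eqI[of _ _ "xs @ ys"]) auto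
  qed
  have D_scale: "q *\<^sub>R x \<in> D" if "q \<in> \<rat>" "x \<in> D" for q x
  proof -
    from that(2) obtain xs where xs: "xs \<in> lists (\<rat> \<times> G)" "x = sum_list (map (\<lambda>(q, g). q *\<^sub>R g) xs)"
      unfolding D_def image_iff by metis
    have "q *\<^sub>R x = sum_list (map (\<lambda>(q, g). q *\<^sub>R g) (map (\<lambda>(p, g). (q * p, g)) xs))"
      unfolding xs(2) by (induction xs) (auto simp: scaleR_add_right)
    moreover have "map (\<lambda>(p, g). (q * p, g)) xs \<in> lists (\<rat> \<times> G)"
      using xs(1) that(1) by (auto simp: in_lists_conv_set)
    ultimately show ?thesis unfolding D_def by blast
  qed
  have D_zero: "0 \<in> D" unfolding D_def by (rule image_eqI[of _ _ "[]"]) auto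
  have G_D: "G \<subseteq> D"
  proof
    fix g assume "g \<in> G"
    then show "g \<in> D" unfolding D_def by (intro image_eqI[of _ _ "[(1, g)]"]) auto
  qed
  let ?C = "closure D"
  have C_add: "x + y \<in> ?C" if xy: "x \<in> ?C" "y \<in> ?C" for x y
  proof -
    obtain X Y where "\<And>n. X n \<in> D" "X \<longlonglongrightarrow> x" "\<And>n. Y n \<in> D" "Y \<longlonglongrightarrow> y"
      using xy unfolding closure_sequential by blast
    then show ?thesis unfolding closure_sequential
      by (intro exI[of _ "\<lambda>n. X n + Y n"]) (auto intro: D_add tendsto_add)
  qed
  have C_scale: "c *\<^sub>R x \<in> ?C" if x: "x \<in> ?C" for c x
  proof -
    obtain X where X: "\<And>n. X n \<in> D" "X \<longlonglongrightarrow> x"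
      using x unfolding closure_sequential by blast
    have "c \<in> closure \<rat>"
      unfolding closure_approachable
    proof (intro allI impI)
      fix e :: real assume "0 < e"
      then obtain q where "q \<in> \<rat>" "c < q" "q < c + e"
        using Rats_dense_in_real[of c "c + e"] by auto
      then show "\<exists>q\<in>\<rat>. dist q c < e" by (intro bexI[of _ q]) (auto simp: dist_real_def)
    qed
    then obtain q where q: "\<And>n::nat. q n \<in> \<rat>" "q \<longlonglongrightarrow> c"
      unfolding closure_sequential by blast
    show ?thesis unfolding closure_sequential
      by (intro exI[of _ "\<lambda>n. q n *\<^sub>R X n"]) (auto intro: D_scale X q tendsto_scaleR)
  qed
  have C_zero: "0 \<in> ?C" using D_zero closure_subset by blast
  have C_sum: "sum f A \<in> ?C" if "finite A" "\<And>a. a \<in> A \<Longrightarrow> f a \<in> ?C" for f :: "real \<Rightarrow> L2" and A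
    using that by (induction A rule: finite_induct) (auto intro: C_zero C_add)
  have C_lim: "x \<in> ?C" if "\<And>n. X n \<in> ?C" "X \<longlonglongrightarrow> x" for X x
    using closed_sequentially[OF closed_closure] that by blast
  have I_C: "to_L2 (I n A) \<in> ?C" if "A \<in> sets borel" for n A
  proof -
    have "P \<subseteq> Pow UNIV" "A \<in> sigma_sets UNIV P" using that P_gen by simp_all
    with P_Int show ?thesis
    proof (induction rule: sigma_sets_induct_disjoint)
      case (basic A)
      then show ?case using G_D closure_subset unfolding G_def by force
    next
      case empty
      have "I n {} = (\<lambda>x. 0)" by (simp add: I_def fun_eq_iff)
      then show ?case using C_zero by simp
    next
      case (compl A)
      then have A: "A \<in> sets borel" using P_gen by simp
      have "I n (UNIV - A) = (\<lambda>x. I n UNIV x - I n A x)"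
        by (auto simp: I_def indicator_def fun_eq_iff)
      then have "to_L2 (I n (UNIV - A)) = to_L2 (I n UNIV) + (-1) *\<^sub>R to_L2 (I n A)"
        using A by (simp add: to_L2_diff I_sq)
      moreover have "to_L2 (I n UNIV) \<in> ?C"
        using G_D closure_subset P_UNIV unfolding G_def by force
      ultimately show ?case using compl C_add C_scale by metis
    next
      case (union A)
      have A: "A i \<in> sets borel" for i using union(2) P_gen by auto
      have fin: "to_L2 (I n (\<Union>i<k. A i)) \<in> ?C" for k
      proof (induction k)
        case 0
        have "I n {} = (\<lambda>x. 0)" by (simp add: I_def fun_eq_iff)
        then show ?case using C_zero by simp
      next
        case (Suc k)
        have "A k \<inter> A i = {}" if "i < k" for i
          using union(1) that by (simp add: disjoint_family_on_def)
        then have dj: "A k \<inter> (\<Union>i<k. A i) = {}" by blast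
        have "I n (\<Union>i<Suc k. A i) = (\<lambda>x. I n (\<Union>i<k. A i) x + I n (A k) x)"
        proof
          fix x
          show "I n (\<Union>i<Suc k. A i) x = I n (\<Union>i<k. A i) x + I n (A k) x"
          proof (cases "x \<in> A k")
            case True
            then have "x \<notin> (\<Union>i<k. A i)" using dj by blast
            with True show ?thesis by (simp add: I_def indicator_def lessThan_Suc)
          next
            case False
            then show ?thesis by (simp add: I_def indicator_def lessThan_Suc)
          qed
        qed
        moreover have "(\<Union>i<k. A i) \<in> sets borel" using A by auto
        ultimately have "to_L2 (I n (\<Union>i<Suc k. A i)) = to_L2 (I n (\<Union>i<k. A i)) + to_L2 (I n (A k))"
          using A by (simp add: to_L2_add I_sq)
        then show ?case using Suc union(3) C_add by metis
      qed
      have "(\<lambda>k. to_L2 (I n (\<Union>i<k. A i))) \<longlonglongrightarrow> to_L2 (I n (\<Union>i. A i))"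
      proof (rule L2_dominated_convergence[where w = "I n UNIV"])
        show "I n (\<Union>i<k. A i) \<in> borel_measurable lebesgue" for k
          using I_sq[of "\<Union>i<k. A i" n] A by (auto simp: square_integrable_def)
        show "I n (\<Union>i. A i) \<in> borel_measurable lebesgue"
          using I_sq[of "\<Union>i. A i" n] A by (auto simp: square_integrable_def)
        show "square_integrable (I n UNIV)" by (rule I_sq) simp
        show "AE x in lebesgue. \<bar>I n (\<Union>i<k. A i) x\<bar> \<le> \<bar>I n UNIV x\<bar>" for k
          by (rule AE_I2) (auto simp: I_def indicator_def)
        show "AE x in lebesgue. (\<lambda>k. I n (\<Union>i<k. A i) x) \<longlonglongrightarrow> I n (\<Union>i. A i) x"
        proof (rule AE_I2)
          fix x
          show "(\<lambda>k. I n (\<Union>i<k. A i) x) \<longlonglongrightarrow> I n (\<Union>i. A i) x"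
          proof (cases "\<exists>i. x \<in> A i")
            case True
            then obtain i where "x \<in> A i" by blast
            then have "I n (\<Union>i<k. A i) x = I n (\<Union>i. A i) x" if "k > i" for k
              using that by (auto simp: I_def indicator_def)
            then show ?thesis
              by (intro tendsto_eventually) (auto simp: eventually_at_top_dense intro!: exI[of _ i])
          next
            case False
            then have "I n (\<Union>i<k. A i) x = I n (\<Union>i. A i) x" for k
              by (auto simp: I_def indicator_def)
            then show ?thesis by simp
          qed
        qed
      qed
      then show ?case by (rule C_lim[rotated]) (rule fin)
    qed
  qed
  have "F \<in> ?C" for F
  proof -
    obtain f where f: "f \<in> borel_measurable lborel" "AE x in lborel. fun_of F x = f x"
      using completion_ex_borel_measurable_real[OF fun_of_measurable[of F]] by auto
    have fm: "f \<in> borel_measurable borel" using f(1) by simp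
    have AE_f: "AE x in lebesgue. fun_of F x = f x" using f(2) by (rule AE_completion)
    have f_leb: "f \<in> borel_measurable lebesgue" using f(1) by (rule measurable_completion)
    have f_sq: "square_integrable f"
      by (rule square_integrable_bound[OF f_leb square_integrable_fun_of[of F]])
        (use AE_f in eventually_elim, simp)
    have F: "F = to_L2 f"
      using to_L2_cong[OF AE_f square_integrable_fun_of f_sq] by simp
    obtain S where S: "\<And>i. simple_function borel (S i)"
      "\<And>x. (\<lambda>i. S i x) \<longlonglongrightarrow> f x" "\<And>i x. norm (S i x) \<le> 2 * norm (f x)"
      using borel_measurable_implies_sequence_metric[OF fm, of 0] by (auto simp: dist_norm)
    define T where "T i x = S i x * I i UNIV x" for i x
    have T_meas: "T i \<in> borel_measurable lebesgue" for i
    proof -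
      have "S i \<in> borel_measurable borel" using S(1) by (rule borel_measurable_simple_function)
      then have "T i \<in> borel_measurable borel" unfolding T_def I_def by measurable
      then have "T i \<in> borel_measurable lborel" by simp
      then show ?thesis by (rule measurable_completion)
    qed
    have T_lim: "(\<lambda>i. to_L2 (T i)) \<longlonglongrightarrow> to_L2 f"
    proof (rule L2_dominated_convergence[where w = "\<lambda>x. 2 * f x"])
      show "T i \<in> borel_measurable lebesgue" for i by (rule T_meas)
      show "f \<in> borel_measurable lebesgue" by (rule f_leb)
      show "square_integrable (\<lambda>x. 2 * f x)" by (rule square_integrable_scale[OF f_sq])
      show "AE x in lebesgue. \<bar>T i x\<bar> \<le> \<bar>2 * f x\<bar>" for i
        by (rule AE_I2) (use S(3)[of i] in \<open>auto simp: T_def I_def indicator_def abs_mult\<close>)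
      show "AE x in lebesgue. (\<lambda>i. T i x) \<longlonglongrightarrow> f x"
      proof (rule AE_I2)
        fix x
        obtain N :: nat where N: "\<bar>x\<bar> \<le> real N" using real_arch_simple by blast
        have "\<forall>\<^sub>F i in sequentially. S i x = T i x"
          using eventually_ge_at_top[of N]
          by eventually_elim (use N in \<open>auto simp: T_def I_def indicator_def\<close>)
        then show "(\<lambda>i. T i x) \<longlonglongrightarrow> f x" using S(2) by (rule Lim_transform_eventually[rotated])
      qed
    qed
    have T_C: "to_L2 (T i) \<in> ?C" for i
    proof -
      have fin: "finite (range (S i))" using simple_functionD(1)[OF S(1)[of i]] by simp
      have sets: "S i -` {y} \<in> sets borel" for y
        using simple_functionD(2)[OF S(1)[of i], of "{y}"] by simp
      have rep: "T i = (\<lambda>x. \<Sum>y\<in>range (S i). y * I i (S i -` {y}) x)"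
      proof
        fix x
        have "(\<Sum>y\<in>range (S i). y * I i (S i -` {y}) x)
            = (\<Sum>y\<in>range (S i). if y = S i x then S i x * I i UNIV x else 0)"
          by (rule sum.cong) (auto simp: I_def indicator_def)
        also have "\<dots> = T i x" using fin by (simp add: T_def)
        finally show "T i x = (\<Sum>y\<in>range (S i). y * I i (S i -` {y}) x)" ..
      qed
      have "square_integrable (\<lambda>x. \<Sum>y\<in>K. y * I i (S i -` {y}) x) \<and>
          to_L2 (\<lambda>x. \<Sum>y\<in>K. y * I i (S i -` {y}) x) = (\<Sum>y\<in>K. y *\<^sub>R to_L2 (I i (S i -` {y})))"
        if "finite K" for K
        using that
        by (induction K rule: finite_induct)
          (auto simp: to_L2_add to_L2_scale square_integrable_add square_integrable_scale I_sq sets)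
      then have "to_L2 (T i) = (\<Sum>y\<in>range (S i). y *\<^sub>R to_L2 (I i (S i -` {y})))"
        using fin unfolding rep by blast
      then show ?thesis using fin by (simp add: C_sum C_scale I_C sets)
    qed
    have "to_L2 f \<in> ?C" using T_lim by (rule C_lim[rotated]) (rule T_C)
    then show ?thesis by (simp only: F[symmetric])
  qed
  then show ?thesis using D_count by blast
qed

instance L2 :: second_countable_topology
proof
  obtain D :: "L2 set" where D: "countable D" "closure D = UNIV" using L2_separable by blast
  define B where "B = (\<lambda>(d, q). ball d q) ` (D \<times> \<rat>)"
  have "topological_basis B"
  proof (rule topological_basisI)
    show "open b" if "b \<in> B" for b using that unfolding B_def by auto
    fix U :: "L2 set" and x assume U: "open U" "x \<in> U"
    then obtain e where e: "e > 0" "ball x e \<subseteq> U" by (meson open_contains_ball)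
    obtain q where q: "q \<in> \<rat>" "e / 4 < q" "q < e / 2"
      using Rats_dense_in_real[of "e/4" "e/2"] e by auto
    have "x \<in> closure D" using D by simp
    then obtain d where d: "d \<in> D" "dist d x < q"
      using q e unfolding closure_approachable by (meson less_trans divide_pos_pos zero_less_numeral)
    have "ball d q \<subseteq> U"
    proof
      fix y assume "y \<in> ball d q"
      then have "dist x y < e"
        using d q dist_triangle[of x y d] by (simp add: dist_commute)
      then show "y \<in> U" using e by auto
    qed
    moreover have "ball d q \<in> B" unfolding B_def using d q by auto
    ultimately show "\<exists>B'\<in>B. x \<in> B' \<and> B' \<subseteq> U" using d by (intro bexI[of _ "ball d q"]) auto
  qed
  then have "open = generate_topology B" by (rule topological_basis_imp_subbasis)
  moreover have "countable B" unfolding B_def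
    by (intro countable_image countable_SIGMA D countable_rat)
  ultimately show "\<exists>B::L2 set set. countable B \<and> open = generate_topology B" by blast
qed


section \<open>Sobolev functions on a bounded interval\<close>

text \<open>The space $L^2(a,b)$ is the closed subspace of the classes that vanish outside the interval.\<close>
definition L2_on :: "real \<Rightarrow> real \<Rightarrow> L2 set" where
  "L2_on a b = {f. AE x in lebesgue. x \<notin> {a<..<b} \<longrightarrow> fun_of f x = 0}"

definition square_integrable_on :: "real \<Rightarrow> real \<Rightarrow> (real \<Rightarrow> real) \<Rightarrow> bool" where
  "square_integrable_on a b f \<longleftrightarrow> square_integrable (\<lambda>x. indicator {a<..<b} x * f x)"

definition restrict_to_L2 :: "real \<Rightarrow> real \<Rightarrow> (real \<Rightarrow> real) \<Rightarrow> L2" where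
  "restrict_to_L2 a b f = to_L2 (\<lambda>x. indicator {a<..<b} x * f x)"

text \<open>The product is again in \<open>L2\<close> if one factor is essentially bounded, in particular if
  it belongs to $H^1(0,L)$; only such products are used below.\<close>
definition mult_L2 :: "L2 \<Rightarrow> L2 \<Rightarrow> L2" where
  "mult_L2 f g = to_L2 (\<lambda>x. fun_of f x * fun_of g x)"

text \<open>Test functions in $C^1_c(a,b)$.\<close>
definition test_function :: "real \<Rightarrow> real \<Rightarrow> (real \<Rightarrow> real) \<Rightarrow> bool" where
  "test_function a b \<phi> \<longleftrightarrow>
     (\<forall>x. \<phi> differentiable at x) \<and> continuous_on UNIV (deriv \<phi>) \<and>
     (\<exists>K. compact K \<and> K \<subseteq> {a<..<b} \<and> (\<forall>x. x \<notin> K \<longrightarrow> \<phi> x = 0))"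

text \<open>\<open>f\<close> belongs to $H^1(a,b)$ and \<open>g\<close> is its weak derivative.\<close>
definition weak_deriv :: "real \<Rightarrow> real \<Rightarrow> L2 \<Rightarrow> L2 \<Rightarrow> bool" where
  "weak_deriv a b f g \<longleftrightarrow> f \<in> L2_on a b \<and> g \<in> L2_on a b \<and>
     (\<forall>\<phi>. test_function a b \<phi> \<longrightarrow>
        (LINT x:{a<..<b}|lebesgue. fun_of f x * deriv \<phi> x) =
        - (LINT x:{a<..<b}|lebesgue. fun_of g x * \<phi> x))"

text \<open>The boundary values of an $H^1$ function are those of its continuous representative.\<close>
definition continuous_rep :: "real \<Rightarrow> real \<Rightarrow> L2 \<Rightarrow> (real \<Rightarrow> real) \<Rightarrow> bool" where
  "continuous_rep a b f c \<longleftrightarrow> continuous_on {a..b} c \<and>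
     (AE x in lebesgue. x \<in> {a<..<b} \<longrightarrow> fun_of f x = c x)"

text \<open>\<open>u\<close> belongs to $L^2(0,T;H^1(a,b))$ and \<open>ux t\<close> is the weak derivative of \<open>u t\<close> for almost every
  \<open>t\<close>; measurability into $H^1(a,b)$ is expressed through the isometric embedding $f \mapsto (f,f')$.\<close>
definition L2_time_H1 ::
  "real \<Rightarrow> real \<Rightarrow> real \<Rightarrow> (real \<Rightarrow> L2) \<Rightarrow> (real \<Rightarrow> L2) \<Rightarrow> bool" where
  "L2_time_H1 a b T u ux \<longleftrightarrow>
     (\<lambda>t. (u t, ux t)) \<in> borel_measurable (lebesgue_on {0..T}) \<and>
     (AE t in lebesgue_on {0..T}. weak_deriv a b (u t) (ux t)) \<and>
     integrable (lebesgue_on {0..T}) (\<lambda>t. (norm (u t))\<^sup>2 + (norm (ux t))\<^sup>2)"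


section \<open>Strongly continuous semigroups on a closed subspace\<close>

definition C0_semigroup_on :: "'a::real_normed_vector set \<Rightarrow> (real \<Rightarrow> 'a \<Rightarrow> 'a) \<Rightarrow> bool" where
  "C0_semigroup_on X S \<longleftrightarrow>
     (\<forall>t\<ge>0. \<forall>x\<in>X. S t x \<in> X) \<and>
     (\<forall>t\<ge>0. \<forall>x\<in>X. \<forall>y\<in>X. S t (x + y) = S t x + S t y) \<and>
     (\<forall>t\<ge>0. \<forall>c. \<forall>x\<in>X. S t (c *\<^sub>R x) = c *\<^sub>R S t x) \<and>
     (\<forall>t\<ge>0. \<exists>C. \<forall>x\<in>X. norm (S t x) \<le> C * norm x) \<and>
     (\<forall>x\<in>X. S 0 x = x) \<and>
     (\<forall>s\<ge>0. \<forall>t\<ge>0. \<forall>x\<in>X. S (s + t) x = S s (S t x)) \<and>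
     (\<forall>x\<in>X. ((\<lambda>t. S t x) \<longlongrightarrow> x) (at_right 0))"

text \<open>The generator, as a graph.\<close>
definition generator_on ::
  "'a::real_normed_vector set \<Rightarrow> (real \<Rightarrow> 'a \<Rightarrow> 'a) \<Rightarrow> ('a \<times> 'a) set" where
  "generator_on X S = {(x, y). x \<in> X \<and> ((\<lambda>t. (S t x - x) /\<^sub>R t) \<longlongrightarrow> y) (at_right 0)}"


section \<open>The Hirota--Satsuma system with boundary delay\<close>

text \<open>A state is a triple \<open>(u, v, z)\<close>; the topology of $H$ is that of the product norm, which for
  $\beta h > 0$ is equivalent to the weighted norm \<open>norm_H\<close>.\<close>
type_synonym state = "L2 \<times> L2 \<times> L2"

definition state_space :: "real \<Rightarrow> state set" where
  "state_space L = L2_on 0 L \<times> L2_on 0 L \<times> L2_on 0 1"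

definition norm_H :: "real \<Rightarrow> real \<Rightarrow> state \<Rightarrow> real" where
  "norm_H h \<beta> = (\<lambda>(u, v, z). sqrt ((norm u)\<^sup>2 + (norm v)\<^sup>2 + \<beta> * h * (norm z)\<^sup>2))"

text \<open>The graph of the linear operator
  $A(u,v,z) = (\frac12 u_{xxx}, -v_{xxx}, -\frac1h z_\rho)$ whose domain consists of the
  $(u,v,z) \in H^3(0,L)^2 \times H^1(0,1)$ with
  $u(0)=u(L)=v(0)=v(L)=u_x(0)=0$, $z(0)=u_x(L)$ and $v_x(L)=\alpha u_x(L)+\beta z(1)$; here
  $z(t,\rho)$ stands for $u_x(t-h\rho,L)$. The functions \<open>cu\<close>, \<open>cu1\<close>, ... are the continuous
  representatives of $u$, $u_x$, ....\<close>
definition HS_operator :: "real \<Rightarrow> real \<Rightarrow> real \<Rightarrow> real \<Rightarrow> (state \<times> state) set" where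
  "HS_operator L h \<alpha> \<beta> =
     {((u, v, z), ((1/2) *\<^sub>R u3, - v3, - (1/h) *\<^sub>R z1)) | u v z u3 v3 z1.
       \<exists>u1 u2 v1 v2 cu cu1 cv cv1 cz.
         weak_deriv 0 L u u1 \<and> weak_deriv 0 L u1 u2 \<and> weak_deriv 0 L u2 u3 \<and>
         weak_deriv 0 L v v1 \<and> weak_deriv 0 L v1 v2 \<and> weak_deriv 0 L v2 v3 \<and>
         weak_deriv 0 1 z z1 \<and>
         continuous_rep 0 L u cu \<and> continuous_rep 0 L u1 cu1 \<and>
         continuous_rep 0 L v cv \<and> continuous_rep 0 L v1 cv1 \<and>
         continuous_rep 0 1 z cz \<and>
         cu 0 = 0 \<and> cu L = 0 \<and> cv 0 = 0 \<and> cv L = 0 \<and> cu1 0 = 0 \<and>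
         cz 0 = cu1 L \<and> cv1 L = \<alpha> * cu1 L + \<beta> * cz 1}"

text \<open>$F(u,v,z) = (3uu_x+3vv_x, -3uv_x, 0)$.\<close>
definition HS_nonlinearity :: "L2 \<Rightarrow> L2 \<Rightarrow> L2 \<Rightarrow> L2 \<Rightarrow> state" where
  "HS_nonlinearity u ux v vx =
     (3 *\<^sub>R mult_L2 u ux + 3 *\<^sub>R mult_L2 v vx, - 3 *\<^sub>R mult_L2 u vx, 0)"

text \<open>Global mild solutions of $U' = AU + F(U)$, $U(0) = U_0$: functions with the stated regularity
  on every $[0,T]$ that satisfy $U(t) = S(t)U_0 + \int_0^t S(t-s)F(U(s))\,ds$, where $S$ is the
  semigroup generated by $A$.\<close>
definition HS_mild_solution ::
  "real \<Rightarrow> real \<Rightarrow> real \<Rightarrow> real \<Rightarrow> state \<Rightarrow> (real \<Rightarrow> state) \<Rightarrow> bool" where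
  "HS_mild_solution L h \<alpha> \<beta> U0 U \<longleftrightarrow>
     (\<exists>S ux vx.
        C0_semigroup_on (state_space L) S \<and>
        generator_on (state_space L) S = HS_operator L h \<alpha> \<beta> \<and>
        (\<forall>T>0. continuous_on {0..T} U \<and> U ` {0..T} \<subseteq> state_space L \<and>
           L2_time_H1 0 L T (\<lambda>t. fst (U t)) ux \<and>
           L2_time_H1 0 L T (\<lambda>t. fst (snd (U t))) vx) \<and>
        (\<forall>t\<ge>0. has_bochner_integral (lebesgue_on {0..t})
           (\<lambda>s. S (t - s) (HS_nonlinearity (fst (U s)) (ux s) (fst (snd (U s))) (vx s)))
           (U t - S t U0)))"

text \<open>$(u_0,v_0,z_0) \in H$ means $(u_0, v_0, z_0(-h\,\cdot)) \in H$.\<close>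
definition data_in_H ::
  "real \<Rightarrow> real \<Rightarrow> (real \<Rightarrow> real) \<Rightarrow> (real \<Rightarrow> real) \<Rightarrow> (real \<Rightarrow> real) \<Rightarrow> bool" where
  "data_in_H L h u0 v0 z0 \<longleftrightarrow>
     square_integrable_on 0 L u0 \<and> square_integrable_on 0 L v0 \<and>
     square_integrable_on 0 1 (\<lambda>\<rho>. z0 (- h * \<rho>))"

definition initial_state ::
  "real \<Rightarrow> real \<Rightarrow> (real \<Rightarrow> real) \<Rightarrow> (real \<Rightarrow> real) \<Rightarrow> (real \<Rightarrow> real) \<Rightarrow> state" where
  "initial_state L h u0 v0 z0 =
     (restrict_to_L2 0 L u0, restrict_to_L2 0 L v0, restrict_to_L2 0 1 (\<lambda>\<rho>. z0 (- h * \<rho>)))"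

text \<open>The last component of the state is $z(t,\rho) = u_x(t-h\rho,L)$.\<close>
definition energy :: "real \<Rightarrow> real \<Rightarrow> real \<Rightarrow> state \<Rightarrow> real" where
  "energy L h \<beta> = (\<lambda>(u, v, z).
     1/2 * (LINT x:{0..L}|lebesgue. (fun_of u x)\<^sup>2 + (fun_of v x)\<^sup>2) +
     \<beta> * h / 2 * (LINT \<rho>:{0..1}|lebesgue. (fun_of z \<rho>)\<^sup>2))"

end

theory Submission
  imports Defs
begin

text \<open>
  The energy decays because the Lyapunov functional \<open>q(U) = B(U, U) / 2\<close> does, where
  \<open>B(U, U)\<close> is the squared norm of \<open>H\<close> with the weights \<open>1 + \<epsilon> (L - x)\<close>, \<open>1 + \<epsilon> x\<close> and
  \<open>1 + \<epsilon> (1 - \<rho>)\<close> inserted in the integrals of \<open>u\<^sup>2\<close>, \<open>v\<^sup>2\<close> and \<open>z\<^sup>2\<close>. For a state \<open>U\<close> in the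
  domain of the linear operator \<open>A\<close>, integration by parts turns \<open>B(U, A U)\<close> into
  \<open>- (3/4) \<epsilon> |u\<^sub>x|\<^sup>2 - (3/2) \<epsilon> |v\<^sub>x|\<^sup>2 - (1/2) \<beta> \<epsilon> |z|\<^sup>2\<close> and a quadratic form in the boundary values
  \<open>u\<^sub>x(L)\<close>, \<open>z(1)\<close> and \<open>v\<^sub>x(0)\<close>, which the condition on \<open>\<alpha>\<close> and \<open>\<beta>\<close> makes nonpositive for small
  \<open>\<epsilon>\<close> (\<open>dissipative\<close>). The nonlinear terms cancel for \<open>\<epsilon> = 0\<close>, so that the norm of \<open>H\<close> does not
  grow; for \<open>\<epsilon> > 0\<close> they contribute at most a multiple of \<open>\<epsilon> |U| (|u\<^sub>x|\<^sup>2 + |v\<^sub>x|\<^sup>2)\<close>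
  (\<open>nonlinear_bound\<close>), which the dissipation absorbs if \<open>|U|\<close> is small. The inequality of
  Poincare bounds what remains by a multiple of \<open>- q\<close>, and \<open>q\<close> decays exponentially (\<open>decay\<close>).

  A mild solution is not differentiable in time, the trace \<open>u\<^sub>x(t, L)\<close> is not defined by its
  regularity, and its components are in \<open>H\<^sup>1(0, L)\<close>, with no boundary condition given. The argument is therefore
  run with continuous functionals only. If \<open>G\<close> is continuous on the state space and
  \<open>B(x, A x) \<le> - G(x)\<close> on the domain of \<open>A\<close>, then \<open>q(U(b)) - q(U(a))\<close> is at most the integral of
  \<open>B(U, F(U)) - G(U)\<close> over \<open>[a, b]\<close> (\<open>mild_energy_inequality\<close>): the inequality for the free
  flow extends from the domain to all states by density, and a mild solution is followed by
  free flows restarted on a fine partition.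

  The functional \<open>|u\<^sub>x|\<^sup>2\<close> is not continuous, but it is the limit of an increasing sequence of
  continuous ones, maxima of finitely many of the expressions \<open>- 2 \<langle>u, p'\<rangle> - |p|\<^sup>2\<close>. Here \<open>p\<close> runs
  through functions of class \<open>C\<^sup>1\<close> with arbitrary boundary values, and then an \<open>H\<^sup>1\<close> function with
  a finite supremum must vanish at both ends (\<open>dirichlet_approximants\<close>). So the energy inequality
  yields first the boundary conditions for almost every time (\<open>AE_regular\<close>) and then, in the
  limit, the full dissipation (\<open>regular_energy_inequality\<close>).
\<close>

section \<open>Monotonicity from one-sided derivatives\<close>

text \<open>The set where \<open>\<phi>\<close> lies below the line of slope \<open>e\<close> through \<open>(a, \<phi> a)\<close> is closed. Its supremum is
\<open>b\<close>, because the one-sided condition continues the bound to the right of any earlier point.\<close>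

lemma right_Dini_nonincreasing:
  fixes \<phi> :: "real \<Rightarrow> real"
  assumes "a \<le> b" and cont: "continuous_on {a..b} \<phi>"
    and dini: "\<And>t e. a \<le> t \<Longrightarrow> t < b \<Longrightarrow> 0 < e \<Longrightarrow> \<forall>\<^sub>F s in at_right t. \<phi> s \<le> \<phi> t + e * (s - t)"
  shows "\<phi> b \<le> \<phi> a"
proof (rule field_le_epsilon)
  fix e0 :: real assume "0 < e0"
  define e where "e = e0 / (b - a + 1)"
  have e: "0 < e" "e * (b - a) \<le> e0"
    using \<open>0 < e0\<close> \<open>a \<le> b\<close> by (auto simp: e_def field_simps)
  define S where "S = {t\<in>{a..b}. \<phi> t \<le> \<phi> a + e * (t - a)}"
  have "closed S"
    unfolding S_def by (intro continuous_on_closed_Collect_le cont continuous_intros)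
  moreover have S: "a \<in> S" "bdd_above S" "S \<subseteq> {a..b}"
    using \<open>a \<le> b\<close> by (auto simp: S_def bdd_above_def)
  ultimately have t: "Sup S \<in> S" by (intro closed_contains_Sup) auto
  define t where "t = Sup S"
  have "t = b"
  proof (rule ccontr)
    assume "t \<noteq> b"
    with t S(3) have tb: "a \<le> t" "t < b" by (auto simp: t_def less_le)
    have "\<forall>\<^sub>F s in at_right t. s \<in> {t<..<b} \<and> \<phi> s \<le> \<phi> t + e * (s - t)"
      using eventually_at_right_real[OF tb(2)] dini[OF tb e(1)] by eventually_elim auto
    then obtain s where s: "t < s" "s < b" "\<phi> s \<le> \<phi> t + e * (s - t)"
      using eventually_happens[of _ "at_right t"] by fastforce
    have "\<phi> t \<le> \<phi> a + e * (t - a)" using t by (auto simp: t_def S_def)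
    with s tb have "s \<in> S" by (auto simp: S_def algebra_simps)
    then have "s \<le> t" unfolding t_def using S(2) by (rule cSup_upper)
    with s show False by simp
  qed
  then have "\<phi> b \<le> \<phi> a + e * (b - a)" using t by (auto simp: t_def S_def)
  with e show "\<phi> b \<le> \<phi> a + e0" by linarith
qed

text \<open>A form of Gronwall's lemma without differentiability: the integrated inequality bounds the upper
right derivative of \<open>q t * exp (c * t)\<close> by zero.\<close>

lemma exponential_decay:
  fixes q :: "real \<Rightarrow> real"
  assumes cont: "continuous_on {0..} q"
    and decr: "\<And>s t. 0 \<le> s \<Longrightarrow> s \<le> t \<Longrightarrow> q t - q s \<le> - c * integral {s..t} q"
    and "0 \<le> t"
  shows "q t \<le> q 0 * exp (- c * t)"
proof -
  have cont_q: "continuous_on {s..r} q" if "0 \<le> s" for s r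
    using cont by (rule continuous_on_subset) (use that in auto)
  define \<phi> where "\<phi> t = q t * exp (c * t)" for t
  have "\<phi> t \<le> \<phi> 0"
  proof (rule right_Dini_nonincreasing[OF \<open>0 \<le> t\<close>])
    show "continuous_on {0..t} \<phi>"
      unfolding \<phi>_def by (intro continuous_intros cont_q) simp
    fix s e :: real assume s: "0 \<le> s" "s < t" "0 < e"
    \<comment> \<open>\<open>D\<close> touches \<open>\<phi>\<close> at \<open>s\<close>, is above it afterwards, and has right derivative \<open>0\<close> at \<open>s\<close>.\<close>
    define D where "D r = (q s - c * integral {s..r} q) * exp (c * r)" for r
    have "((\<lambda>r. integral {s..r} q) has_real_derivative q s) (at s within {s..t})"
      using integral_has_real_derivative[OF cont_q[OF s(1)], of s t] s by simp
    then have "(D has_real_derivative (0 - c * q s) * exp (c * s) + (q s - c * integral {s..s} q) * (c * exp (c * s)))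
        (at s within {s..t})"
      unfolding D_def
      by (auto intro!: derivative_eq_intros)
    then have "(D has_real_derivative 0) (at s within {s..t})" by (simp add: algebra_simps)
    then have lim: "((\<lambda>r. (D r - D s) / (r - s)) \<longlongrightarrow> 0) (at_right s)"
      unfolding has_field_derivative_iff using s at_within_Icc_at_right[of s t] by simp
    have "\<forall>\<^sub>F r in at_right s. (D r - D s) / (r - s) < e"
      using order_tendstoD(2)[OF lim s(3)] .
    then show "\<forall>\<^sub>F r in at_right s. \<phi> r \<le> \<phi> s + e * (r - s)"
      using eventually_at_right_real[OF s(2)]
    proof eventually_elim
      case (elim r)
      then have "D r - D s \<le> e * (r - s)" by (simp add: pos_divide_less_eq less_imp_le)
      moreover have "\<phi> r \<le> D r"
        unfolding \<phi>_def D_def using decr[of s r] s elim by (intro mult_right_mono) auto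
      moreover have "D s = \<phi> s" by (simp add: D_def \<phi>_def)
      ultimately show ?case by linarith
    qed
  qed
  then have "q t * exp (c * t) \<le> q 0" by (simp add: \<phi>_def)
  then have "q t * exp (c * t) * exp (- c * t) \<le> q 0 * exp (- c * t)"
    by (rule mult_right_mono) simp
  then show ?thesis by (simp add: mult.assoc flip: exp_add)
qed

section \<open>Uniform boundedness\<close>

text \<open>The theorem of Banach and Steinhaus: by Baire's theorem one of the closed sets \<open>F k\<close> contains a
ball, and linearity moves this ball to the origin.\<close>

lemma uniform_boundedness:
  fixes T :: "nat \<Rightarrow> 'a::banach \<Rightarrow> 'b::real_normed_vector"
  assumes lin: "\<And>n. bounded_linear (T n)" and bd: "\<And>x. \<exists>C. \<forall>n. norm (T n x) \<le> C"
  shows "\<exists>C. \<forall>n x. norm (T n x) \<le> C * norm x"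
proof -
  define F where "F k = {x. \<forall>n. norm (T n x) \<le> real k}" for k :: nat
  have contT: "continuous_on UNIV (T n)" for n
    using lin by (simp add: linear_continuous_on)
  have closed_F: "closed (F k)" for k
    unfolding F_def by (intro closed_Collect_all closed_Collect_le continuous_intros contT)
  have "\<exists>k. interior (F k) \<noteq> {}"
  proof (rule ccontr)
    assume "\<nexists>k. interior (F k) \<noteq> {}"
    then have emp: "interior (F k) = {}" for k by simp
    have "closure (\<Inter>(range (\<lambda>k. - F k))) = UNIV"
    proof -
      have "Met_TC.mtopology closure_of \<Inter>(range (\<lambda>k. - F k)) = (UNIV :: 'a set)"
      proof (rule Met_TC.metric_Baire_category)
        show "Met_TC.mcomplete TYPE('a)"
          using complete_UNIV mcomplete_iff_complete by blast
        fix S assume "S \<in> range (\<lambda>k. - F k)"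
        then obtain k where "S = - F k" by blast
        then show "openin Met_TC.mtopology S \<and> Met_TC.mtopology closure_of S = UNIV"
          using closed_F[of k] emp[of k] by (simp add: closure_interior open_Compl)
      qed auto
      then show ?thesis by simp
    qed
    moreover have "\<Inter>(range (\<lambda>k. - F k)) = {}"
    proof -
      have "\<exists>k. x \<in> F k" for x
      proof -
        obtain C where C: "\<And>n. norm (T n x) \<le> C" using bd by blast
        obtain k :: nat where "C \<le> real k" using real_arch_simple by blast
        then have "x \<in> F k" using C by (auto simp: F_def intro: order_trans)
        then show ?thesis ..
      qed
      then show ?thesis by auto
    qed
    ultimately show False by simp
  qed
  then obtain k x0 where "x0 \<in> interior (F k)" by blast
  then obtain r where r: "0 < r" "cball x0 r \<subseteq> F k"
    using mem_interior_cball by blast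
  have "norm (T n x) \<le> (2 * real k / r) * norm x" for n x
  proof (cases "x = 0")
    case True
    then show ?thesis using lin[of n] by (simp add: linear_simps)
  next
    case False
    define y where "y = (r / norm x) *\<^sub>R x"
    have "norm y = r" using False r by (simp add: y_def)
    then have "x0 + y \<in> F k" "x0 \<in> F k" using r by (auto simp: dist_norm)
    then have "norm (T n (x0 + y)) \<le> k" "norm (T n x0) \<le> k" by (auto simp: F_def)
    moreover have "T n y = T n (x0 + y) - T n x0" using lin[of n] by (simp add: linear_simps)
    ultimately have "norm (T n y) \<le> 2 * real k"
      using norm_triangle_ineq4[of "T n (x0 + y)" "T n x0"] by simp
    moreover have "norm (T n y) = (r / norm x) * norm (T n x)"
      using lin[of n] r by (simp add: y_def linear_simps)
    ultimately show ?thesis using r False by (simp add: field_simps)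
  qed
  then show ?thesis by blast
qed

lemma has_vector_derivative_right_iff:
  fixes f :: "real \<Rightarrow> 'a::real_normed_vector"
  shows "(f has_vector_derivative y) (at_right t) \<longleftrightarrow>
    ((\<lambda>h. (f (h + t) - f t) /\<^sub>R h) \<longlongrightarrow> y) (at_right 0)"
proof -
  have "(f has_vector_derivative y) (at_right t) \<longleftrightarrow>
      ((\<lambda>s. (f s - f t - (s - t) *\<^sub>R y) /\<^sub>R \<bar>s - t\<bar>) \<longlongrightarrow> 0) (at_right t)"
    by (simp add: has_vector_derivative_def has_derivative_at_within bounded_linear_scaleR_left)
  also have "\<dots> \<longleftrightarrow> ((\<lambda>h. (f (h + t) - f t) /\<^sub>R h - y) \<longlongrightarrow> 0) (at_right 0)"
    unfolding filterlim_at_right_to_0[of _ _ t]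
  proof (rule filterlim_cong[OF refl refl])
    show "\<forall>\<^sub>F h in at_right 0. (f (h + t) - f t - (h + t - t) *\<^sub>R y) /\<^sub>R \<bar>h + t - t\<bar>
        = (f (h + t) - f t) /\<^sub>R h - y"
      using eventually_at_right_less[of 0] by eventually_elim (simp add: scaleR_diff_right)
  qed
  also have "\<dots> \<longleftrightarrow> ((\<lambda>h. (f (h + t) - f t) /\<^sub>R h) \<longlongrightarrow> y) (at_right 0)"
    by (rule LIM_zero_iff)
  finally show ?thesis .
qed

section \<open>Strongly continuous semigroups behind a projection\<close>

text \<open>A strongly continuous semigroup on a closed subspace, composed with a bounded projection onto this
subspace. The operators are then bounded and linear on the whole space, \<open>T 0\<close> is the projection, and
the subspace consists of the fixed points of \<open>T 0\<close>.\<close>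

locale projected_semigroup =
  fixes T :: "real \<Rightarrow> 'a::{banach, second_countable_topology} \<Rightarrow> 'a"
  assumes lin: "0 \<le> t \<Longrightarrow> bounded_linear (T t)"
    and semigroup: "0 \<le> s \<Longrightarrow> 0 \<le> t \<Longrightarrow> T (s + t) x = T s (T t x)"
    and cont_0: "((\<lambda>t. T t x) \<longlongrightarrow> T 0 x) (at_right 0)"
begin

lemma T_T0 [simp]: "0 \<le> t \<Longrightarrow> T t (T 0 x) = T t x"
  using semigroup[of t 0 x] by simp

lemma T0_T [simp]: "0 \<le> t \<Longrightarrow> T 0 (T t x) = T t x"
  using semigroup[of 0 t x] by simp

text \<open>Otherwise the norms of \<open>T (t n)\<close> are unbounded for some \<open>t n\<close> that tend to \<open>0\<close>, whereas
\<open>T (t n) x\<close> converges for each \<open>x\<close>; this contradicts uniform boundedness.\<close>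

lemma bounded_near_0: "\<exists>d>0. \<exists>M. \<forall>t\<in>{0..d}. \<forall>x. norm (T t x) \<le> M * norm x"
proof (rule ccontr)
  assume neg: "\<not> ?thesis"
  have "\<exists>t x. 0 \<le> t \<and> t \<le> 1 / real (Suc n) \<and> norm (T t x) > real n * norm x" for n
  proof (rule ccontr)
    assume "\<not> ?thesis"
    then have "\<forall>t\<in>{0..1 / real (Suc n)}. \<forall>x. norm (T t x) \<le> real n * norm x"
      by (force simp: not_less)
    moreover have "0 < 1 / real (Suc n)" by simp
    ultimately show False using neg by blast
  qed
  then obtain t x where tx: "\<And>n. 0 \<le> t n" "\<And>n. t n \<le> 1 / real (Suc n)"
    "\<And>n. norm (T (t n) (x n)) > real n * norm (x n)"
    by metis
  have t0: "t \<longlonglongrightarrow> 0"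
    by (rule tendsto_sandwich[of "\<lambda>_. 0" _ _ "\<lambda>n. 1 / real (Suc n)"])
      (use tx LIMSEQ_inverse_real_of_nat in \<open>auto simp: inverse_eq_divide\<close>)
  have "\<exists>C. \<forall>n x. norm (T (t n) x) \<le> C * norm x"
  proof (rule uniform_boundedness)
    show "bounded_linear (T (t n))" for n using lin tx by blast
    fix x
    have "((\<lambda>t. T t x) \<longlongrightarrow> T 0 x) (at 0 within {0..})"
      using cont_0[of x] by (simp add: at_within_Ici_at_right)
    then have "continuous (at 0 within {0..}) (\<lambda>t. T t x)" by (simp add: continuous_within)
    then have "(\<lambda>n. T (t n) x) \<longlonglongrightarrow> T 0 x"
      unfolding continuous_within_sequentially using t0 tx(1) by (auto simp: o_def)
    then show "\<exists>C. \<forall>n. norm (T (t n) x) \<le> C"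
      by (meson BseqE convergentI convergent_imp_Bseq)
  qed
  then obtain C where C: "\<And>n x. norm (T (t n) x) \<le> C * norm x" by blast
  obtain n :: nat where "C \<le> real n" using real_arch_simple by blast
  then have "norm (T (t n) (x n)) \<le> real n * norm (x n)"
    using C[of n "x n"] by (meson mult_right_mono norm_ge_zero order_trans)
  with tx(3)[of n] show False by simp
qed

lemma locally_bounded:
  obtains M where "1 \<le> M" "\<And>t x. 0 \<le> t \<Longrightarrow> t \<le> \<tau> \<Longrightarrow> norm (T t x) \<le> M * norm x"
proof -
  obtain d M0 where d: "0 < d" and M0: "\<And>t x. t \<in> {0..d} \<Longrightarrow> norm (T t x) \<le> M0 * norm x"
    using bounded_near_0 by blast
  define M where "M = max 1 M0"
  have M: "norm (T t x) \<le> M * norm x" if "t \<in> {0..d}" for t x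
    using M0[OF that, of x] mult_right_mono[of M0 M "norm x"] by (simp add: M_def)
  have pow: "norm (T t x) \<le> M ^ Suc n * norm x" if "0 \<le> t" "t \<le> real (Suc n) * d" for n t x
    using that
  proof (induction n arbitrary: t)
    case 0
    then show ?case using M[of t x] by simp
  next
    case (Suc n)
    show ?case
    proof (cases "t \<le> d")
      case True
      have "norm (T t x) \<le> M * norm x" using M[of t x] True Suc.prems by simp
      also have "\<dots> \<le> M ^ Suc (Suc n) * norm x"
        using power_increasing[of 1 "Suc (Suc n)" M] by (intro mult_right_mono) (auto simp: M_def)
      finally show ?thesis .
    next
      case False
      then have "norm (T t x) = norm (T d (T (t - d) x))"
        using semigroup[of d "t - d" x] d by simp
      also have "\<dots> \<le> M * norm (T (t - d) x)" using M[of d] d by simp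
      also have "\<dots> \<le> M * (M ^ Suc n * norm x)"
        using False Suc.prems by (intro mult_left_mono Suc.IH) (auto simp: M_def algebra_simps)
      finally show ?thesis by (simp add: mult.assoc)
    qed
  qed
  obtain n :: nat where n: "\<tau> / d \<le> real n" using real_arch_simple by blast
  show ?thesis
  proof (rule that)
    show "1 \<le> M ^ Suc n" by (rule one_le_power) (simp add: M_def)
    fix t x assume t: "0 \<le> t" "t \<le> \<tau>"
    have "\<tau> \<le> real n * d" using n d by (simp add: field_simps)
    then have "t \<le> real (Suc n) * d" using t d by (simp add: algebra_simps)
    with t show "norm (T t x) \<le> M ^ Suc n * norm x" by (intro pow)
  qed
qed

text \<open>The increment between the times \<open>s\<close> and \<open>t\<close> is the image of the increment between \<open>0\<close> and
\<open>\<bar>s - t\<bar>\<close>, so continuity at \<open>0\<close> from the right gives continuity from both sides at every time.\<close>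

lemma orbit_modulus:
  obtains M where "1 \<le> M" "\<And>s t x. 0 \<le> s \<Longrightarrow> s \<le> \<tau> \<Longrightarrow> 0 \<le> t \<Longrightarrow> t \<le> \<tau> \<Longrightarrow>
    norm (T s x - T t x) \<le> M * norm (T \<bar>s - t\<bar> x - T 0 x)"
proof -
  obtain M where M: "1 \<le> M" "\<And>t x. 0 \<le> t \<Longrightarrow> t \<le> \<tau> \<Longrightarrow> norm (T t x) \<le> M * norm x"
    using locally_bounded by blast
  have *: "norm (T s x - T t x) \<le> M * norm (T (s - t) x - T 0 x)" if "0 \<le> t" "t \<le> s" "s \<le> \<tau>" for s t x
  proof -
    have "T s x - T t x = T t (T (s - t) x - T 0 x)"
      using semigroup[of t "s - t" x] lin[OF that(1)] that by (simp add: linear_simps)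
    then show ?thesis using M(2)[of t] that by simp
  qed
  show ?thesis
  proof (rule that[OF M(1)])
    fix s t x assume "0 \<le> s" "s \<le> \<tau>" "0 \<le> t" "t \<le> \<tau>"
    then show "norm (T s x - T t x) \<le> M * norm (T \<bar>s - t\<bar> x - T 0 x)"
      using *[of t s x] *[of s t x] by (cases "t \<le> s") (auto simp: norm_minus_commute)
  qed
qed

lemma continuous_orbit: "continuous_on {0..} (\<lambda>t. T t x)"
  unfolding continuous_on_iff
proof (intro ballI allI impI)
  fix t e :: real assume t: "t \<in> {0..}" and "0 < e"
  obtain M where M: "1 \<le> M" "\<And>s r x. 0 \<le> s \<Longrightarrow> s \<le> t + 1 \<Longrightarrow> 0 \<le> r \<Longrightarrow> r \<le> t + 1 \<Longrightarrow>
    norm (T s x - T r x) \<le> M * norm (T \<bar>s - r\<bar> x - T 0 x)"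
    using orbit_modulus by blast
  have "\<forall>\<^sub>F h in at_right 0. dist (T h x) (T 0 x) < e / M"
    using tendstoD[OF cont_0[of x], of "e / M"] M(1) \<open>0 < e\<close> by simp
  then obtain d where d: "0 < d" "\<And>h. 0 < h \<Longrightarrow> h < d \<Longrightarrow> dist (T h x) (T 0 x) < e / M"
    unfolding eventually_at_right_field by auto
  have "dist (T s x) (T t x) < e" if s: "s \<in> {0..}" "dist s t < min d 1" for s
  proof (cases "s = t")
    case False
    have "norm (T s x - T t x) \<le> M * norm (T \<bar>s - t\<bar> x - T 0 x)"
      using s t by (intro M(2)) (auto simp: dist_real_def)
    also have "\<dots> < M * (e / M)"
      using d(2)[of "\<bar>s - t\<bar>"] False s M(1)
      by (intro mult_strict_left_mono) (auto simp: dist_real_def dist_norm)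
    finally show ?thesis using M(1) by (simp add: dist_norm)
  qed (use \<open>0 < e\<close> in simp)
  then show "\<exists>d>0. \<forall>s\<in>{0..}. dist s t < d \<longrightarrow> dist (T s x) (T t x) < e"
    using d(1) by (intro exI[of _ "min d 1"]) auto
qed

lemma jointly_continuous: "continuous_on ({0..} \<times> UNIV) (\<lambda>p. T (fst p) (snd p))"
  unfolding continuous_on_def
proof (intro ballI)
  fix p :: "real \<times> 'a" assume "p \<in> {0..} \<times> UNIV"
  then obtain t x where p: "p = (t, x)" "0 \<le> t" by auto
  let ?F = "at p within {0..} \<times> UNIV"
  obtain M where M: "1 \<le> M" "\<And>s x. 0 \<le> s \<Longrightarrow> s \<le> t + 1 \<Longrightarrow> norm (T s x) \<le> M * norm x"
    using locally_bounded by blast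
  have fst_lim: "(fst \<longlongrightarrow> t) ?F" and snd_lim: "(snd \<longlongrightarrow> x) ?F"
    unfolding p by (auto intro!: tendsto_eq_intros)
  have dom: "\<forall>\<^sub>F q in ?F. 0 \<le> fst q"
    by (auto simp: eventually_at_topological intro!: exI[of _ UNIV])
  have ev: "\<forall>\<^sub>F q in ?F. 0 \<le> fst q \<and> fst q \<le> t + 1"
    using eventually_conj[OF dom order_tendstoD(2)[OF fst_lim, of "t + 1"]]
    by (simp add: eventually_mono less_imp_le)
  have orbit: "((\<lambda>q. T (fst q) x) \<longlongrightarrow> T t x) ?F"
    by (rule continuous_on_tendsto_compose[OF continuous_orbit fst_lim]) (use p dom in auto)
  have "((\<lambda>q. T (fst q) (snd q) - T (fst q) x) \<longlongrightarrow> 0) ?F"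
  proof (rule Lim_null_comparison)
    show "\<forall>\<^sub>F q in ?F. norm (T (fst q) (snd q) - T (fst q) x) \<le> M * norm (snd q - x)"
      using ev
    proof eventually_elim
      case (elim q)
      then have "T (fst q) (snd q) - T (fst q) x = T (fst q) (snd q - x)"
        using lin[of "fst q"] by (simp add: linear_simps)
      then show ?case using M(2) elim by simp
    qed
    have "((\<lambda>q. M * norm (snd q - x)) \<longlongrightarrow> M * norm (x - x)) ?F"
      by (intro tendsto_intros snd_lim)
    then show "((\<lambda>q. M * norm (snd q - x)) \<longlongrightarrow> 0) ?F" by simp
  qed
  from tendsto_add[OF this orbit]
  show "((\<lambda>p. T (fst p) (snd p)) \<longlongrightarrow> T (fst p) (snd p)) ?F" by (simp add: p)
qed

lemma continuous_on_orbits: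
  assumes "continuous_on A s" "continuous_on A y" "\<And>a. a \<in> A \<Longrightarrow> 0 \<le> s a"
  shows "continuous_on A (\<lambda>a. T (s a) (y a))"
  by (rule continuous_on_compose2[OF jointly_continuous continuous_on_Pair[OF assms(1,2)], simplified])
    (use assms(3) in auto)

lemma tendsto_orbits:
  assumes "(s \<longlongrightarrow> t) F" "(y \<longlongrightarrow> x) F" "0 \<le> t" "\<forall>\<^sub>F a in F. 0 \<le> s a"
  shows "((\<lambda>a. T (s a) (y a)) \<longlongrightarrow> T t x) F"
  using continuous_on_tendsto_compose[OF jointly_continuous tendsto_Pair[OF assms(1,2)]] assms(3,4)
  by simp

definition generator :: "('a \<times> 'a) set" where
  "generator = {(x, y). T 0 x = x \<and> ((\<lambda>t. (T t x - x) /\<^sub>R t) \<longlongrightarrow> y) (at_right 0)}"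

lemma generator_orbit:
  assumes "(x, y) \<in> generator" "0 \<le> t"
  shows "(T t x, T t y) \<in> generator"
proof -
  from assms have lim: "((\<lambda>h. (T h x - x) /\<^sub>R h) \<longlongrightarrow> y) (at_right 0)"
    by (auto simp: generator_def)
  have "((\<lambda>h. T t ((T h x - x) /\<^sub>R h)) \<longlongrightarrow> T t y) (at_right 0)"
    using bounded_linear.tendsto[OF lin[OF assms(2)] lim] .
  moreover have "\<forall>\<^sub>F h in at_right 0. T t ((T h x - x) /\<^sub>R h) = (T h (T t x) - T t x) /\<^sub>R h"
    using eventually_at_right_less[of 0]
  proof eventually_elim
    case (elim h)
    then show ?case
      using semigroup[of t h x] semigroup[of h t x] assms(2) lin[OF assms(2)]
      by (simp add: linear_simps add.commute)
  qed
  ultimately have "((\<lambda>h. (T h (T t x) - T t x) /\<^sub>R h) \<longlongrightarrow> T t y) (at_right 0)"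
    by (rule Lim_transform_eventually)
  then show ?thesis using assms(2) by (simp add: generator_def)
qed

lemma orbit_right_derivative:
  assumes "(x, y) \<in> generator" "0 \<le> t"
  shows "((\<lambda>s. T s x) has_vector_derivative T t y) (at_right t)"
proof -
  have "((\<lambda>h. (T h (T t x) - T t x) /\<^sub>R h) \<longlongrightarrow> T t y) (at_right 0)"
    using generator_orbit[OF assms] by (simp add: generator_def)
  then have "((\<lambda>h. (T (h + t) x - T t x) /\<^sub>R h) \<longlongrightarrow> T t y) (at_right 0)"
    by (rule Lim_transform_eventually)
      (use eventually_at_right_less[of 0] assms(2) in \<open>auto elim!: eventually_mono simp: semigroup\<close>)
  then show ?thesis by (simp add: has_vector_derivative_right_iff)
qed

text \<open>The averages of the orbit of \<open>x\<close> over \<open>[0, d]\<close> are in the domain of the generator, and they tend to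
\<open>x\<close> as \<open>d\<close> tends to \<open>0\<close>.\<close>

lemma generator_dense:
  assumes "T 0 x = x"
  obtains X Y where "\<And>n. (X n, Y n) \<in> generator" "X \<longlonglongrightarrow> x"
proof -
  let ?o = "\<lambda>s. T s x"
  have int: "?o integrable_on {a..b}" if "0 \<le> a" for a b
    by (intro integrable_continuous_real continuous_on_subset[OF continuous_orbit]) (use that in auto)
  have quot: "((\<lambda>h. integral {a..a+h} ?o /\<^sub>R h) \<longlongrightarrow> T a x) (at_right 0)" if "0 \<le> a" for a
  proof -
    have "((\<lambda>r. integral {a..r} ?o) has_vector_derivative T a x) (at a within {a..a+1})"
      by (rule integral_has_vector_derivative)
        (use that in \<open>auto intro: continuous_on_subset[OF continuous_orbit]\<close>)
    then show ?thesis by (simp add: at_within_Icc_at_right has_vector_derivative_right_iff add.commute)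
  qed
  define J where "J d = integral {0..d} ?o /\<^sub>R d" for d
  have J: "(J d, (T d x - x) /\<^sub>R d) \<in> generator" if "0 < d" for d
  proof -
    have shift: "T h (integral {0..d} ?o) = integral {h..h+d} ?o" if "0 \<le> h" for h
    proof -
      have "T h (integral {0..d} ?o) = integral {0..d} (\<lambda>s. T h (T s x))"
        using integral_linear[OF int[of 0 d] lin[OF that]] by (simp add: o_def)
      also have "\<dots> = integral {0..d} (\<lambda>s. T (s + h) x)"
        by (rule integral_cong) (use that semigroup[of h _ x] in \<open>auto simp: add.commute\<close>)
      also have "\<dots> = integral {h..h+d} ?o"
        using integral_shift_real_ivl[of h h "h + d" ?o] by simp
      finally show ?thesis .
    qed
    have "((\<lambda>h. ((integral {d..d+h} ?o /\<^sub>R h) - integral {0..0+h} ?o /\<^sub>R h) /\<^sub>R d)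
        \<longlongrightarrow> (T d x - T 0 x) /\<^sub>R d) (at_right 0)"
      by (intro tendsto_intros quot) (use that in auto)
    moreover have "\<forall>\<^sub>F h in at_right 0. ((integral {d..d+h} ?o /\<^sub>R h) - integral {0..0+h} ?o /\<^sub>R h) /\<^sub>R d
        = (T h (J d) - J d) /\<^sub>R h"
      using eventually_at_right_less[of 0]
    proof eventually_elim
      case (elim h)
      have "integral {0..h} ?o + integral {h..h+d} ?o = integral {0..d} ?o + integral {d..d+h} ?o"
        using Henstock_Kurzweil_Integration.integral_combine[of 0 h "h + d" ?o]
          Henstock_Kurzweil_Integration.integral_combine[of 0 d "d + h" ?o] int[of 0] elim that
        by (simp add: add.commute)
      then have "integral {h..h+d} ?o = integral {0..d} ?o + integral {d..d+h} ?o - integral {0..h} ?o"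
        by (metis add_diff_cancel_left')
      then have "integral {d..d+h} ?o - integral {0..h} ?o = integral {h..h+d} ?o - integral {0..d} ?o"
        by simp
      then show ?case
        using elim that lin[of h] shift[of h]
        by (simp add: J_def linear_simps flip: scaleR_diff_right)
    qed
    ultimately have "((\<lambda>h. (T h (J d) - J d) /\<^sub>R h) \<longlongrightarrow> (T d x - T 0 x) /\<^sub>R d) (at_right 0)"
      by (rule Lim_transform_eventually)
    moreover have "T 0 (J d) = J d"
      using shift[of 0] lin[of 0] by (simp add: J_def linear_simps)
    ultimately show ?thesis by (simp add: generator_def assms)
  qed
  have Jlim: "(J \<longlongrightarrow> x) (at_right 0)" using quot[of 0] assms unfolding J_def by simp
  have "filterlim (\<lambda>n. 1 / real (Suc n)) (at_right 0) sequentially"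
    unfolding filterlim_at using LIMSEQ_inverse_real_of_nat by (auto simp: inverse_eq_divide)
  from filterlim_compose[OF Jlim this]
  have "(\<lambda>n. J (1 / real (Suc n))) \<longlonglongrightarrow> x" .
  then show ?thesis by (rule that[rotated]) (rule J, simp)
qed

lemma dissipation_on_generator:
  assumes B: "bounded_bilinear B" and sym: "\<And>x y. B x y = (B y x :: real)"
    and G: "continuous_on UNIV (G :: 'a \<Rightarrow> real)"
    and diss: "\<And>x y. (x, y) \<in> generator \<Longrightarrow> B x y \<le> - G x"
    and xy: "(x, y) \<in> generator" and "0 \<le> t"
  shows "B (T t x) (T t x) / 2 + integral {0..t} (\<lambda>s. G (T s x)) \<le> B x x / 2"
proof -
  interpret B: bounded_bilinear B by fact
  have contG: "continuous_on {0..} (\<lambda>s. G (T s x))"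
    by (rule continuous_on_compose2[OF G continuous_orbit]) auto
  define \<phi> where "\<phi> t = B (T t x) (T t x) / 2 + integral {0..t} (\<lambda>s. G (T s x))" for t
  have "\<phi> t \<le> \<phi> 0"
  proof (rule right_Dini_nonincreasing[OF \<open>0 \<le> t\<close>])
    have "continuous_on {0..t} (\<lambda>t. T t x)"
      by (rule continuous_on_subset[OF continuous_orbit]) auto
    moreover have "(\<lambda>s. G (T s x)) integrable_on {0..t}"
      by (intro integrable_continuous_real continuous_on_subset[OF contG]) auto
    ultimately show "continuous_on {0..t} \<phi>"
      unfolding \<phi>_def
      by (intro continuous_intros B.continuous_on indefinite_integral_continuous_1) auto
    fix s e :: real assume s: "0 \<le> s" "s < t" "0 < e"
    have d1: "((\<lambda>s. B (T s x) (T s x)) has_vector_derivative B (T s x) (T s y) + B (T s y) (T s x)) (at_right s)"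
      using B.has_vector_derivative[OF orbit_right_derivative[OF xy s(1)] orbit_right_derivative[OF xy s(1)]] .
    have "((\<lambda>r. integral {0..r} (\<lambda>s. G (T s x))) has_vector_derivative G (T s x)) (at s within {s..t})"
    proof -
      have "((\<lambda>r. integral {0..r} (\<lambda>s. G (T s x))) has_vector_derivative G (T s x)) (at s within {0..t})"
        by (rule integral_has_vector_derivative)
          (use s in \<open>auto intro: continuous_on_subset[OF contG]\<close>)
      then show ?thesis
        by (rule has_vector_derivative_within_subset) (use s in auto)
    qed
    then have d2: "((\<lambda>r. integral {0..r} (\<lambda>s. G (T s x))) has_vector_derivative G (T s x)) (at_right s)"
      using s by (simp add: at_within_Icc_at_right)
    have "(\<phi> has_vector_derivative (B (T s x) (T s y) + B (T s y) (T s x)) / 2 + G (T s x)) (at_right s)"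
      unfolding \<phi>_def using d1 d2
      by (intro has_vector_derivative_add has_vector_derivative_divide) 
    moreover have "(B (T s x) (T s y) + B (T s y) (T s x)) / 2 + G (T s x) \<le> 0"
      using diss[OF generator_orbit[OF xy s(1)]] sym[of "T s y" "T s x"] by simp
    ultimately obtain D where D: "(\<phi> has_vector_derivative D) (at_right s)" "D \<le> 0" by blast
    then have "((\<lambda>r. (\<phi> r - \<phi> s) / (r - s)) \<longlongrightarrow> D) (at_right s)"
      by (simp add: has_field_derivative_iff flip: has_real_derivative_iff_has_vector_derivative)
    from order_tendstoD(2)[OF this, of e] D(2) s(3)
    have "\<forall>\<^sub>F r in at_right s. (\<phi> r - \<phi> s) / (r - s) < e" by simp
    then show "\<forall>\<^sub>F r in at_right s. \<phi> r \<le> \<phi> s + e * (r - s)"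
      using eventually_at_right_less[of s]
      by eventually_elim (simp add: pos_divide_less_eq algebra_simps)
  qed
  then show ?thesis using xy by (simp add: \<phi>_def generator_def)
qed

text \<open>Both sides depend continuously on \<open>x\<close>, so the inequality extends from the dense domain of the
generator. This step is the reason why the dissipation is measured by a continuous functional \<open>G\<close>.\<close>

lemma dissipation:
  assumes B: "bounded_bilinear B" and sym: "\<And>x y. B x y = (B y x :: real)"
    and G: "continuous_on UNIV (G :: 'a \<Rightarrow> real)"
    and diss: "\<And>x y. (x, y) \<in> generator \<Longrightarrow> B x y \<le> - G x"
    and x: "T 0 x = x" and "0 \<le> t"
  shows "B (T t x) (T t x) / 2 + integral {0..t} (\<lambda>s. G (T s x)) \<le> B x x / 2"
proof -
  interpret B: bounded_bilinear B by fact
  obtain X Y where X: "\<And>n. (X n, Y n) \<in> generator" "X \<longlonglongrightarrow> x"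
    using generator_dense[OF x] by blast
  have "continuous_on (UNIV \<times> cbox 0 t) (\<lambda>p. T (snd p) (fst p))"
    by (intro continuous_on_orbits continuous_intros) auto
  then have "continuous_on (UNIV \<times> cbox 0 t) (\<lambda>(x, s). G (T s x))"
    unfolding case_prod_beta by (rule continuous_on_compose2[OF G]) auto
  from integral_continuous_on_param[OF this]
  have c1: "continuous_on UNIV (\<lambda>x. integral {0..t} (\<lambda>s. G (T s x)))" by simp
  have c2: "continuous_on UNIV (T t)"
    using lin[OF \<open>0 \<le> t\<close>] by (simp add: linear_continuous_on)
  have "(\<lambda>n. B (T t (X n)) (T t (X n)) / 2 + integral {0..t} (\<lambda>s. G (T s (X n))))
      \<longlonglongrightarrow> B (T t x) (T t x) / 2 + integral {0..t} (\<lambda>s. G (T s x))"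
    by (intro tendsto_intros B.tendsto continuous_on_tendsto_compose[OF c1 X(2)]
        continuous_on_tendsto_compose[OF c2 X(2)]) auto
  moreover have "(\<lambda>n. B (X n) (X n) / 2) \<longlonglongrightarrow> B x x / 2"
    by (intro tendsto_intros B.tendsto X(2)) auto
  ultimately show ?thesis
    by (rule LIMSEQ_le)
      (use dissipation_on_generator[OF B sym G diss X(1) \<open>0 \<le> t\<close>] in blast)
qed

end

section \<open>The energy inequality for mild solutions\<close>

lemma set_integral_atLeastLessThan:
  fixes h :: "real \<Rightarrow> 'a::{banach, second_countable_topology}"
  assumes "set_integrable lebesgue {c..d} h"
  shows "set_integrable lebesgue {c..<d} h"
    and "(LINT s:{c..<d}|lebesgue. h s) = (LINT s:{c..d}|lebesgue. h s)"
proof -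
  show *: "set_integrable lebesgue {c..<d} h"
    by (rule set_integrable_subset[OF assms]) auto
  have "AE s in lebesgue. s \<noteq> d"
    using AE_completion[OF AE_lborel_singleton[of d]] .
  then have ae: "AE s in lebesgue. indicator {c..<d} s *\<^sub>R h s = indicator {c..d} s *\<^sub>R h s"
    by eventually_elim (auto simp: indicator_def)
  show "(LINT s:{c..<d}|lebesgue. h s) = (LINT s:{c..d}|lebesgue. h s)"
    unfolding set_lebesgue_integral_def
    by (rule integral_cong_AE)
      (use assms * ae in \<open>auto simp: set_integrable_def intro: borel_measurable_integrable\<close>)
qed

context projected_semigroup
begin

text \<open>In the step from \<open>x\<close> at time \<open>c\<close> to \<open>y\<close> at time \<open>d\<close>, the free flow from \<open>x\<close> to \<open>x' = T (d - c) x\<close>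
dissipates, and the remaining jump \<open>y - x'\<close> is the Duhamel integral. The jump changes the energy by
\<open>B ((y + x') / 2) (y - x')\<close>, which is linear in \<open>f\<close>; with the midpoint in the first argument there
is no quadratic remainder to estimate.\<close>

lemma energy_increment:
  assumes B: "bounded_bilinear B" and sym: "\<And>x y. B x y = (B y x :: real)"
    and G: "continuous_on UNIV (G :: 'a \<Rightarrow> real)"
    and diss: "\<And>x y. (x, y) \<in> generator \<Longrightarrow> B x y \<le> - G x"
    and x: "T 0 x = x" and "c \<le> d"
    and int: "set_integrable lebesgue {c..d} (\<lambda>s. T (d - s) (f s))"
    and y: "(LINT s:{c..d}|lebesgue. T (d - s) (f s)) = y - T (d - c) x"
  defines "h \<equiv> \<lambda>s. B ((1/2) *\<^sub>R (y + T (d - c) x)) (T (d - s) (f s)) - G (T (s - c) x)"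
  shows "set_integrable lebesgue {c..d} h" "B y y / 2 - B x x / 2 \<le> (LINT s:{c..d}|lebesgue. h s)"
proof -
  interpret B: bounded_bilinear B by fact
  let ?m = "(1/2) *\<^sub>R (y + T (d - c) x)"
  have lin_m: "bounded_linear (B ?m)" by (rule B.bounded_linear_right)
  have i1: "set_integrable lebesgue {c..d} (\<lambda>s. B ?m (T (d - s) (f s)))"
    using integrable_bounded_linear[OF lin_m int[unfolded set_integrable_def]]
    by (simp add: set_integrable_def B.scaleR_right)
  have e1: "(LINT s:{c..d}|lebesgue. B ?m (T (d - s) (f s))) = B ?m (y - T (d - c) x)"
    using integral_bounded_linear[OF lin_m int[unfolded set_integrable_def]]
    by (simp add: set_lebesgue_integral_def B.scaleR_right flip: y)
  have contG: "continuous_on {c..d} (\<lambda>s. G (T (s - c) x))"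
    by (rule continuous_on_compose2[OF G continuous_on_orbits]) (auto intro!: continuous_intros)
  have i2: "set_integrable lebesgue {c..d} (\<lambda>s. G (T (s - c) x))"
    by (rule absolutely_integrable_continuous_real[OF contG])
  have e2: "(LINT s:{c..d}|lebesgue. G (T (s - c) x)) = integral {0..d - c} (\<lambda>s. G (T s x))"
    using set_lebesgue_integral_eq_integral(2)[OF i2]
      integral_shift_real_ivl[of c c d "\<lambda>s. G (T (s - c) x)"] by simp
  show "set_integrable lebesgue {c..d} h"
    unfolding h_def using i1 i2 by (rule set_integral_diff)
  have "(LINT s:{c..d}|lebesgue. h s) = B ?m (y - T (d - c) x) - integral {0..d - c} (\<lambda>s. G (T s x))"
    unfolding h_def using set_integral_diff(2)[OF i1 i2] e1 e2 by simp
  moreover have "B ?m (y - T (d - c) x) = B y y / 2 - B (T (d - c) x) (T (d - c) x) / 2"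
    using sym[of y "T (d - c) x"]
    by (simp add: B.scaleR_left B.add_left B.diff_right algebra_simps)
  moreover have "B (T (d - c) x) (T (d - c) x) / 2 + integral {0..d - c} (\<lambda>s. G (T s x)) \<le> B x x / 2"
    by (rule dissipation[OF B sym G diss x]) (use \<open>c \<le> d\<close> in auto)
  ultimately show "B y y / 2 - B x x / 2 \<le> (LINT s:{c..d}|lebesgue. h s)" by linarith
qed

text \<open>The increments are summed over a partition into \<open>Suc n\<close> intervals. The sum is the integral of a
piecewise defined function \<open>H n\<close>, which tends pointwise to \<open>B (U s) (f s) - G (U s)\<close>. Since \<open>f\<close> is
only integrable in time, the limit is taken by dominated convergence.\<close>

theorem mild_energy_inequality:
  assumes "a \<le> b" and contU: "continuous_on {a..b} U" and U: "\<And>t. t \<in> {a..b} \<Longrightarrow> T 0 (U t) = U t"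
    and f: "\<And>s. s \<in> {a..b} \<Longrightarrow> T 0 (f s) = f s"
    and int: "\<And>c d. a \<le> c \<Longrightarrow> c \<le> d \<Longrightarrow> d \<le> b \<Longrightarrow> set_integrable lebesgue {c..d} (\<lambda>s. T (d - s) (f s))"
    and mild: "\<And>c d. a \<le> c \<Longrightarrow> c \<le> d \<Longrightarrow> d \<le> b \<Longrightarrow>
      (LINT s:{c..d}|lebesgue. T (d - s) (f s)) = U d - T (d - c) (U c)"
    and g: "set_integrable lebesgue {a..b} g" "AE s in lebesgue. s \<in> {a..b} \<longrightarrow> norm (f s) \<le> g s"
    and B: "bounded_bilinear B" and sym: "\<And>x y. B x y = (B y x :: real)"
    and G: "continuous_on UNIV (G :: 'a \<Rightarrow> real)"
    and diss: "\<And>x y. (x, y) \<in> generator \<Longrightarrow> B x y \<le> - G x"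
  shows "set_integrable lebesgue {a..b} (\<lambda>s. B (U s) (f s))"
    and "B (U b) (U b) / 2 - B (U a) (U a) / 2 \<le> (LINT s:{a..b}|lebesgue. B (U s) (f s) - G (U s))"
proof -
  interpret B: bounded_bilinear B by fact
  define \<delta> where "\<delta> n = (b - a) / real (Suc n)" for n
  define t where "t n i = a + real i * \<delta> n" for n i
  have t0: "t n 0 = a" and tN: "t n (Suc n) = b" for n by (auto simp: t_def \<delta>_def)
  have \<delta>_nonneg: "0 \<le> \<delta> n" and \<delta>_le: "\<delta> n \<le> b - a" for n
    using \<open>a \<le> b\<close> divide_left_mono[of 1 "real (Suc n)" "b - a"] by (auto simp: \<delta>_def)
  have t_Suc: "t n (Suc i) = t n i + \<delta> n" for n i by (simp add: t_def algebra_simps)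
  have t_mono: "t n i \<le> t n j" if "i \<le> j" for n i j
    using that \<delta>_nonneg by (simp add: t_def mult_right_mono)
  have t_ab: "a \<le> t n i" "i \<le> Suc n \<Longrightarrow> t n i \<le> b" for n i
    using t_mono[of 0 i n] t_mono[of i "Suc n" n] by (auto simp: t0 tN)
  \<comment> \<open>Half-open intervals: each \<open>s\<close> with \<open>a \<le> s < b\<close> is in exactly one.\<close>
  define I where "I n i = {t n i..<t n (Suc i)}" for n i
  define h where "h n i s = B ((1/2) *\<^sub>R (U (t n (Suc i)) + T (t n (Suc i) - t n i) (U (t n i))))
      (T (t n (Suc i) - s) (f s)) - G (T (s - t n i) (U (t n i)))" for n i s
  have step: "set_integrable lebesgue {t n i..t n (Suc i)} (h n i)"
    "B (U (t n (Suc i))) (U (t n (Suc i))) / 2 - B (U (t n i)) (U (t n i)) / 2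
      \<le> (LINT s:{t n i..t n (Suc i)}|lebesgue. h n i s)" if "i < Suc n" for n i
    unfolding h_def
    by (rule energy_increment[OF B sym G diss U _ int mild];
        use t_ab(1)[of n i] t_ab(2)[of i n] t_ab(2)[of "Suc i" n] t_mono[of i "Suc i" n] that in simp_all)+
  define H where "H n s = (\<Sum>i<Suc n. indicator (I n i) s *\<^sub>R h n i s)" for n s
  have int_I: "integrable lebesgue (\<lambda>s. indicator (I n i) s *\<^sub>R h n i s)" if "i < Suc n" for n i
    using set_integral_atLeastLessThan(1)[OF step(1)[OF that]] by (simp add: I_def set_integrable_def)
  have int_H: "integrable lebesgue (H n)" for n
    unfolding H_def by (rule Bochner_Integration.integrable_sum) (use int_I in auto)
  have sum_H: "B (U b) (U b) / 2 - B (U a) (U a) / 2 \<le> integral\<^sup>L lebesgue (H n)" for n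
  proof -
    have "B (U b) (U b) / 2 - B (U a) (U a) / 2
        = (\<Sum>i<Suc n. B (U (t n (Suc i))) (U (t n (Suc i))) / 2 - B (U (t n i)) (U (t n i)) / 2)"
      by (subst sum_lessThan_telescope) (simp add: t0 tN)
    also have "\<dots> \<le> (\<Sum>i<Suc n. LINT s:I n i|lebesgue. h n i s)"
      using step set_integral_atLeastLessThan(2)[OF step(1)] by (intro sum_mono) (simp add: I_def)
    also have "\<dots> = integral\<^sup>L lebesgue (H n)"
      unfolding H_def set_lebesgue_integral_def
      by (subst Bochner_Integration.integral_sum) (use int_I in auto)
    finally show ?thesis .
  qed
  \<comment> \<open>The index of the interval that contains \<open>s\<close>.\<close>
  define i where "i n s = nat \<lfloor>(s - a) / \<delta> n\<rfloor>" for n s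
  have i: "i n s < Suc n" "s \<in> I n (i n s)" if s: "s \<in> {a..<b}" for n s
  proof -
    have pos: "0 < \<delta> n" using s by (simp add: \<delta>_def)
    have r: "real (i n s) \<le> (s - a) / \<delta> n" "(s - a) / \<delta> n < real (i n s) + 1"
      using s pos unfolding i_def by (auto simp: of_nat_nat)
    have "(s - a) / \<delta> n < real (Suc n)"
    proof -
      have "real (Suc n) * \<delta> n = b - a" by (simp add: \<delta>_def)
      then show ?thesis using s pos by (simp only: pos_divide_less_eq) simp
    qed
    with r(1) show "i n s < Suc n" by linarith
    show "s \<in> I n (i n s)"
      using r pos by (simp add: I_def t_def field_simps)
  qed
  have I_unique: "j = i n s" if "s \<in> I n j" "s \<in> {a..<b}" for n j s
  proof (rule ccontr)
    assume "j \<noteq> i n s"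
    then have "Suc j \<le> i n s \<or> Suc (i n s) \<le> j" by linarith
    then show False
      using t_mono[of "Suc j" "i n s" n] t_mono[of "Suc (i n s)" j n] that i(2)[OF that(2), of n]
      by (auto simp: I_def)
  qed
  have I_sub: "I n j \<subseteq> {a..<b}" if "j < Suc n" for n j
    using t_ab(1)[of n j] t_ab(2)[of "Suc j" n] that by (auto simp: I_def)
  have H_in: "H n s = h n (i n s) s" if s: "s \<in> {a..<b}" for n s
  proof -
    have "H n s = (\<Sum>j<Suc n. if j = i n s then h n (i n s) s else 0)"
      unfolding H_def by (rule sum.cong) (use I_unique[OF _ s] i[OF s] in \<open>auto simp: indicator_def\<close>)
    also have "\<dots> = h n (i n s) s" using i(1)[OF s, of n] by (subst sum.delta) auto
    finally show ?thesis .
  qed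
  have H_out: "H n s = 0" if s: "s \<notin> {a..<b}" for n s
  proof -
    have "s \<notin> I n j" if "j < Suc n" for j using I_sub[OF that] s by blast
    then show ?thesis unfolding H_def by (intro sum.neutral) (simp add: indicator_def)
  qed
  define k where "k s = indicator {a..<b} s *\<^sub>R (B (U s) (f s) - G (U s))" for s
  have \<delta>_lim: "\<delta> \<longlonglongrightarrow> 0"
    unfolding \<delta>_def using tendsto_mult_left[OF LIMSEQ_inverse_real_of_nat, of "b - a"]
    by (simp add: divide_inverse)
  have H_lim: "(\<lambda>n. H n s) \<longlonglongrightarrow> k s" for s
  proof (cases "s \<in> {a..<b}")
    case False
    then show ?thesis by (simp add: H_out k_def)
  next
    case True
    define l r where "l n = t n (i n s)" and "r n = t n (Suc (i n s))" for n
    have lr: "l n \<le> s" "s \<le> r n" "r n = l n + \<delta> n" "a \<le> l n" "r n \<le> b" for n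
      using i[OF True, of n] t_Suc[of n "i n s"] t_ab(1)[of n "i n s"] t_ab(2)[of "Suc (i n s)" n]
      by (auto simp: l_def r_def I_def)
    have l: "l \<longlonglongrightarrow> s"
    proof (rule tendsto_sandwich[of "\<lambda>n. s - \<delta> n" _ _ "\<lambda>n. s"])
      show "(\<lambda>n. s - \<delta> n) \<longlonglongrightarrow> s" using tendsto_diff[OF tendsto_const \<delta>_lim, of s] by simp
    qed (use lr in \<open>auto simp: algebra_simps intro!: always_eventually\<close>)
    have r: "r \<longlonglongrightarrow> s"
      using tendsto_add[OF l \<delta>_lim] unfolding lr(3)[symmetric] by simp
    have s_ab: "s \<in> {a..b}" using True by simp
    have lr_ab: "l n \<in> {a..b}" "r n \<in> {a..b}" for n
      using lr(1)[of n] lr(2)[of n] lr(4)[of n] lr(5)[of n] True by auto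
    have Ul: "(\<lambda>n. U (l n)) \<longlonglongrightarrow> U s"
      by (rule continuous_on_tendsto_compose[OF contU l s_ab])
        (use lr_ab in \<open>auto intro!: always_eventually\<close>)
    have Ur: "(\<lambda>n. U (r n)) \<longlonglongrightarrow> U s"
      by (rule continuous_on_tendsto_compose[OF contU r s_ab])
        (use lr_ab in \<open>auto intro!: always_eventually\<close>)
    have z: "(\<lambda>n. r n - s) \<longlonglongrightarrow> 0" "(\<lambda>n. s - l n) \<longlonglongrightarrow> 0" "(\<lambda>n. r n - l n) \<longlonglongrightarrow> 0"
      using tendsto_diff[OF r tendsto_const, of s] tendsto_diff[OF tendsto_const l, of s]
        tendsto_diff[OF r l] by auto
    have T1: "(\<lambda>n. T (r n - l n) (U (l n))) \<longlonglongrightarrow> U s"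
      using tendsto_orbits[OF z(3) Ul] lr U[OF s_ab] \<delta>_nonneg by simp
    have T2: "(\<lambda>n. T (r n - s) (f s)) \<longlonglongrightarrow> f s"
      using tendsto_orbits[OF z(1) tendsto_const[of "f s"]] lr f[OF s_ab] by simp
    have T3: "(\<lambda>n. T (s - l n) (U (l n))) \<longlonglongrightarrow> U s"
      using tendsto_orbits[OF z(2) Ul] lr U[OF s_ab] by simp
    have "(\<lambda>n. B ((1/2) *\<^sub>R (U (r n) + T (r n - l n) (U (l n)))) (T (r n - s) (f s)) - G (T (s - l n) (U (l n))))
        \<longlonglongrightarrow> B ((1/2) *\<^sub>R (U s + U s)) (f s) - G (U s)"
      by (intro tendsto_intros B.tendsto Ur T1 T2 continuous_on_tendsto_compose[OF G T3]) auto
    moreover have "(1/2) *\<^sub>R (U s + U s) = U s" by (simp flip: scaleR_2)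
    ultimately show ?thesis
      using True by (simp add: H_in h_def k_def l_def r_def)
  qed
  obtain M where M: "1 \<le> M" "\<And>t x. 0 \<le> t \<Longrightarrow> t \<le> b - a \<Longrightarrow> norm (T t x) \<le> M * norm x"
    using locally_bounded by blast
  obtain R where R: "0 < R" "\<And>t. t \<in> {a..b} \<Longrightarrow> norm (U t) \<le> R"
    using compact_imp_bounded[OF compact_continuous_image[OF contU compact_Icc]]
    unfolding bounded_pos by auto
  obtain K where K: "0 \<le> K" "\<And>x y. norm (B x y) \<le> norm x * norm y * K"
    using B.nonneg_bounded by blast
  have "continuous_on ({0..b-a} \<times> {a..b}) (\<lambda>p. T (fst p) (U (snd p)))"
    by (intro continuous_on_orbits continuous_intros continuous_on_compose2[OF contU]) auto
  then have "continuous_on ({0..b-a} \<times> {a..b}) (\<lambda>p. G (T (fst p) (U (snd p))))"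
    by (rule continuous_on_compose2[OF G]) auto
  from compact_imp_bounded[OF compact_continuous_image[OF this compact_Times[OF compact_Icc compact_Icc]]]
  obtain C where C: "\<And>r t. r \<in> {0..b-a} \<Longrightarrow> t \<in> {a..b} \<Longrightarrow> \<bar>G (T r (U t))\<bar> \<le> C"
    unfolding bounded_pos by (auto simp: image_iff) force
  define w where "w s = indicator {a..b} s *\<^sub>R ((M * R) * (M * g s) * K + C)" for s
  have int_w: "integrable lebesgue w"
  proof -
    have "set_integrable lebesgue {a..b} (\<lambda>s. (M * R) * (M * g s) * K + C)"
      using g(1) absolutely_integrable_continuous_real[OF continuous_on_const, of a b C]
      by (intro set_integral_add) auto
    then show ?thesis by (simp add: w_def[abs_def] set_integrable_def)
  qed
  have H_bound: "AE s in lebesgue. norm (H n s) \<le> w s" for n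
    using g(2)
  proof eventually_elim
    case (elim s)
    show ?case
    proof (cases "s \<in> {a..<b}")
      case False
      have "0 \<le> w s"
      proof (cases "s \<in> {a..b}")
        case True
        then have "0 \<le> g s" using elim norm_ge_zero[of "f s"] by linarith
        moreover have "0 \<le> C" using C[of 0 a] \<open>a \<le> b\<close> by force
        ultimately show ?thesis using M R K by (simp add: w_def)
      qed (simp add: w_def)
      then show ?thesis using H_out[OF False] by simp
    next
      case True
      define l r where "l = t n (i n s)" and "r = t n (Suc (i n s))"
      have lr: "l \<le> s" "s \<le> r" "r = l + \<delta> n" "a \<le> l" "r \<le> b"
        using i[OF True, of n] t_Suc[of n "i n s"] t_ab(1)[of n "i n s"] t_ab(2)[of "Suc (i n s)" n]
        by (auto simp: l_def r_def I_def)
      have s_ab: "s \<in> {a..b}" using True by simp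
      have 1: "norm (T (r - l) (U l)) \<le> M * R"
        using M(2)[of "r - l" "U l"] R(2)[of l] lr \<delta>_nonneg[of n] \<delta>_le[of n] M(1)
        by (auto intro: order_trans mult_left_mono)
      have 2: "norm (U r) \<le> M * R"
      proof -
        have "norm (U r) \<le> R" using R(2)[of r] lr(2,4,5) True by auto
        moreover have "R \<le> M * R" using M(1) R(1) by simp
        ultimately show ?thesis by linarith
      qed
      have m: "norm ((1/2) *\<^sub>R (U r + T (r - l) (U l))) \<le> M * R"
        using norm_triangle_ineq[of "U r" "T (r - l) (U l)"] 1 2 by simp
      have "norm (T (r - s) (f s)) \<le> M * norm (f s)" using M(2)[of "r - s"] lr by simp
      also have "\<dots> \<le> M * g s" using elim s_ab M(1) by (intro mult_left_mono) auto
      finally have fs: "norm (T (r - s) (f s)) \<le> M * g s" .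
      have "norm (B ((1/2) *\<^sub>R (U r + T (r - l) (U l))) (T (r - s) (f s))) \<le> (M * R) * (M * g s) * K"
        using m fs M(1) R(1) K(1)
        by (intro order_trans[OF K(2)] mult_right_mono mult_mono) auto
      moreover have "\<bar>G (T (s - l) (U l))\<bar> \<le> C" using C[of "s - l" l] lr s_ab by auto
      ultimately show ?thesis
        using s_ab by (simp add: H_in[OF True] h_def w_def flip: l_def r_def)
    qed
  qed
  have [measurable]: "H n \<in> borel_measurable lebesgue" for n
    using int_H by (rule borel_measurable_integrable)
  have k_meas: "k \<in> borel_measurable lebesgue"
    by (rule borel_measurable_LIMSEQ_real[OF H_lim]) simp
  have int_k: "integrable lebesgue k"
    by (rule integrable_dominated_convergence[where s = H and w = w])
      (use k_meas int_w H_bound H_lim in auto)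
  have lim_k: "(\<lambda>n. integral\<^sup>L lebesgue (H n)) \<longlonglongrightarrow> integral\<^sup>L lebesgue k"
    by (rule integral_dominated_convergence[where w = w])
      (use k_meas int_w H_bound H_lim in auto)
  have contG: "continuous_on {a..b} (\<lambda>s. G (U s))"
    by (rule continuous_on_compose2[OF G contU]) auto
  have int_G: "set_integrable lebesgue {a..b} (\<lambda>s. G (U s))"
    by (rule absolutely_integrable_continuous_real[OF contG])
  have int_k': "set_integrable lebesgue {a..b} (\<lambda>s. B (U s) (f s) - G (U s))"
  proof -
    have "set_integrable lebesgue {a..<b} (\<lambda>s. B (U s) (f s) - G (U s))"
      using int_k by (simp add: set_integrable_def k_def[abs_def])
    moreover have "set_integrable lebesgue {b} (\<lambda>s. B (U s) (f s) - G (U s))"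
    proof -
      have "(\<lambda>s. indicator {b} s *\<^sub>R (B (U s) (f s) - G (U s)))
          = (\<lambda>s. indicator {b} s *\<^sub>R (B (U b) (f b) - G (U b)))"
        by (auto simp: fun_eq_iff indicator_def)
      moreover have "integrable lebesgue (\<lambda>s. indicator {b} s *\<^sub>R (B (U b) (f b) - G (U b)))"
        by (intro integrable_scaleR_left integrable_real_indicator) auto
      ultimately show ?thesis by (simp only: set_integrable_def)
    qed
    ultimately have "set_integrable lebesgue ({a..<b} \<union> {b}) (\<lambda>s. B (U s) (f s) - G (U s))"
      by (rule set_integrable_Un) auto
    moreover have "{a..<b} \<union> {b} = {a..b}" using \<open>a \<le> b\<close> by auto
    ultimately show ?thesis by simp
  qed
  show "set_integrable lebesgue {a..b} (\<lambda>s. B (U s) (f s))"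
    using set_integral_add(1)[OF int_k' int_G] by simp
  have "integral\<^sup>L lebesgue k = (LINT s:{a..b}|lebesgue. B (U s) (f s) - G (U s))"
    using set_integral_atLeastLessThan(2)[OF int_k'] by (simp add: set_lebesgue_integral_def k_def[abs_def])
  with LIMSEQ_le_const[OF lim_k] sum_H
  show "B (U b) (U b) / 2 - B (U a) (U a) / 2 \<le> (LINT s:{a..b}|lebesgue. B (U s) (f s) - G (U s))"
    by metis
qed

end

section \<open>Square integrable functions on an interval\<close>

lemma norm_L2_mono:
  assumes "AE x in lebesgue. \<bar>fun_of F x\<bar> \<le> \<bar>fun_of G x\<bar>"
  shows "norm F \<le> norm G"
proof -
  have "(norm F)\<^sup>2 \<le> (norm G)\<^sup>2"
    unfolding norm_L2_sq
    by (rule integral_mono_AE)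
      (use assms square_integrable_fun_of in \<open>auto simp: square_integrable_def abs_le_square_iff\<close>)
  then show ?thesis by (rule power2_le_imp_le) simp
qed

lemma inner_L2_cong:
  assumes "AE x in lebesgue. fun_of F x * fun_of G x = fun_of F' x * fun_of G' x"
  shows "F \<bullet> G = F' \<bullet> G'"
  unfolding inner_L2_def by (rule integral_cong_AE) (use assms in auto)

lemma L2_onD: "F \<in> L2_on a b \<Longrightarrow> AE x in lebesgue. x \<notin> {a<..<b} \<longrightarrow> fun_of F x = 0"
  by (simp add: L2_on_def)

lemma L2_on_add:
  assumes "F \<in> L2_on a b" "G \<in> L2_on a b"
  shows "F + G \<in> L2_on a b"
  unfolding L2_on_def mem_Collect_eq
  using fun_of_add[of F G] L2_onD[OF assms(1)] L2_onD[OF assms(2)] by eventually_elim auto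

lemma L2_on_diff:
  assumes "F \<in> L2_on a b" "G \<in> L2_on a b"
  shows "F - G \<in> L2_on a b"
  unfolding L2_on_def mem_Collect_eq
  using fun_of_diff[of F G] L2_onD[OF assms(1)] L2_onD[OF assms(2)] by eventually_elim auto

lemma L2_on_scale:
  assumes "F \<in> L2_on a b"
  shows "c *\<^sub>R F \<in> L2_on a b"
  unfolding L2_on_def mem_Collect_eq
  using fun_of_scaleR[of c F] L2_onD[OF assms(1)] by eventually_elim auto

lemma L2_on_zero [simp]: "0 \<in> L2_on a b"
  unfolding L2_on_def mem_Collect_eq using fun_of_zero by eventually_elim auto

text \<open>The inner product with \<open>chi x\<close> is the integral over \<open>(0, x)\<close>; primitives are written in this way
below, so that they are continuous in the integrand with respect to the norm.\<close>

definition chi :: "real \<Rightarrow> L2" where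
  "chi x = to_L2 (indicator {0<..<x})"

lemma square_integrable_indicator: "square_integrable (indicator {a<..<b})"
proof -
  have "(\<lambda>x. (indicator {a<..<b} x)\<^sup>2) = (indicator {a<..<b} :: real \<Rightarrow> real)"
    by (auto simp: fun_eq_iff indicator_def)
  moreover have "integrable lebesgue (indicator {a<..<b} :: real \<Rightarrow> real)"
    by (rule integrable_real_indicator) (use emeasure_bounded_finite[of "{a<..<b}"] in auto)
  ultimately show ?thesis by (simp add: square_integrable_def)
qed

lemma fun_of_chi: "AE y in lebesgue. fun_of (chi x) y = indicator {0<..<x} y"
  unfolding chi_def by (rule fun_of_to_L2[OF square_integrable_indicator])

lemma norm_chi_diff:
  assumes "0 \<le> x" "x \<le> y"
  shows "norm (chi y - chi x) = sqrt (y - x)"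
proof -
  have "(norm (chi y - chi x))\<^sup>2 = (LINT r|lebesgue. indicator {x<..<y} r)"
    unfolding norm_L2_sq
  proof (rule integral_cong_AE)
    have "AE r in lebesgue. r \<noteq> x" using AE_completion[OF AE_lborel_singleton[of x]] .
    then show "AE r in lebesgue. (fun_of (chi y - chi x) r)\<^sup>2 = indicator {x<..<y} r"
      using fun_of_chi[of x] fun_of_chi[of y] fun_of_diff[of "chi y" "chi x"]
      by eventually_elim (use assms in \<open>auto simp: indicator_def\<close>)
    show "indicat_real {x<..<y} \<in> borel_measurable lebesgue"
      by (rule borel_measurable_indicator) simp
  qed auto
  also have "\<dots> = y - x" using assms by simp
  finally show ?thesis by (simp add: real_sqrt_unique)
qed

lemma chi_0 [simp]: "chi 0 = 0"
  unfolding chi_def to_L2_zero[symmetric] by (rule arg_cong[where f = to_L2]) (auto simp: fun_eq_iff)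

lemma norm_chi: "0 \<le> x \<Longrightarrow> norm (chi x) = sqrt x"
  using norm_chi_diff[of 0 x] by simp

locale bounded_interval =
  fixes L :: real
  assumes L_pos: "0 < L"
begin

abbreviation emb :: "(real \<Rightarrow> real) \<Rightarrow> L2" where "emb \<equiv> restrict_to_L2 0 L"

text \<open>Multiplication by a function that is continuous on \<open>[0, L]\<close>, with restriction to \<open>(0, L)\<close>. The
factor is a weight or the continuous representative of an \<open>H\<^sup>1\<close> function.\<close>

definition cmul :: "(real \<Rightarrow> real) \<Rightarrow> L2 \<Rightarrow> L2" where
  "cmul w F = to_L2 (\<lambda>x. indicator {0<..<L} x * w x * fun_of F x)"

abbreviation cont :: "(real \<Rightarrow> real) \<Rightarrow> bool" where "cont w \<equiv> continuous_on {0..L} w"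

lemma cont_measurable:
  assumes "cont w"
  shows "(\<lambda>x. indicator {0<..<L} x * w x) \<in> borel_measurable lebesgue"
proof -
  have "set_integrable lebesgue {0<..<L} w"
    by (rule set_integrable_subset[OF absolutely_integrable_continuous_real[OF assms]]) auto
  then show ?thesis unfolding set_integrable_def by (auto dest: borel_measurable_integrable)
qed

lemma cont_bounded:
  assumes "cont w"
  obtains M where "0 \<le> M" "\<And>x. x \<in> {0..L} \<Longrightarrow> \<bar>w x\<bar> \<le> M"
  using compact_imp_bounded[OF compact_continuous_image[OF assms compact_Icc]]
  unfolding bounded_iff by (metis abs_ge_zero atLeastAtMost_iff imageI order_trans real_norm_def L_pos less_imp_le order_refl)

lemma square_integrable_cont:
  assumes "cont w"
  shows "square_integrable (\<lambda>x. indicator {0<..<L} x * w x)"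
proof -
  obtain M where M: "0 \<le> M" "\<And>x. x \<in> {0..L} \<Longrightarrow> \<bar>w x\<bar> \<le> M" using cont_bounded[OF assms] by blast
  show ?thesis
    by (rule square_integrable_bound[OF cont_measurable[OF assms]
          square_integrable_scale[OF square_integrable_indicator[of 0 L], of M]])
      (use M in \<open>auto simp: indicator_def\<close>)
qed

lemma square_integrable_cmul:
  assumes "cont w"
  shows "square_integrable (\<lambda>x. indicator {0<..<L} x * w x * fun_of F x)"
proof -
  obtain M where M: "0 \<le> M" "\<And>x. x \<in> {0..L} \<Longrightarrow> \<bar>w x\<bar> \<le> M" using cont_bounded[OF assms] by blast
  have "(\<lambda>x. indicator {0<..<L} x * w x * fun_of F x) \<in> borel_measurable lebesgue"
    using cont_measurable[OF assms] by (rule borel_measurable_times) simp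
  then show ?thesis
    by (rule square_integrable_bound[OF _ square_integrable_scale[OF square_integrable_fun_of[of F], of M]])
      (use M in \<open>auto simp: indicator_def abs_mult intro!: mult_right_mono\<close>)
qed

lemma fun_of_cmul:
  "cont w \<Longrightarrow> AE x in lebesgue. fun_of (cmul w F) x = indicator {0<..<L} x * w x * fun_of F x"
  unfolding cmul_def by (rule fun_of_to_L2[OF square_integrable_cmul])

lemma fun_of_emb:
  "cont w \<Longrightarrow> AE x in lebesgue. fun_of (emb w) x = indicator {0<..<L} x * w x"
  unfolding restrict_to_L2_def by (rule fun_of_to_L2[OF square_integrable_cont])

lemma emb_in [simp]: "cont w \<Longrightarrow> emb w \<in> L2_on 0 L"
  unfolding L2_on_def mem_Collect_eq
  using fun_of_emb by (rule eventually_mono) (auto simp: indicator_def)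

lemma cmul_in [simp]: "cont w \<Longrightarrow> cmul w F \<in> L2_on 0 L"
  unfolding L2_on_def mem_Collect_eq
  using fun_of_cmul by (rule eventually_mono) (auto simp: indicator_def)

lemma chi_in: "x \<le> L \<Longrightarrow> chi x \<in> L2_on 0 L"
  unfolding L2_on_def mem_Collect_eq
  using fun_of_chi by (rule eventually_mono) (auto simp: indicator_def)

lemma emb_add: "cont c \<Longrightarrow> cont d \<Longrightarrow> emb (\<lambda>x. c x + d x) = emb c + emb d"
  using to_L2_add[OF square_integrable_cont square_integrable_cont, of c d]
  by (simp add: restrict_to_L2_def distrib_left)

lemma emb_diff: "cont c \<Longrightarrow> cont d \<Longrightarrow> emb (\<lambda>x. c x - d x) = emb c - emb d"
  using to_L2_diff[OF square_integrable_cont square_integrable_cont, of c d]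
  by (simp add: restrict_to_L2_def right_diff_distrib)

lemma emb_scale: "cont c \<Longrightarrow> emb (\<lambda>x. r * c x) = r *\<^sub>R emb c"
  using to_L2_scale[OF square_integrable_cont, of c r]
  by (simp add: restrict_to_L2_def mult.left_commute)

lemma cmul_add:
  assumes "cont w"
  shows "cmul w (F + G) = cmul w F + cmul w G"
  unfolding L2_eq_iff
  using fun_of_cmul[OF assms, of "F + G"] fun_of_cmul[OF assms, of F] fun_of_cmul[OF assms, of G]
    fun_of_add[of F G] fun_of_add[of "cmul w F" "cmul w G"]
  by eventually_elim (simp add: distrib_left)

lemma cmul_diff:
  assumes "cont w"
  shows "cmul w (F - G) = cmul w F - cmul w G"
  unfolding L2_eq_iff
  using fun_of_cmul[OF assms, of "F - G"] fun_of_cmul[OF assms, of F] fun_of_cmul[OF assms, of G]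
    fun_of_diff[of F G] fun_of_diff[of "cmul w F" "cmul w G"]
  by eventually_elim (simp add: right_diff_distrib)

lemma cmul_scale:
  assumes "cont w"
  shows "cmul w (r *\<^sub>R F) = r *\<^sub>R cmul w F"
  unfolding L2_eq_iff
  using fun_of_cmul[OF assms, of "r *\<^sub>R F"] fun_of_cmul[OF assms, of F] fun_of_scaleR[of r F]
    fun_of_scaleR[of r "cmul w F"]
  by eventually_elim simp

lemma cmul_add_left:
  assumes "cont w" "cont w'"
  shows "cmul (\<lambda>x. w x + w' x) F = cmul w F + cmul w' F"
  unfolding L2_eq_iff
  using fun_of_cmul[OF continuous_on_add[OF assms], of F] fun_of_cmul[OF assms(1), of F]
    fun_of_cmul[OF assms(2), of F] fun_of_add[of "cmul w F" "cmul w' F"]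
  by eventually_elim (simp add: algebra_simps)

lemma cmul_diff_left:
  assumes "cont w" "cont w'"
  shows "cmul (\<lambda>x. w x - w' x) F = cmul w F - cmul w' F"
  unfolding L2_eq_iff
  using fun_of_cmul[OF continuous_on_diff[OF assms], of F] fun_of_cmul[OF assms(1), of F]
    fun_of_cmul[OF assms(2), of F] fun_of_diff[of "cmul w F" "cmul w' F"]
  by eventually_elim (simp add: algebra_simps)

lemma cmul_emb:
  assumes "cont w" "cont c"
  shows "cmul w (emb c) = emb (\<lambda>x. w x * c x)"
  unfolding L2_eq_iff
  using fun_of_cmul[OF assms(1), of "emb c"] fun_of_emb[OF assms(2)] fun_of_emb[OF continuous_on_mult[OF assms]]
  by eventually_elim (auto simp: indicator_def)

lemma cmul_const:
  assumes "F \<in> L2_on 0 L"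
  shows "cmul (\<lambda>x. r) F = r *\<^sub>R F"
  unfolding L2_eq_iff
  using fun_of_cmul[OF continuous_on_const, of r F] fun_of_scaleR[of r F] L2_onD[OF assms]
  by eventually_elim (auto simp: indicator_def)

lemma emb_eq_cmul:
  assumes "cont c"
  shows "emb c = cmul c (chi L)"
  unfolding L2_eq_iff
  using fun_of_cmul[OF assms, of "chi L"] fun_of_emb[OF assms] fun_of_chi[of L]
  by eventually_elim (auto simp: indicator_def)

lemma norm_cmul_le:
  assumes "cont w" "\<And>x. x \<in> {0..L} \<Longrightarrow> \<bar>w x\<bar> \<le> M"
  shows "norm (cmul w F) \<le> M * norm F"
proof -
  have "0 \<le> M" using assms(2)[of 0] L_pos by force
  have "norm (cmul w F) \<le> norm (M *\<^sub>R F)"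
  proof (rule norm_L2_mono)
    show "AE x in lebesgue. \<bar>fun_of (cmul w F) x\<bar> \<le> \<bar>fun_of (M *\<^sub>R F) x\<bar>"
      using fun_of_cmul[OF assms(1), of F] fun_of_scaleR[of M F]
    proof eventually_elim
      case (elim x)
      have "\<bar>w x\<bar> * \<bar>fun_of F x\<bar> \<le> M * \<bar>fun_of F x\<bar>" if "x \<in> {0<..<L}"
        using assms(2)[of x] that by (intro mult_right_mono) auto
      then show ?case using elim \<open>0 \<le> M\<close> by (auto simp: indicator_def abs_mult)
    qed
  qed
  then show ?thesis using \<open>0 \<le> M\<close> by simp
qed

lemma norm_emb_le:
  assumes "cont c" "\<And>x. x \<in> {0..L} \<Longrightarrow> \<bar>c x\<bar> \<le> M"
  shows "norm (emb c) \<le> M * sqrt L"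
  using norm_cmul_le[OF assms, of "chi L"] norm_chi[of L] L_pos
  by (simp add: emb_eq_cmul[OF assms(1)])

lemma inner_cmul:
  assumes "cont w"
  shows "cmul w F \<bullet> G = F \<bullet> cmul w G"
proof (rule inner_L2_cong)
  show "AE x in lebesgue. fun_of (cmul w F) x * fun_of G x = fun_of F x * fun_of (cmul w G) x"
    using fun_of_cmul[OF assms, of F] fun_of_cmul[OF assms, of G] by eventually_elim simp
qed

lemma cmul_inner_chi:
  assumes "cont w"
  shows "cmul w F \<bullet> chi L = emb w \<bullet> F"
  by (metis assms emb_eq_cmul inner_cmul inner_commute)

lemma emb_inner_chi:
  assumes "cont c" "x \<in> {0..L}"
  shows "emb c \<bullet> chi x = integral {0..x} c"
proof -
  have cx: "continuous_on {0..x} c" by (rule continuous_on_subset[OF assms(1)]) (use assms in auto)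
  have int: "set_integrable lebesgue {0<..<x} c"
    by (rule set_integrable_subset[OF absolutely_integrable_continuous_real[OF cx]]) auto
  have "emb c \<bullet> chi x = (LINT y:{0<..<x}|lebesgue. c y)"
    unfolding inner_L2_def set_lebesgue_integral_def
  proof (rule integral_cong_AE)
    show "AE y in lebesgue. fun_of (emb c) y * fun_of (chi x) y = indicator {0<..<x} y *\<^sub>R c y"
      using fun_of_emb[OF assms(1)] fun_of_chi[of x]
      by eventually_elim (use assms(2) in \<open>auto simp: indicator_def\<close>)
  qed (use int in \<open>auto simp: set_integrable_def intro: borel_measurable_integrable\<close>)
  also have "\<dots> = integral {0<..<x} c" by (rule set_lebesgue_integral_eq_integral(2)[OF int])
  also have "\<dots> = integral {0..x} c" by (simp add: integral_open_interval_real)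
  finally show ?thesis .
qed

lemma emb_inner_emb:
  assumes "cont c" "cont d"
  shows "emb c \<bullet> emb d = integral {0..L} (\<lambda>x. c x * d x)"
proof -
  have "emb c \<bullet> emb d = emb (\<lambda>x. c x * d x) \<bullet> chi L"
    using assms by (simp add: emb_eq_cmul[of d] inner_cmul[symmetric] cmul_emb mult.commute)
  then show ?thesis using assms L_pos by (simp add: emb_inner_chi continuous_on_mult)
qed

lemma emb_eq_imp_eq:
  assumes "cont c" "cont d" "emb c = emb d" "x \<in> {0..L}"
  shows "c x = d x"
proof -
  have cd: "cont (\<lambda>x. c x - d x)" using assms by (intro continuous_intros)
  have "integral {0..L} (\<lambda>x. (c x - d x) * (c x - d x)) = 0"
    using emb_inner_emb[OF cd cd] assms(3) emb_diff[OF assms(1,2)] by simp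
  then have "\<forall>x\<in>{0..L}. (c x - d x) * (c x - d x) = 0"
    by (subst (asm) integral_eq_0_iff) (use cd L_pos in \<open>auto intro!: continuous_intros assms\<close>)
  then show ?thesis using assms(4) by auto
qed

definition C1 :: "(real \<Rightarrow> real) \<Rightarrow> (real \<Rightarrow> real) \<Rightarrow> bool" where
  "C1 p p' \<longleftrightarrow> (\<forall>x. (p has_real_derivative p' x) (at x)) \<and> continuous_on UNIV p'"

lemma C1_cont:
  assumes "C1 p p'"
  shows "cont p" "cont p'"
proof -
  have "continuous_on UNIV p"
    using assms by (auto simp: C1_def continuous_on_eq_continuous_at intro: DERIV_isCont)
  then show "cont p" "cont p'"
    using assms by (auto simp: C1_def intro: continuous_on_subset)
qed

text \<open>A measurable function is an almost everywhere limit of continuous ones. Truncated at height \<open>k\<close>,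
these converge in \<open>L\<^sup>2\<close>; then \<open>k\<close> tends to infinity. Continuous functions are approximated uniformly
by polynomials.\<close>

lemma emb_dense:
  assumes F: "F \<in> L2_on 0 L"
  obtains p p' where "\<And>n. C1 (p n) (p' n)" "(\<lambda>n. emb (p n)) \<longlonglongrightarrow> F"
proof -
  define C where "C = closure {emb p | p p'. C1 p p'}"
  have C_lim: "x \<in> C" if "\<And>n. X n \<in> C" "X \<longlonglongrightarrow> x" for X x
    using closed_sequentially[OF closed_closure] that unfolding C_def by blast
  have cont_C: "emb c \<in> C" if c: "cont c" for c
    unfolding C_def closure_approachable
  proof (intro allI impI)
    fix e :: real assume "0 < e"
    define e' where "e' = e / (2 * sqrt L)"
    have e': "0 < e'" "e' * sqrt L < e" using \<open>0 < e\<close> L_pos by (auto simp: e'_def field_simps)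
    obtain p where p: "real_polynomial_function p" "\<And>x. x \<in> {0..L} \<Longrightarrow> \<bar>c x - p x\<bar> < e'"
      using Stone_Weierstrass_real_polynomial_function[OF compact_Icc c e'(1)] by blast
    obtain p' where p': "real_polynomial_function p'" "\<And>x. (p has_real_derivative p' x) (at x)"
      using has_real_derivative_polynomial_function[OF p(1)] by blast
    have C1: "C1 p p'"
      using p' continuous_on_polymonial_function[of p' UNIV]
      by (auto simp: C1_def real_polynomial_function_eq)
    have cp: "cont (\<lambda>x. c x - p x)" using c C1_cont[OF C1] by (intro continuous_intros)
    have "norm (emb (\<lambda>x. c x - p x)) \<le> e' * sqrt L"
      by (rule norm_emb_le[OF cp]) (use p(2) in \<open>auto intro: less_imp_le\<close>)
    then have "dist (emb p) (emb c) < e"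
      using e'(2) emb_diff[OF c C1_cont(1)[OF C1]] by (simp add: dist_norm norm_minus_commute)
    with C1 show "\<exists>y\<in>{emb p | p p'. C1 p p'}. dist y (emb c) < e" by blast
  qed
  obtain N g where N: "negligible N" and g: "\<And>n. continuous_on UNIV (g n)"
    and lim: "\<And>x. x \<notin> N \<Longrightarrow> (\<lambda>n. g n x) \<longlonglongrightarrow> fun_of F x"
    using lebesgue_measurable_imp_measurable_on_real[OF fun_of_measurable[of F], of UNIV]
    unfolding measurable_on_def by auto
  have AE_N: "AE x in lebesgue. x \<notin> N"
    using N by (auto simp: negligible_iff_null_sets intro: AE_not_in)
  define cl where "cl k y = max (- real k) (min (real k) y)" for k :: nat and y
  have cl_bd: "\<bar>cl k y\<bar> \<le> real k" "\<bar>cl k y\<bar> \<le> \<bar>y\<bar>" for k y by (auto simp: cl_def)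
  have cl_cont: "continuous_on UNIV (cl k)" for k unfolding cl_def by (intro continuous_intros)
  have cl_meas: "(\<lambda>x. indicator {0<..<L} x * cl k (fun_of F x)) \<in> borel_measurable lebesgue" for k
    by (intro borel_measurable_times borel_measurable_indicator
        measurable_compose[OF fun_of_measurable borel_measurable_continuous_onI[OF cl_cont]]) simp
  have k_C: "to_L2 (\<lambda>x. indicator {0<..<L} x * cl k (fun_of F x)) \<in> C" for k
  proof (rule C_lim)
    have cg: "cont (\<lambda>x. cl k (g n x))" for n
      by (rule continuous_on_compose2[OF cl_cont continuous_on_subset[OF g]]) auto
    show "to_L2 (\<lambda>x. indicator {0<..<L} x * cl k (g n x)) \<in> C" for n
      using cont_C[OF cg[of n]] by (simp add: restrict_to_L2_def)
    show "(\<lambda>n. to_L2 (\<lambda>x. indicator {0<..<L} x * cl k (g n x)))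
        \<longlonglongrightarrow> to_L2 (\<lambda>x. indicator {0<..<L} x * cl k (fun_of F x))"
    proof (rule L2_dominated_convergence)
      show "square_integrable (\<lambda>x. real k * indicator {0<..<L} x)"
        by (intro square_integrable_scale square_integrable_indicator)
      show "AE x in lebesgue. \<bar>indicator {0<..<L} x * cl k (g n x)\<bar> \<le> \<bar>real k * indicator {0<..<L} x\<bar>" for n
        by (rule AE_I2) (use cl_bd in \<open>auto simp: indicator_def\<close>)
      show "AE x in lebesgue. (\<lambda>n. indicator {0<..<L} x * cl k (g n x)) \<longlonglongrightarrow> indicator {0<..<L} x * cl k (fun_of F x)"
        using AE_N
        by eventually_elim (intro tendsto_intros continuous_on_tendsto_compose[OF cl_cont lim]; simp)
    qed (use cont_measurable[OF cg] cl_meas in auto)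
  qed
  have "(\<lambda>k. to_L2 (\<lambda>x. indicator {0<..<L} x * cl k (fun_of F x))) \<longlonglongrightarrow> to_L2 (fun_of F)"
  proof (rule L2_dominated_convergence[OF cl_meas fun_of_measurable square_integrable_fun_of[of F]])
    show "AE x in lebesgue. \<bar>indicator {0<..<L} x * cl k (fun_of F x)\<bar> \<le> \<bar>fun_of F x\<bar>" for k
      by (rule AE_I2) (use cl_bd in \<open>auto simp: indicator_def\<close>)
    show "AE x in lebesgue. (\<lambda>k. indicator {0<..<L} x * cl k (fun_of F x)) \<longlonglongrightarrow> fun_of F x"
      using L2_onD[OF F]
    proof eventually_elim
      case (elim x)
      obtain K :: nat where K: "\<bar>fun_of F x\<bar> \<le> real K" using real_arch_simple by blast
      have "\<forall>\<^sub>F k in sequentially. indicator {0<..<L} x * cl k (fun_of F x) = fun_of F x"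
        using eventually_ge_at_top[of K]
      proof eventually_elim
        case (elim k)
        then have "\<bar>fun_of F x\<bar> \<le> real k" using K by linarith
        then have "cl k (fun_of F x) = fun_of F x" by (auto simp: cl_def)
        then show ?case using \<open>x \<notin> {0<..<L} \<longrightarrow> fun_of F x = 0\<close> by (auto simp: indicator_def)
      qed
      then show ?case by (rule tendsto_eventually)
    qed
  qed
  then have "F \<in> C" using C_lim[OF k_C] by simp
  then obtain X where X: "\<And>n. X n \<in> {emb p | p p'. C1 p p'}" "X \<longlonglongrightarrow> F"
    unfolding C_def closure_sequential by blast
  then have "\<forall>n. \<exists>p p'. X n = emb p \<and> C1 p p'" by blast
  then obtain p p' where p: "\<And>n. X n = emb (p n)" "\<And>n. C1 (p n) (p' n)" by metis
  then have "X = (\<lambda>n. emb (p n))" by auto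
  then show ?thesis using that p(2) X(2) by blast
qed

section \<open>Sobolev functions and the product rule\<close>

text \<open>The space \<open>H\<^sup>1(0, L)\<close> as a space of primitives: \<open>c\<close> is the continuous representative and \<open>F\<close> the
derivative.\<close>

definition H1 :: "(real \<Rightarrow> real) \<Rightarrow> L2 \<Rightarrow> bool" where
  "H1 c F \<longleftrightarrow> F \<in> L2_on 0 L \<and> (\<forall>x\<in>{0..L}. c x = c 0 + F \<bullet> chi x)"

lemma H1_eq: "H1 c F \<Longrightarrow> x \<in> {0..L} \<Longrightarrow> c x = c 0 + F \<bullet> chi x"
  unfolding H1_def by blast

lemma H1_in: "H1 c F \<Longrightarrow> F \<in> L2_on 0 L"
  unfolding H1_def by blast

lemma H1_modulus:
  assumes "H1 c F" "x \<in> {0..L}" "y \<in> {0..L}"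
  shows "\<bar>c x - c y\<bar> \<le> norm F * sqrt \<bar>x - y\<bar>"
proof -
  have *: "\<bar>c x - c y\<bar> \<le> norm F * sqrt \<bar>x - y\<bar>" if "x \<in> {0..L}" "y \<in> {0..L}" "y \<le> x" for x y
  proof -
    have "c x - c y = F \<bullet> (chi x - chi y)"
      using H1_eq[OF assms(1) that(1)] H1_eq[OF assms(1) that(2)] by (simp add: inner_diff_right)
    moreover have "norm (chi x - chi y) = sqrt \<bar>x - y\<bar>"
      using norm_chi_diff[of y x] that by simp
    ultimately show ?thesis using Cauchy_Schwarz_ineq2[of F "chi x - chi y"] by metis
  qed
  show ?thesis using *[of x y] *[of y x] assms by (cases "y \<le> x") (auto simp: abs_minus_commute)
qed

lemma H1_cont:
  assumes "H1 c F"
  shows "cont c"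
  unfolding continuous_on_def
proof (intro ballI)
  fix x assume x: "x \<in> {0..L}"
  show "(c \<longlongrightarrow> c x) (at x within {0..L})"
  proof (rule LIM_zero_cancel, rule Lim_null_comparison)
    show "\<forall>\<^sub>F y in at x within {0..L}. norm (c y - c x) \<le> norm F * sqrt \<bar>y - x\<bar>"
      using H1_modulus[OF assms _ x] by (auto simp: eventually_at_filter)
    have "((\<lambda>y. norm F * sqrt \<bar>y - x\<bar>) \<longlongrightarrow> norm F * sqrt \<bar>x - x\<bar>) (at x within {0..L})"
      by (intro tendsto_intros)
    then show "((\<lambda>y. norm F * sqrt \<bar>y - x\<bar>) \<longlongrightarrow> 0) (at x within {0..L})" by simp
  qed
qed

lemma H1_end:
  assumes "H1 c F"
  shows "F \<bullet> chi L = c L - c 0"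
  using H1_eq[OF assms, of L] L_pos by simp

lemma H1_cong:
  assumes "H1 c F" "\<And>x. x \<in> {0..L} \<Longrightarrow> d x = c x"
  shows "H1 d F"
  unfolding H1_def
proof (intro conjI ballI)
  fix x assume "x \<in> {0..L}"
  then show "d x = d 0 + F \<bullet> chi x"
    using H1_eq[OF assms(1)] assms(2) L_pos by (metis atLeastAtMost_iff less_imp_le order_refl)
qed (rule H1_in[OF assms(1)])

lemma H1_primitive: "F \<in> L2_on 0 L \<Longrightarrow> H1 (\<lambda>x. k + F \<bullet> chi x) F"
  by (simp add: H1_def)

lemma H1_C1:
  assumes "C1 p p'"
  shows "H1 p (emb p')"
  unfolding H1_def
proof (intro conjI ballI)
  show "emb p' \<in> L2_on 0 L" using C1_cont[OF assms] by simp
  fix x assume x: "x \<in> {0..L}"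
  have "(p' has_integral (p x - p 0)) {0..x}"
    by (rule fundamental_theorem_of_calculus)
      (use assms x in \<open>auto simp: C1_def has_real_derivative_iff_has_vector_derivative
        intro: has_vector_derivative_at_within\<close>)
  then show "p x = p 0 + emb p' \<bullet> chi x"
    using emb_inner_chi[OF C1_cont(2)[OF assms] x] by (simp add: integral_unique)
qed

lemma H1_affine: "H1 (\<lambda>x. p + q * x) (emb (\<lambda>_. q))"
  by (rule H1_C1) (auto simp: C1_def intro!: derivative_eq_intros continuous_intros)

lemma emb_primitive_lim:
  assumes F: "F \<in> L2_on 0 L" and X: "\<And>n. X n \<in> L2_on 0 L" "X \<longlonglongrightarrow> F" and Y: "Y \<longlonglongrightarrow> G"
  shows "(\<lambda>n. cmul (\<lambda>x. X n \<bullet> chi x) (Y n)) \<longlonglongrightarrow> cmul (\<lambda>x. F \<bullet> chi x) G"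
proof -
  have cF: "cont (\<lambda>x. F \<bullet> chi x)" if "F \<in> L2_on 0 L" for F
    using H1_cont[OF H1_primitive[OF that, of 0]] by simp
  have bd: "norm (cmul (\<lambda>x. F \<bullet> chi x) G) \<le> norm F * sqrt L * norm G" if "F \<in> L2_on 0 L" for F G
  proof (rule norm_cmul_le[OF cF[OF that]])
    fix x assume "x \<in> {0..L}"
    then have "\<bar>F \<bullet> chi x\<bar> \<le> norm F * sqrt x"
      using H1_modulus[OF H1_primitive[OF that, of 0], of x 0] L_pos by simp
    also have "\<dots> \<le> norm F * sqrt L" using \<open>x \<in> {0..L}\<close> by (simp add: mult_left_mono)
    finally show "\<bar>F \<bullet> chi x\<bar> \<le> norm F * sqrt L" .
  qed
  have "(\<lambda>n. cmul (\<lambda>x. X n \<bullet> chi x) (Y n) - cmul (\<lambda>x. F \<bullet> chi x) G) \<longlonglongrightarrow> 0"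
  proof (rule Lim_null_comparison)
    have "norm (cmul (\<lambda>x. X n \<bullet> chi x) (Y n) - cmul (\<lambda>x. F \<bullet> chi x) G)
        \<le> norm (X n - F) * sqrt L * norm (Y n) + norm F * sqrt L * norm (Y n - G)" for n
    proof -
      have "cmul (\<lambda>x. X n \<bullet> chi x) (Y n) - cmul (\<lambda>x. F \<bullet> chi x) G
          = cmul (\<lambda>x. (X n - F) \<bullet> chi x) (Y n) + cmul (\<lambda>x. F \<bullet> chi x) (Y n - G)"
        using cmul_diff_left[OF cF[OF X(1)] cF[OF F], of n "Y n"] cmul_diff[OF cF[OF F], of "Y n" G]
        by (simp add: inner_diff_left)
      then show ?thesis
        using norm_triangle_ineq bd[OF L2_on_diff[OF X(1)[of n] F], of "Y n"] bd[OF F, of "Y n - G"]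
        by (smt (verit))
    qed
    then show "\<forall>\<^sub>F n in sequentially. norm (cmul (\<lambda>x. X n \<bullet> chi x) (Y n) - cmul (\<lambda>x. F \<bullet> chi x) G)
        \<le> norm (X n - F) * sqrt L * norm (Y n) + norm F * sqrt L * norm (Y n - G)" by simp
    have "(\<lambda>n. norm (X n - F) * sqrt L * norm (Y n) + norm F * sqrt L * norm (Y n - G))
        \<longlonglongrightarrow> norm (F - F) * sqrt L * norm G + norm F * sqrt L * norm (G - G)"
      by (intro tendsto_intros X Y)
    then show "(\<lambda>n. norm (X n - F) * sqrt L * norm (Y n) + norm F * sqrt L * norm (Y n - G)) \<longlonglongrightarrow> 0"
      by simp
  qed
  then show ?thesis by (rule LIM_zero_cancel)
qed

text \<open>For continuous integrands this is the classical product rule. Both sides are continuous in \<open>F\<close> and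
\<open>G\<close>, and continuous functions are dense.\<close>

lemma H1_mult_primitive:
  assumes F: "F \<in> L2_on 0 L" and G: "G \<in> L2_on 0 L" and x: "x \<in> {0..L}"
  shows "(cmul (\<lambda>x. F \<bullet> chi x) G + cmul (\<lambda>x. G \<bullet> chi x) F) \<bullet> chi x = (F \<bullet> chi x) * (G \<bullet> chi x)"
proof -
  obtain p p' where p: "\<And>n. C1 (p n) (p' n)" and pF: "(\<lambda>n. emb (p n)) \<longlonglongrightarrow> F"
    using emb_dense[OF F] by blast
  obtain q q' where q: "\<And>n. C1 (q n) (q' n)" and qG: "(\<lambda>n. emb (q n)) \<longlonglongrightarrow> G"
    using emb_dense[OF G] by blast
  have smooth: "(cmul (\<lambda>x. emb p \<bullet> chi x) (emb q) + cmul (\<lambda>x. emb q \<bullet> chi x) (emb p)) \<bullet> chi x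
      = (emb p \<bullet> chi x) * (emb q \<bullet> chi x)" if pq: "cont p" "cont q" for p q
  proof -
    let ?P = "\<lambda>x. emb p \<bullet> chi x" and ?Q = "\<lambda>x. emb q \<bullet> chi x"
    have PQ: "cont ?P" "cont ?Q" using H1_cont[OF H1_primitive[of _ 0]] pq by simp_all
    have d: "((\<lambda>x. emb c \<bullet> chi x) has_real_derivative c y) (at y within {0..L})"
      if "cont c" "y \<in> {0..L}" for c y
      by (rule has_field_derivative_transform_within[OF integral_has_real_derivative[OF that] zero_less_one])
        (use that in \<open>auto simp: emb_inner_chi\<close>)
    have "((\<lambda>y. ?P y * q y + ?Q y * p y) has_integral (?P x * ?Q x - ?P 0 * ?Q 0)) {0..x}"
    proof (rule fundamental_theorem_of_calculus)
      fix y assume "y \<in> {0..x}"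
      then have "((\<lambda>y. ?P y * ?Q y) has_real_derivative ?P y * q y + ?Q y * p y) (at y within {0..L})"
        using x DERIV_mult[OF d[OF pq(1), of y] d[OF pq(2), of y]] by (simp add: algebra_simps)
      then show "((\<lambda>y. ?P y * ?Q y) has_vector_derivative ?P y * q y + ?Q y * p y) (at y within {0..x})"
        unfolding has_real_derivative_iff_has_vector_derivative
        by (rule has_vector_derivative_within_subset) (use x in auto)
    qed (use x in auto)
    then have "integral {0..x} (\<lambda>y. ?P y * q y + ?Q y * p y) = ?P x * ?Q x"
      by (simp add: integral_unique)
    moreover have "cmul ?P (emb q) + cmul ?Q (emb p) = emb (\<lambda>y. ?P y * q y + ?Q y * p y)"
      using PQ pq by (simp add: cmul_emb emb_add continuous_on_mult)
    ultimately show ?thesis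
      using emb_inner_chi[OF _ x, of "\<lambda>y. ?P y * q y + ?Q y * p y"] PQ pq
      by (simp add: continuous_intros)
  qed
  note in_p = emb_in[OF C1_cont(1)[OF p]] and in_q = emb_in[OF C1_cont(1)[OF q]]
  have "(\<lambda>n. (cmul (\<lambda>x. emb (p n) \<bullet> chi x) (emb (q n)) + cmul (\<lambda>x. emb (q n) \<bullet> chi x) (emb (p n))) \<bullet> chi x)
      \<longlonglongrightarrow> (cmul (\<lambda>x. F \<bullet> chi x) G + cmul (\<lambda>x. G \<bullet> chi x) F) \<bullet> chi x"
    by (intro tendsto_intros emb_primitive_lim F G in_p in_q pF qG)
  moreover have "(\<lambda>n. (emb (p n) \<bullet> chi x) * (emb (q n) \<bullet> chi x)) \<longlonglongrightarrow> (F \<bullet> chi x) * (G \<bullet> chi x)"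
    by (intro tendsto_intros pF qG)
  ultimately show ?thesis
    using smooth[OF C1_cont(1)[OF p] C1_cont(1)[OF q]] LIMSEQ_unique by simp
qed

lemma cmul_cong:
  assumes "\<And>x. x \<in> {0<..<L} \<Longrightarrow> w x = w' x"
  shows "cmul w F = cmul w' F"
  unfolding cmul_def using assms by (intro arg_cong[where f = to_L2]) (auto simp: fun_eq_iff indicator_def)

theorem H1_mult:
  assumes c: "H1 c F" and d: "H1 d G"
  shows "H1 (\<lambda>x. c x * d x) (cmul c G + cmul d F)"
  unfolding H1_def
proof (intro conjI ballI)
  have FG: "F \<in> L2_on 0 L" "G \<in> L2_on 0 L" using H1_in[OF c] H1_in[OF d] .
  show "cmul c G + cmul d F \<in> L2_on 0 L" using H1_cont[OF c] H1_cont[OF d] by (intro L2_on_add) auto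
  have cF: "cont (\<lambda>x. F \<bullet> chi x)" if "F \<in> L2_on 0 L" for F
    using H1_cont[OF H1_primitive[OF that, of 0]] by simp
  have split: "cmul c G = c 0 *\<^sub>R G + cmul (\<lambda>x. F \<bullet> chi x) G"
    if "H1 c F" "G \<in> L2_on 0 L" for c F G
  proof -
    have "cmul c G = cmul (\<lambda>x. c 0 + F \<bullet> chi x) G"
      by (rule cmul_cong, rule H1_eq[OF that(1)]) auto
    then show ?thesis
      using that(2) cF[OF H1_in[OF that(1)]] by (simp add: cmul_add_left cmul_const)
  qed
  fix x assume x: "x \<in> {0..L}"
  have "(cmul c G + cmul d F) \<bullet> chi x
      = c 0 * (G \<bullet> chi x) + d 0 * (F \<bullet> chi x) + (F \<bullet> chi x) * (G \<bullet> chi x)"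
    unfolding split[OF c FG(2)] split[OF d FG(1)]
    using H1_mult_primitive[OF FG x] by (simp add: inner_add_left)
  moreover have "c x = c 0 + F \<bullet> chi x" "d x = d 0 + G \<bullet> chi x"
    using H1_eq[OF c x] H1_eq[OF d x] .
  ultimately show "c x * d x = c 0 * d 0 + (cmul c G + cmul d F) \<bullet> chi x"
    by (simp add: algebra_simps)
qed

lemma integration_by_parts:
  assumes "H1 c F" "H1 d G"
  shows "emb c \<bullet> G + emb d \<bullet> F = c L * d L - c 0 * d 0"
  using H1_end[OF H1_mult[OF assms]] H1_cont[OF assms(1)] H1_cont[OF assms(2)]
  by (simp add: inner_add_left cmul_inner_chi)

section \<open>Weak derivatives\<close>

lemma inner_emb_set_integral:
  assumes "cont c"
  shows "F \<bullet> emb c = (LINT x:{0<..<L}|lebesgue. fun_of F x * c x)"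
  unfolding inner_L2_def set_lebesgue_integral_def
proof (rule integral_cong_AE)
  show "AE x in lebesgue. fun_of F x * fun_of (emb c) x = indicator {0<..<L} x *\<^sub>R (fun_of F x * c x)"
    using fun_of_emb[OF assms] by eventually_elim simp
  have "(\<lambda>x. fun_of F x * (indicator {0<..<L} x * c x)) \<in> borel_measurable lebesgue"
    by (rule borel_measurable_times[OF fun_of_measurable cont_measurable[OF assms]])
  then show "(\<lambda>x. indicator {0<..<L} x *\<^sub>R (fun_of F x * c x)) \<in> borel_measurable lebesgue"
    by (simp add: mult.left_commute)
qed simp

text \<open>The primitive vanishes on the left of the support, and because of the zero mean also on the right.\<close>

lemma test_function_antiderivative:
  fixes \<psi> :: "real \<Rightarrow> real"
  assumes cont: "continuous_on UNIV \<psi>" and k: "0 < k1" "k2 < L"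
    and supp: "\<And>x. x \<notin> {k1..k2} \<Longrightarrow> \<psi> x = 0" and mean: "integral {0..L} \<psi> = 0"
  obtains \<phi> where "test_function 0 L \<phi>" "C1 \<phi> \<psi>" "\<phi> 0 = 0" "\<phi> L = 0"
proof -
  define \<phi> where "\<phi> x = integral {0..x} \<psi>" for x
  have int: "\<psi> integrable_on {a..b}" for a b
    by (intro integrable_continuous_real continuous_on_subset[OF cont]) auto
  have left: "\<phi> x = 0" if "x < k1" for x
  proof -
    have "integral {0..x} \<psi> = integral {0..x} (\<lambda>_. 0)"
      by (rule integral_cong) (use supp that in auto)
    then show ?thesis by (simp add: \<phi>_def)
  qed
  have right: "\<phi> x = 0" if x: "k2 < x" for x
  proof (cases "x < 0")
    case False
    show ?thesis
    proof (cases "x \<le> L")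
      case True
      have "integral {x..L} \<psi> = integral {x..L} (\<lambda>_. 0)"
        by (rule integral_cong) (use supp x in auto)
      then show ?thesis
        using Henstock_Kurzweil_Integration.integral_combine[of 0 x L \<psi>] int True False mean
        by (simp add: \<phi>_def)
    next
      case False
      have "integral {L..x} \<psi> = integral {L..x} (\<lambda>_. 0)"
        by (rule integral_cong) (use supp k in auto)
      then show ?thesis
        using Henstock_Kurzweil_Integration.integral_combine[of 0 L x \<psi>] int False L_pos mean
        by (simp add: \<phi>_def)
    qed
  qed (simp add: \<phi>_def)
  have deriv: "(\<phi> has_real_derivative \<psi> x) (at x)" for x
  proof (cases "0 < x")
    case True
    have "(\<phi> has_real_derivative \<psi> x) (at x within {0..x+1})"
      unfolding \<phi>_def by (rule integral_has_real_derivative)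
        (use True in \<open>auto intro: continuous_on_subset[OF cont]\<close>)
    moreover have "at x within {0..x+1} = at x"
      using True by (intro at_within_interior) auto
    ultimately show ?thesis by simp
  next
    case False
    have "((\<lambda>_. 0) has_real_derivative \<psi> x) (at x)"
      using supp[of x] False k by simp
    then show ?thesis
      by (rule has_field_derivative_transform_within_open[of _ _ _ "{..<k1}"])
        (use left False k in auto)
  qed
  have "deriv \<phi> = \<psi>" using deriv by (auto intro: DERIV_imp_deriv)
  have "test_function 0 L \<phi>"
    unfolding test_function_def
  proof (intro conjI allI exI)
    show "\<phi> differentiable at x" for x using deriv real_differentiable_def by blast
    show "continuous_on UNIV (deriv \<phi>)" using cont \<open>deriv \<phi> = \<psi>\<close> by simp
    show "compact {k1..k2}" "{k1..k2} \<subseteq> {0<..<L}" using k by auto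
    show "x \<notin> {k1..k2} \<longrightarrow> \<phi> x = 0" for x using left[of x] right[of x] by force
  qed
  then show ?thesis
    using that deriv cont left[of 0] right[of L] k by (auto simp: C1_def)
qed

lemma orthogonal_dense:
  assumes F: "F \<in> L2_on 0 L" and orth: "\<And>p p'. C1 p p' \<Longrightarrow> F \<bullet> emb p = 0"
  shows "F = 0"
proof -
  obtain p p' where p: "\<And>n. C1 (p n) (p' n)" "(\<lambda>n. emb (p n)) \<longlonglongrightarrow> F"
    using emb_dense[OF F] by blast
  have "(\<lambda>n. F \<bullet> emb (p n)) \<longlonglongrightarrow> F \<bullet> F" by (intro tendsto_intros p)
  then have "F \<bullet> F = 0" by (simp add: orth[OF p(1)] LIMSEQ_const_iff)
  then show ?thesis by simp
qed

text \<open>The lemma of du Bois-Reymond. The product of a cut-off function \<open>\<eta> n\<close> and an arbitrary \<open>p\<close> becomes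
the derivative of a test function when a multiple of the fixed bump \<open>\<eta> m\<close> is subtracted. Hence \<open>W\<close>
and a constant \<open>k\<close> have the same inner product with \<open>\<eta> n * p\<close>, and \<open>\<eta> n\<close> tends to \<open>1\<close>.\<close>

lemma weakly_constant:
  assumes W: "W \<in> L2_on 0 L"
    and orth: "\<And>\<phi> \<psi>. test_function 0 L \<phi> \<Longrightarrow> C1 \<phi> \<psi> \<Longrightarrow> \<phi> 0 = 0 \<Longrightarrow> \<phi> L = 0 \<Longrightarrow> W \<bullet> emb \<psi> = 0"
  obtains k where "W = k *\<^sub>R chi L"
proof -
  define \<eta> where "\<eta> n x = max 0 (min 1 (real n * x - 1)) * max 0 (min 1 (real n * (L - x) - 1))" for n x
  have \<eta>_cont: "continuous_on UNIV (\<eta> n)" for n unfolding \<eta>_def by (intro continuous_intros)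
  have \<eta>_bd: "0 \<le> \<eta> n x" "\<eta> n x \<le> 1" for n x
    unfolding \<eta>_def by (auto intro!: mult_le_one)
  have \<eta>_supp: "\<eta> n x = 0" if "x \<notin> {1 / real n..L - 1 / real n}" "0 < n" for n x
    using that unfolding \<eta>_def by (auto simp: field_simps not_le max_def min_def)
  have orth': "W \<bullet> emb \<psi> = 0"
    if "continuous_on UNIV \<psi>" "0 < n" "\<And>x. x \<notin> {1 / real n..L - 1 / real n} \<Longrightarrow> \<psi> x = 0" "integral {0..L} \<psi> = 0"
    for \<psi> n
    by (rule test_function_antiderivative[OF that(1) _ _ that(3,4)])
      (use that(2) orth in auto)
  \<comment> \<open>For this \<open>m\<close> the bump \<open>\<eta> m\<close> is positive at the midpoint.\<close>
  obtain m :: nat where m: "4 / L < real m" using reals_Archimedean2 by blast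
  then have m0: "0 < m" using L_pos by (metis divide_pos_pos less_trans of_nat_0_less_iff zero_less_numeral)
  define e where "e = integral {0..L} (\<eta> m)"
  have "e \<noteq> 0"
  proof
    assume "e = 0"
    then have "\<forall>x\<in>{0..L}. \<eta> m x = 0"
      unfolding e_def by (subst (asm) integral_eq_0_iff)
        (use \<eta>_bd L_pos in \<open>auto intro: continuous_on_subset[OF \<eta>_cont]\<close>)
    then have "\<eta> m (L / 2) = 0" using L_pos by auto
    moreover have "1 < real m * (L / 2)" "1 < real m * (L - L / 2)"
      using m L_pos by (auto simp: field_simps)
    ultimately show False by (auto simp: \<eta>_def)
  qed
  define k where "k = (W \<bullet> emb (\<eta> m)) / e"
  have C0: "cont p" if "continuous_on UNIV p" for p :: "real \<Rightarrow> real"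
    using that by (rule continuous_on_subset) simp
  have cut: "(W - k *\<^sub>R chi L) \<bullet> emb (\<lambda>x. \<eta> n x * p x) = 0"
    if p: "continuous_on UNIV p" and n: "m \<le> n" for p n
  proof -
    define I where "I = integral {0..L} (\<lambda>x. \<eta> n x * p x)"
    define \<psi> where "\<psi> x = \<eta> n x * p x - (I / e) * \<eta> m x" for x
    have c: "cont (\<lambda>x. \<eta> n x * p x)" "cont (\<lambda>x. (I / e) * \<eta> m x)"
      by (intro C0 continuous_intros \<eta>_cont p)+
    have "0 < n" using m0 n by simp
    have "1 / real n \<le> 1 / real m" using m0 n by (simp add: frac_le)
    have "W \<bullet> emb \<psi> = 0"
    proof (rule orth'[OF _ \<open>0 < n\<close>])
      show "continuous_on UNIV \<psi>" unfolding \<psi>_def by (intro continuous_intros \<eta>_cont p)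
      show "\<psi> x = 0" if "x \<notin> {1 / real n..L - 1 / real n}" for x
      proof -
        have "x \<notin> {1 / real m..L - 1 / real m}" using that \<open>1 / real n \<le> 1 / real m\<close> by auto
        then show ?thesis unfolding \<psi>_def using \<eta>_supp[OF that \<open>0 < n\<close>] \<eta>_supp[of x m] m0 by simp
      qed
      have "integral {0..L} \<psi> = integral {0..L} (\<lambda>x. \<eta> n x * p x) - integral {0..L} (\<lambda>x. (I / e) * \<eta> m x)"
        unfolding \<psi>_def by (rule integral_diff) (rule c[THEN integrable_continuous_real])+
      also have "\<dots> = I - integral {0..L} (\<lambda>x. (I / e) * \<eta> m x)" by (simp add: I_def)
      finally show "integral {0..L} \<psi> = 0" using \<open>e \<noteq> 0\<close> by (simp add: e_def[symmetric])
    qed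
    then have "W \<bullet> emb (\<lambda>x. \<eta> n x * p x) = (I / e) * (W \<bullet> emb (\<eta> m))"
      unfolding \<psi>_def emb_diff[OF c] emb_scale[OF C0[OF \<eta>_cont]] by (simp add: inner_diff_right)
    moreover have "chi L \<bullet> emb (\<lambda>x. \<eta> n x * p x) = I"
      unfolding I_def using emb_inner_chi[OF c(1), of L] L_pos by (simp add: inner_commute)
    ultimately show ?thesis by (simp add: inner_diff_left k_def)
  qed
  have "W - k *\<^sub>R chi L = 0"
  proof (rule orthogonal_dense)
    show "W - k *\<^sub>R chi L \<in> L2_on 0 L" by (intro L2_on_diff L2_on_scale W chi_in) simp
    fix p p' assume "C1 p p'"
    then have p: "continuous_on UNIV p"
      by (auto simp: C1_def continuous_on_eq_continuous_at intro: DERIV_isCont)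
    have "(\<lambda>n. emb (\<lambda>x. \<eta> n x * p x)) \<longlonglongrightarrow> emb p"
      unfolding restrict_to_L2_def
    proof (rule L2_dominated_convergence[OF _ _ square_integrable_cont[OF C0[OF p]]])
      have "cont (\<lambda>x. \<eta> n x * p x)" for n by (intro C0 continuous_intros \<eta>_cont p)
      then show "(\<lambda>x. indicator {0<..<L} x * (\<eta> n x * p x)) \<in> borel_measurable lebesgue" for n
        by (rule cont_measurable)
      show "(\<lambda>x. indicator {0<..<L} x * p x) \<in> borel_measurable lebesgue"
        by (rule cont_measurable[OF C0[OF p]])
      show "AE x in lebesgue. \<bar>indicator {0<..<L} x * (\<eta> n x * p x)\<bar> \<le> \<bar>indicator {0<..<L} x * p x\<bar>" for n
        by (rule AE_I2) (use \<eta>_bd in \<open>auto simp: indicator_def abs_mult intro: mult_left_le_one_le\<close>)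
      show "AE x in lebesgue. (\<lambda>n. indicator {0<..<L} x * (\<eta> n x * p x)) \<longlonglongrightarrow> indicator {0<..<L} x * p x"
      proof (rule AE_I2)
        fix x
        show "(\<lambda>n. indicator {0<..<L} x * (\<eta> n x * p x)) \<longlonglongrightarrow> indicator {0<..<L} x * p x"
        proof (cases "x \<in> {0<..<L}")
          case True
          obtain N :: nat where N: "max (2 / x) (2 / (L - x)) < real N" using reals_Archimedean2 by blast
          have "\<forall>\<^sub>F n in sequentially. \<eta> n x = 1"
            using eventually_ge_at_top[of N]
          proof eventually_elim
            case (elim n)
            then have "2 / x < real n" "2 / (L - x) < real n" using N by auto
            then have "2 \<le> real n * x" "2 \<le> real n * (L - x)" using True by (auto simp: field_simps)
            then show ?case by (simp add: \<eta>_def)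
          qed
          then show ?thesis by (intro tendsto_eventually) (auto elim: eventually_mono)
        qed simp
      qed
    qed
    then have "(\<lambda>n. (W - k *\<^sub>R chi L) \<bullet> emb (\<lambda>x. \<eta> n x * p x)) \<longlonglongrightarrow> (W - k *\<^sub>R chi L) \<bullet> emb p"
      by (intro tendsto_intros)
    moreover have "(\<lambda>n. (W - k *\<^sub>R chi L) \<bullet> emb (\<lambda>x. \<eta> n x * p x)) \<longlonglongrightarrow> 0"
    proof (rule tendsto_eventually)
      show "\<forall>\<^sub>F n in sequentially. (W - k *\<^sub>R chi L) \<bullet> emb (\<lambda>x. \<eta> n x * p x) = 0"
        using eventually_ge_at_top[of m] by eventually_elim (rule cut[OF p])
    qed
    ultimately show "(W - k *\<^sub>R chi L) \<bullet> emb p = 0" by (rule LIMSEQ_unique)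
  qed
  then show ?thesis using that[of k] by simp
qed

text \<open>The difference of \<open>f\<close> and the primitive of \<open>g\<close> has weak derivative zero.\<close>

theorem weak_deriv_H1:
  assumes "weak_deriv 0 L f g"
  obtains c where "H1 c g" "f = emb c"
proof -
  have fg: "f \<in> L2_on 0 L" "g \<in> L2_on 0 L" using assms by (auto simp: weak_deriv_def)
  define v where "v x = 0 + g \<bullet> chi x" for x
  have v: "H1 v g" unfolding v_def by (rule H1_primitive[OF fg(2)])
  obtain k where k: "f - emb v = k *\<^sub>R chi L"
  proof (rule weakly_constant)
    show "f - emb v \<in> L2_on 0 L" using fg H1_cont[OF v] by (intro L2_on_diff) auto
    fix \<phi> \<psi> assume \<phi>: "test_function 0 L \<phi>" "C1 \<phi> \<psi>" "\<phi> 0 = 0" "\<phi> L = 0"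
    have "deriv \<phi> = \<psi>" using \<phi>(2) by (auto simp: C1_def intro: DERIV_imp_deriv)
    then have "f \<bullet> emb \<psi> = - (g \<bullet> emb \<phi>)"
      using assms \<phi>(1) C1_cont[OF \<phi>(2)] by (auto simp: weak_deriv_def inner_emb_set_integral)
    moreover have "emb v \<bullet> emb \<psi> + emb \<phi> \<bullet> g = 0"
      using integration_by_parts[OF v H1_C1[OF \<phi>(2)]] \<phi>(3,4) by simp
    ultimately show "(f - emb v) \<bullet> emb \<psi> = 0" 
      by (simp add: inner_diff_left inner_commute[of "emb \<phi>" g])
  qed
  have "emb (\<lambda>_. k) = k *\<^sub>R chi L" using cmul_const[OF chi_in[of L], of k] by (simp add: emb_eq_cmul)
  then have "f = emb (\<lambda>_. k) + emb v" using k by (simp add: algebra_simps)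
  also have "\<dots> = emb (\<lambda>x. k + v x)" using H1_cont[OF v] by (simp add: emb_add)
  finally have "f = emb (\<lambda>x. k + v x)" .
  moreover have "H1 (\<lambda>x. k + v x) g"
    unfolding v_def using H1_primitive[OF fg(2), of k] by simp
  ultimately show ?thesis using that by blast
qed

lemma continuous_rep_emb:
  assumes "continuous_rep 0 L f c" "f \<in> L2_on 0 L"
  shows "cont c" "f = emb c"
proof -
  show c: "cont c" using assms by (simp add: continuous_rep_def)
  have "AE x in lebesgue. x \<in> {0<..<L} \<longrightarrow> fun_of f x = c x"
    using assms by (simp add: continuous_rep_def)
  then show "f = emb c"
    unfolding L2_eq_iff using L2_onD[OF assms(2)] fun_of_emb[OF c]
    by eventually_elim (auto simp: indicator_def)
qed

lemma weak_deriv_rep: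
  assumes "weak_deriv 0 L f g" "continuous_rep 0 L f c"
  shows "H1 c g" "f = emb c"
proof -
  obtain d where d: "H1 d g" "f = emb d" using weak_deriv_H1[OF assms(1)] by blast
  have c: "cont c" "f = emb c"
    using continuous_rep_emb[OF assms(2)] assms(1) by (auto simp: weak_deriv_def)
  show "f = emb c" by fact
  show "H1 c g"
    by (rule H1_cong[OF d(1)]) (use emb_eq_imp_eq[OF c(1) H1_cont[OF d(1)]] c d in auto)
qed

text \<open>The value \<open>c x\<close> is written as \<open>c y + (c x - c y)\<close>, and the norm is taken in \<open>y\<close>.\<close>

lemma H1_sup:
  assumes "H1 c g" "x \<in> {0..L}"
  shows "\<bar>c x\<bar> \<le> norm (emb c) / sqrt L + norm g * sqrt L"
proof -
  note cc = H1_cont[OF assms(1)]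
  have split: "emb (\<lambda>y. c x) = emb c + emb (\<lambda>y. c x - c y)"
    using cc by (simp add: emb_diff continuous_intros)
  have "norm (emb (\<lambda>y. c x - c y)) \<le> (norm g * sqrt L) * sqrt L"
  proof (rule norm_emb_le)
    fix y assume y: "y \<in> {0..L}"
    have "\<bar>c x - c y\<bar> \<le> norm g * sqrt \<bar>x - y\<bar>" by (rule H1_modulus[OF assms y])
    also have "\<dots> \<le> norm g * sqrt L"
      using y assms(2) by (intro mult_left_mono real_sqrt_le_mono) auto
    finally show "\<bar>c x - c y\<bar> \<le> norm g * sqrt L" .
  qed (use cc in \<open>intro continuous_intros\<close>)
  moreover have "norm (emb (\<lambda>y. c x)) = \<bar>c x\<bar> * sqrt L"
    using cmul_const[OF chi_in[of L], of "c x"] norm_chi[of L] L_pos by (simp add: emb_eq_cmul)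
  ultimately have "\<bar>c x\<bar> * sqrt L \<le> norm (emb c) + (norm g * sqrt L) * sqrt L"
    using norm_triangle_ineq[of "emb c" "emb (\<lambda>y. c x - c y)"] unfolding split by linarith
  then show ?thesis using L_pos by (simp add: field_simps)
qed

lemma H1_0_sup:
  assumes "H1 c g" "c 0 = 0" "x \<in> {0..L}"
  shows "\<bar>c x\<bar> \<le> norm g * sqrt L"
proof -
  have "\<bar>c x - c 0\<bar> \<le> norm g * sqrt \<bar>x - 0\<bar>" by (rule H1_modulus[OF assms(1,3)]) (use L_pos in simp)
  also have "\<dots> \<le> norm g * sqrt L" using assms(3) by (intro mult_left_mono real_sqrt_le_mono) auto
  finally show ?thesis using assms(2) by simp
qed

lemma Poincare:
  assumes "H1 c g" "c 0 = 0"
  shows "norm (emb c) \<le> L * norm g"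
proof -
  have "norm (emb c) \<le> norm g * sqrt L * sqrt L"
    by (rule norm_emb_le[OF H1_cont[OF assms(1)] H1_0_sup[OF assms]])
  also have "\<dots> = L * norm g" using L_pos by (simp add: mult.assoc)
  finally show ?thesis .
qed

lemma mult_L2_emb:
  assumes "cont c"
  shows "mult_L2 (emb c) g = cmul c g"
  unfolding mult_L2_def cmul_def
proof (rule to_L2_cong)
  show ae: "AE x in lebesgue. fun_of (emb c) x * fun_of g x = indicator {0<..<L} x * c x * fun_of g x"
    using fun_of_emb[OF assms] by eventually_elim simp
  show "square_integrable (\<lambda>x. indicator {0<..<L} x * c x * fun_of g x)"
    by (rule square_integrable_cmul[OF assms])
  then show "square_integrable (\<lambda>x. fun_of (emb c) x * fun_of g x)"
    by (rule square_integrable_bound[rotated]) (use ae in \<open>auto elim: eventually_mono\<close>)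
qed

section \<open>The Dirichlet norm as a limit of continuous functionals\<close>

text \<open>Scaling of \<open>p\<close> shows that \<open>emb c \<bullet> emb p'\<close> is at most \<open>sqrt M * norm (emb p)\<close>. By integration by
parts, \<open>c L * p L - c 0 * p 0\<close> is then bounded by a multiple of the norm of \<open>p\<close>. The powers of
\<open>x / L\<close> and of \<open>1 - x / L\<close> have the boundary values \<open>0\<close> and \<open>1\<close> and norms that tend to zero, so
\<open>c\<close> vanishes at both ends. What is left is a bound of \<open>g \<bullet> emb p\<close> for a dense set of \<open>p\<close>.\<close>

lemma dirichlet_bound_imp:
  assumes c: "H1 c g"
    and M: "\<And>p p'. C1 p p' \<Longrightarrow> - 2 * (emb c \<bullet> emb p') - (norm (emb p))\<^sup>2 \<le> M"
  shows "c 0 = 0" "c L = 0" "(norm g)\<^sup>2 \<le> M"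
proof -
  have M0: "0 \<le> M"
    using M[of "\<lambda>_. 0" "\<lambda>_. 0"] by (simp add: C1_def restrict_to_L2_def)
  have scaled: "\<bar>emb c \<bullet> emb p'\<bar> \<le> sqrt M * norm (emb p)" if p: "C1 p p'" for p p'
  proof -
    note cp = C1_cont[OF p]
    define a where "a = emb c \<bullet> emb p'"
    define b where "b = norm (emb p)"
    \<comment> \<open>The hypothesis for the multiple \<open>- l\<close> of \<open>p\<close>.\<close>
    have quad: "2 * l * a - l\<^sup>2 * b\<^sup>2 \<le> M" for l
    proof -
      have "C1 (\<lambda>x. - l * p x) (\<lambda>x. - l * p' x)"
        using p by (auto simp: C1_def intro!: derivative_eq_intros continuous_intros)
      from M[OF this] show ?thesis
        unfolding emb_scale[OF cp(1)] emb_scale[OF cp(2)] a_def b_def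
        by (simp add: power_mult_distrib algebra_simps)
    qed
    have "a\<^sup>2 \<le> M * b\<^sup>2"
    proof (cases "b = 0")
      case True
      have "a = 0"
      proof (rule ccontr)
        assume "a \<noteq> 0"
        then show False using quad[of "(M + 1) / a"] True M0 by simp
      qed
      then show ?thesis using M0 by simp
    next
      case False
      have "2 * (a / b\<^sup>2) * a - (a / b\<^sup>2)\<^sup>2 * b\<^sup>2 = a\<^sup>2 / b\<^sup>2"
        using False by (simp add: field_simps power2_eq_square)
      then have "a\<^sup>2 / b\<^sup>2 \<le> M" using quad[of "a / b\<^sup>2"] by simp
      then show ?thesis using False by (simp add: field_simps)
    qed
    then have "\<bar>a\<bar> \<le> sqrt (M * b\<^sup>2)" by (metis real_sqrt_abs real_sqrt_le_mono)
    then show ?thesis by (simp add: real_sqrt_mult a_def b_def)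
  qed
  have parts: "\<bar>c L * p L - c 0 * p 0\<bar> \<le> (sqrt M + norm g) * norm (emb p)" if p: "C1 p p'" for p p'
  proof -
    have "c L * p L - c 0 * p 0 = emb c \<bullet> emb p' + emb p \<bullet> g"
      using integration_by_parts[OF c H1_C1[OF p]] by simp
    moreover have "\<bar>emb p \<bullet> g\<bar> \<le> norm g * norm (emb p)"
      using Cauchy_Schwarz_ineq2[of "emb p" g] by (simp add: mult.commute)
    ultimately show ?thesis using scaled[OF p] by (simp add: distrib_right)
  qed
  have vanish: "d = 0"
    if p: "\<And>n. C1 (p n) (p' n)" "\<And>n. \<bar>c L * p n L - c 0 * p n 0\<bar> = \<bar>d\<bar>"
      and lim: "\<And>x. x \<in> {0<..<L} \<Longrightarrow> (\<lambda>n. p n x) \<longlonglongrightarrow> 0"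
      and bd: "\<And>n x. x \<in> {0<..<L} \<Longrightarrow> \<bar>p n x\<bar> \<le> 1" for p p' and d :: real
  proof -
    have "(\<lambda>n. emb (p n)) \<longlonglongrightarrow> to_L2 (\<lambda>x. 0)"
      unfolding restrict_to_L2_def
    proof (rule L2_dominated_convergence[OF cont_measurable[OF C1_cont(1)[OF p(1)]] _ square_integrable_indicator[of 0 L]])
      show "AE x in lebesgue. \<bar>indicator {0<..<L} x * p n x\<bar> \<le> \<bar>indicator {0<..<L} x\<bar>" for n
        by (rule AE_I2) (use bd in \<open>auto simp: indicator_def\<close>)
      show "AE x in lebesgue. (\<lambda>n. indicator {0<..<L} x * p n x) \<longlonglongrightarrow> 0"
        by (rule AE_I2) (use lim in \<open>auto simp: indicator_def\<close>)
    qed simp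
    then have "(\<lambda>n. emb (p n)) \<longlonglongrightarrow> 0" by simp
    then have "(\<lambda>n. (sqrt M + norm g) * norm (emb (p n))) \<longlonglongrightarrow> (sqrt M + norm g) * norm (0::L2)"
      by (intro tendsto_intros)
    then have "\<bar>d\<bar> \<le> 0"
      using LIMSEQ_le_const[of _ _ "\<bar>d\<bar>"] parts[OF p(1)] p(2) by fastforce
    then show ?thesis by simp
  qed
  have pow_lim: "(\<lambda>n. y ^ Suc n) \<longlonglongrightarrow> 0" "y ^ Suc n \<le> 1" if "0 < y" "y < 1" for y :: real and n
    using LIMSEQ_Suc[OF LIMSEQ_realpow_zero[of y]] that by (auto intro!: power_le_one simp del: power_Suc)
  show "c L = 0"
  proof (rule vanish)
    show "C1 (\<lambda>x. (x / L) ^ Suc n) (\<lambda>x. real (Suc n) * (1 / L * (x / L) ^ n))" for n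
      unfolding C1_def
    proof (intro conjI allI)
      show "((\<lambda>x. (x / L) ^ Suc n) has_real_derivative real (Suc n) * (1 / L * (x / L) ^ n)) (at x)" for x
        using DERIV_power[of "\<lambda>x. x / L" "1 / L" x UNIV "Suc n"] by (simp add: DERIV_cdivide)
    qed (intro continuous_intros, use L_pos in simp_all)
    show "(\<lambda>n. (x / L) ^ Suc n) \<longlonglongrightarrow> 0" if "x \<in> {0<..<L}" for x
      using that by (intro pow_lim(1)) auto
    show "\<bar>(x / L) ^ Suc n\<bar> \<le> 1" if "x \<in> {0<..<L}" for n x
      using that pow_lim(2)[of "x / L" n] by (simp del: power_Suc)
  qed (use L_pos in simp)
  show "c 0 = 0"
  proof (rule vanish)
    show "C1 (\<lambda>x. (1 - x / L) ^ Suc n) (\<lambda>x. real (Suc n) * (- (1 / L) * (1 - x / L) ^ n))" for n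
      unfolding C1_def
    proof (intro conjI allI)
      have d: "((\<lambda>x. 1 - x / L) has_real_derivative - (1 / L)) (at x)" for x
        using L_pos by (auto intro!: derivative_eq_intros)
      show "((\<lambda>x. (1 - x / L) ^ Suc n) has_real_derivative real (Suc n) * (- (1 / L) * (1 - x / L) ^ n)) (at x)" for x
        using DERIV_power[OF d[of x], where n = "Suc n"] by simp
    qed (intro continuous_intros, use L_pos in simp_all)
    show "(\<lambda>n. (1 - x / L) ^ Suc n) \<longlonglongrightarrow> 0" if "x \<in> {0<..<L}" for x
      using that by (intro pow_lim(1)) auto
    show "\<bar>(1 - x / L) ^ Suc n\<bar> \<le> 1" if "x \<in> {0<..<L}" for n x
      using that pow_lim(2)[of "1 - x / L" n] by (simp del: power_Suc)
  qed (use L_pos in simp)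
  have orth: "\<bar>g \<bullet> emb p\<bar> \<le> sqrt M * norm (emb p)" if p: "C1 p p'" for p p'
    using scaled[OF p] integration_by_parts[OF c H1_C1[OF p]] \<open>c L = 0\<close> \<open>c 0 = 0\<close>
    by (simp add: inner_commute[of g])
  obtain p p' where p: "\<And>n. C1 (p n) (p' n)" "(\<lambda>n. emb (p n)) \<longlonglongrightarrow> g"
    using emb_dense[OF H1_in[OF c]] by blast
  have l1: "(\<lambda>n. \<bar>g \<bullet> emb (p n)\<bar>) \<longlonglongrightarrow> \<bar>g \<bullet> g\<bar>" by (intro tendsto_intros p)
  have l2: "(\<lambda>n. sqrt M * norm (emb (p n))) \<longlonglongrightarrow> sqrt M * norm g" by (intro tendsto_intros p)
  have "\<bar>g \<bullet> g\<bar> \<le> sqrt M * norm g"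
    by (rule LIMSEQ_le[OF l1 l2]) (use orth[OF p(1)] in auto)
  then have "norm g * norm g \<le> sqrt M * norm g" by (simp add: norm_eq_sqrt_inner)
  then have "norm g \<le> sqrt M" by (cases "norm g = 0") (auto simp: M0)
  then have "(norm g)\<^sup>2 \<le> (sqrt M)\<^sup>2" by (rule power_mono) simp
  then show "(norm g)\<^sup>2 \<le> M" using M0 by simp
qed

text \<open>In the absence of boundary terms the left-hand side is
\<open>2 * (emb p \<bullet> g) - (norm (emb p))\<^sup>2\<close>, which falls short of \<open>(norm g)\<^sup>2\<close> by
\<open>(norm (g - emb p))\<^sup>2\<close>.\<close>

lemma dirichlet_bound:
  assumes c: "H1 c g" "c 0 = 0" "c L = 0" and p: "C1 p p'"
  shows "- 2 * (emb c \<bullet> emb p') - (norm (emb p))\<^sup>2 \<le> (norm g)\<^sup>2"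
proof -
  have "emb c \<bullet> emb p' = - (emb p \<bullet> g)"
    using integration_by_parts[OF c(1) H1_C1[OF p]] c by simp
  moreover have "0 \<le> (norm (g - emb p))\<^sup>2" by simp
  moreover have "(norm (g - emb p))\<^sup>2 = (norm g)\<^sup>2 - 2 * (emb p \<bullet> g) + (norm (emb p))\<^sup>2"
    by (simp add: power2_norm_eq_inner inner_diff_left inner_diff_right inner_commute)
  ultimately show ?thesis by linarith
qed

end

lemma countable_dense_sequence:
  fixes S :: "'a::{second_countable_topology} set"
  assumes "S \<noteq> {}"
  obtains s :: "nat \<Rightarrow> 'a" where "range s \<subseteq> S" "S \<subseteq> closure (range s)"
proof -
  obtain B :: "'a set set" where B: "countable B" "topological_basis B"
    using ex_countable_basis by blast
  define T where "T = (\<lambda>b. SOME x. x \<in> b \<inter> S) ` {b \<in> B. b \<inter> S \<noteq> {}}"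
  have pick: "(SOME x. x \<in> b \<inter> S) \<in> b \<inter> S" if "b \<inter> S \<noteq> {}" for b
    using that by (metis all_not_in_conv someI)
  have T_S: "T \<subseteq> S" unfolding T_def using pick by auto
  have dense: "S \<subseteq> closure T"
  proof
    fix x assume x: "x \<in> S"
    show "x \<in> closure T"
      unfolding closure_iff_nhds_not_empty
    proof (intro allI impI)
      fix A V assume "V \<subseteq> A" "open V" "x \<in> V"
      then obtain b where b: "b \<in> B" "x \<in> b" "b \<subseteq> V" using B(2) topological_basisE by metis
      then have "b \<inter> S \<noteq> {}" using x by blast
      then have "(SOME x. x \<in> b \<inter> S) \<in> T \<inter> A"
        using pick[of b] b \<open>V \<subseteq> A\<close> by (auto simp: T_def)
      then show "T \<inter> A \<noteq> {}" by blast
    qed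
  qed
  have "T \<noteq> {}" using dense assms by auto
  moreover have "countable T" unfolding T_def using B(1) by auto
  ultimately have "range (from_nat_into T) = T" by (rule range_from_nat_into)
  then show ?thesis using that[of "from_nat_into T"] T_S dense by simp
qed

context bounded_interval
begin

text \<open>\<open>G N\<close> is the maximum of \<open>0\<close> and of the functionals given by the first \<open>N\<close> terms of a sequence that
is dense in the set of all pairs \<open>(p, p')\<close>. The density refers to both components, because the
boundary values of \<open>p\<close>, which are not continuous in the norm of \<open>p\<close> alone, detect those of \<open>c\<close>.\<close>

lemma dirichlet_approximants:
  obtains G :: "nat \<Rightarrow> L2 \<Rightarrow> real" where
    "\<And>N. continuous_on UNIV (G N)" "\<And>N F. 0 \<le> G N F" "\<And>F. incseq (\<lambda>N. G N F)"
    "\<And>N c g. H1 c g \<Longrightarrow> c 0 = 0 \<Longrightarrow> c L = 0 \<Longrightarrow> G N (emb c) \<le> (norm g)\<^sup>2"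
    "\<And>c g M. H1 c g \<Longrightarrow> \<forall>N. G N (emb c) \<le> M \<Longrightarrow> c 0 = 0 \<and> c L = 0 \<and> (norm g)\<^sup>2 \<le> M"
proof -
  define \<Gamma> where "\<Gamma> = {(emb p, emb p') | p p'. C1 p p'}"
  have "C1 (\<lambda>_. 0) (\<lambda>_. 0)" by (simp add: C1_def)
  then have ne: "\<Gamma> \<noteq> {}" unfolding \<Gamma>_def by blast
  obtain s :: "nat \<Rightarrow> L2 \<times> L2" where s: "range s \<subseteq> \<Gamma>" "\<Gamma> \<subseteq> closure (range s)"
    by (rule countable_dense_sequence[OF ne])
  define \<Psi> where "\<Psi> F y = - 2 * (F \<bullet> snd y) - (norm (fst y))\<^sup>2" for F and y :: "L2 \<times> L2"
  define G where "G = rec_nat (\<lambda>F. 0) (\<lambda>N r F. max (r F) (\<Psi> F (s N)))"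
  have G0: "G 0 F = 0" and GS: "G (Suc N) F = max (G N F) (\<Psi> F (s N))" for N F
    by (simp_all add: G_def)
  have inc: "incseq (\<lambda>N. G N F)" for F
    by (rule incseq_SucI) (simp add: GS)
  show ?thesis
  proof (rule that[of G])
    show "continuous_on UNIV (G N)" for N
    proof (induction N)
      case 0
      have "G 0 = (\<lambda>_. 0)" by (simp add: fun_eq_iff G0)
      then show ?case by simp
    next
      case (Suc N)
      have "G (Suc N) = (\<lambda>F. max (G N F) (\<Psi> F (s N)))" by (simp add: fun_eq_iff GS)
      moreover have "continuous_on UNIV (\<lambda>F. \<Psi> F (s N))" unfolding \<Psi>_def by (intro continuous_intros)
      ultimately show ?case using Suc by (simp add: continuous_on_max)
    qed
    show "0 \<le> G N F" for N F using incseqD[OF inc, of 0 N F] by (simp add: G0)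
    show "incseq (\<lambda>N. G N F)" for F by (rule inc)
    show "G N (emb c) \<le> (norm g)\<^sup>2" if "H1 c g" "c 0 = 0" "c L = 0" for N c g
    proof (induction N)
      case (Suc N)
      have "s N \<in> \<Gamma>" using s(1) by blast
      then obtain p p' where p: "s N = (emb p, emb p')" "C1 p p'" unfolding \<Gamma>_def by blast
      then show ?case using Suc dirichlet_bound[OF that p(2)] by (simp add: GS \<Psi>_def)
    qed (simp add: G0)
    fix c g M assume c: "H1 c g" and M: "\<forall>N. G N (emb c) \<le> M"
    have sM: "\<Psi> (emb c) (s N) \<le> M" for N using spec[OF M, of "Suc N"] by (simp add: GS)
    have "closed {y. \<Psi> (emb c) y \<le> M}"
      unfolding \<Psi>_def by (intro closed_Collect_le continuous_intros)
    then have "closure (range s) \<subseteq> {y. \<Psi> (emb c) y \<le> M}"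
      by (rule closure_minimal[rotated]) (use sM in auto)
    then have "\<Psi> (emb c) y \<le> M" if "y \<in> \<Gamma>" for y using s(2) that by blast
    moreover have "(emb p, emb p') \<in> \<Gamma>" if "C1 p p'" for p p'
      using that unfolding \<Gamma>_def by blast
    ultimately have "\<Psi> (emb c) (emb p, emb p') \<le> M" if "C1 p p'" for p p'
      using that by blast
    then have "- 2 * (emb c \<bullet> emb p') - (norm (emb p))\<^sup>2 \<le> M" if "C1 p p'" for p p'
      using that by (simp add: \<Psi>_def)
    from dirichlet_bound_imp[OF c this] show "c 0 = 0 \<and> c L = 0 \<and> (norm g)\<^sup>2 \<le> M" by blast
  qed
qed

section \<open>Multiplier identities\<close>

lemma bounded_linear_cmul:
  assumes "cont w"
  shows "bounded_linear (cmul w)"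
proof -
  obtain M where M: "0 \<le> M" "\<And>x. x \<in> {0..L} \<Longrightarrow> \<bar>w x\<bar> \<le> M" using cont_bounded[OF assms] by blast
  show ?thesis
    by (rule bounded_linear_intro[of _ M])
      (use cmul_add[OF assms] cmul_scale[OF assms] norm_cmul_le[OF assms M(2)] in \<open>auto simp: mult.commute\<close>)
qed

lemma cmul_sym: "cont w \<Longrightarrow> cmul w F \<bullet> G = cmul w G \<bullet> F"
  by (metis inner_cmul inner_commute)

lemma cont_affine: "cont (\<lambda>x. p + q * x)"
  by (intro continuous_intros)

lemma first_order_identity:
  assumes z: "H1 z z1"
  shows "2 * (cmul (\<lambda>x. p + q * x) (emb z) \<bullet> z1) + q * (norm (emb z))\<^sup>2
    = (p + q * L) * (z L)\<^sup>2 - p * (z 0)\<^sup>2"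
proof -
  let ?w = "\<lambda>x. p + q * x"
  note cz = H1_cont[OF z] and cw = cont_affine[of p q]
  have "emb ?w \<bullet> (cmul z z1 + cmul z z1) + emb (\<lambda>x. z x * z x) \<bullet> emb (\<lambda>_. q)
      = ?w L * (z L * z L) - ?w 0 * (z 0 * z 0)"
    by (rule integration_by_parts[OF H1_affine H1_mult[OF z z]])
  moreover have "emb ?w \<bullet> cmul z z1 = cmul ?w (emb z) \<bullet> z1"
    using cz cw by (simp add: inner_cmul[OF cz, symmetric] cmul_emb mult.commute)
  moreover have "emb (\<lambda>x. z x * z x) \<bullet> emb (\<lambda>_. q) = q * (norm (emb z))\<^sup>2"
  proof -
    have "emb (\<lambda>x. z x * z x) \<bullet> emb (\<lambda>_. q) = emb z \<bullet> emb (\<lambda>x. q * z x)"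
      using cz by (simp add: emb_inner_emb continuous_intros mult.commute mult.left_commute)
    then show ?thesis using cz by (simp add: emb_scale power2_norm_eq_inner)
  qed
  ultimately show ?thesis by (simp add: inner_add_right power2_eq_square)
qed

text \<open>For an affine weight \<open>w\<close> of slope \<open>q\<close>, the function \<open>w u u\<^sub>x\<^sub>x - q u u\<^sub>x - w u\<^sub>x\<^sup>2 / 2\<close> has the
derivative \<open>w u u\<^sub>x\<^sub>x\<^sub>x - (3/2) q u\<^sub>x\<^sup>2\<close>, and as \<open>u\<close> vanishes at the ends only its last term has
boundary values.\<close>

lemma third_order_identity:
  assumes u: "H1 u u1" "H1 c1 u2" "H1 c2 u3" and c: "u1 = emb c1" "u2 = emb c2"
    and bc: "u 0 = 0" "u L = 0"
  shows "cmul (\<lambda>x. p + q * x) (emb u) \<bullet> u3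
    = 3/2 * q * (norm u1)\<^sup>2 - 1/2 * ((p + q * L) * (c1 L)\<^sup>2 - p * (c1 0)\<^sup>2)"
proof -
  let ?w = "\<lambda>x. p + q * x"
  note cu = H1_cont[OF u(1)] and cc1 = H1_cont[OF u(2)] and cw = cont_affine[of p q]
  have "emb (\<lambda>x. ?w x * u x) \<bullet> u3 + emb c2 \<bullet> (cmul ?w u1 + cmul u (emb (\<lambda>_. q))) = 0"
    using integration_by_parts[OF H1_mult[OF H1_affine u(1)] u(3)] bc by simp
  moreover have "cmul u (emb (\<lambda>_. q)) = q *\<^sub>R emb u"
    using cu by (simp add: cmul_emb mult.commute[of _ q] emb_scale)
  moreover have "emb u \<bullet> u2 + emb c1 \<bullet> u1 = 0"
    using integration_by_parts[OF u(1,2)] bc by simp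
  moreover have "2 * (cmul ?w u1 \<bullet> u2) + q * (norm u1)\<^sup>2 = ?w L * (c1 L)\<^sup>2 - p * (c1 0)\<^sup>2"
    using first_order_identity[OF u(2), of p q] c by simp
  moreover have "emb (\<lambda>x. ?w x * u x) = cmul ?w (emb u)" using cu cw by (simp add: cmul_emb)
  moreover define N where "N = (norm u1)\<^sup>2"
  ultimately have "cmul ?w (emb u) \<bullet> u3 + (cmul ?w u1 \<bullet> u2 + q * (emb u \<bullet> u2)) = 0"
    and D: "emb u \<bullet> u2 = - N" and "2 * (cmul ?w u1 \<bullet> u2) + q * N = ?w L * (c1 L)\<^sup>2 - p * (c1 0)\<^sup>2"
    using c by (simp_all add: inner_add_right inner_commute[of "emb c2"] power2_norm_eq_inner)
  then have "cmul ?w (emb u) \<bullet> u3 = 3/2 * (q * N) - 1/2 * (?w L * (c1 L)\<^sup>2 - p * (c1 0)\<^sup>2)"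
    unfolding D mult_minus_right by argo
  then show ?thesis by (simp add: N_def)
qed

text \<open>The integral of the derivative of \<open>w u\<^sup>3\<close> vanishes.\<close>

lemma cubic_identity:
  assumes u: "H1 u g" and bc: "u 0 = 0" "u L = 0"
  shows "3 * (cmul (\<lambda>x. p + q * x) (emb u) \<bullet> cmul u g) = - q * (cmul u (emb u) \<bullet> emb u)"
proof -
  let ?w = "\<lambda>x. p + q * x"
  note cu = H1_cont[OF u] and cw = cont_affine[of p q]
  have "emb (\<lambda>x. u x * u x) \<bullet> (cmul ?w g + cmul u (emb (\<lambda>_. q)))
      + emb (\<lambda>x. ?w x * u x) \<bullet> (cmul u g + cmul u g) = 0"
    using integration_by_parts[OF H1_mult[OF u u] H1_mult[OF H1_affine[of p q] u]] bc by simp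
  moreover have "cmul u (emb (\<lambda>_. q)) = q *\<^sub>R emb u"
    using cu by (simp add: cmul_emb mult.commute[of _ q] emb_scale)
  moreover have "emb (\<lambda>x. u x * u x) \<bullet> cmul ?w g = cmul ?w (emb u) \<bullet> cmul u g"
    using cu cw by (simp add: inner_cmul[symmetric] cmul_emb continuous_on_mult mult.left_commute)
  moreover have "emb (\<lambda>x. ?w x * u x) = cmul ?w (emb u)" "emb (\<lambda>x. u x * u x) = cmul u (emb u)"
    using cu cw by (simp_all add: cmul_emb)
  ultimately show ?thesis by (simp add: inner_add_right algebra_simps)
qed

lemma cmul_nonneg:
  assumes "cont w" "\<And>x. x \<in> {0..L} \<Longrightarrow> 0 \<le> w x"
  shows "0 \<le> cmul w F \<bullet> F"
  unfolding inner_L2_def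
proof (rule integral_nonneg_AE)
  show "AE x in lebesgue. 0 \<le> fun_of (cmul w F) x * fun_of F x"
    using fun_of_cmul[OF assms(1), of F]
    by eventually_elim (use assms(2) in \<open>auto simp: indicator_def mult.assoc\<close>)
qed

lemma cmul_ge:
  assumes "F \<in> L2_on 0 L" "cont w" "\<And>x. x \<in> {0..L} \<Longrightarrow> 1 \<le> w x"
  shows "(norm F)\<^sup>2 \<le> cmul w F \<bullet> F"
proof -
  have "0 \<le> cmul (\<lambda>x. w x - 1) F \<bullet> F"
    by (rule cmul_nonneg) (use assms in \<open>auto intro!: continuous_intros\<close>)
  then show ?thesis
    using assms cmul_const[OF assms(1), of 1]
    by (simp add: cmul_diff_left inner_diff_left power2_norm_eq_inner)
qed

lemma cmul_le:
  assumes "cont w" "\<And>x. x \<in> {0..L} \<Longrightarrow> \<bar>w x\<bar> \<le> M"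
  shows "cmul w F \<bullet> F \<le> M * (norm F)\<^sup>2"
proof -
  have "cmul w F \<bullet> F \<le> norm (cmul w F) * norm F" by (rule norm_cauchy_schwarz)
  also have "\<dots> \<le> (M * norm F) * norm F" by (intro mult_right_mono norm_cmul_le assms) auto
  finally show ?thesis by (simp add: power2_eq_square)
qed

lemma mult_L2_in:
  assumes "F \<in> L2_on 0 L"
  shows "mult_L2 F G \<in> L2_on 0 L"
proof (cases "square_integrable (\<lambda>x. fun_of F x * fun_of G x)")
  case True
  show ?thesis
    unfolding mult_L2_def L2_on_def mem_Collect_eq
    using fun_of_to_L2[OF True] L2_onD[OF assms] by eventually_elim auto
next
  case False
  then have "mult_L2 F G = 0" by (simp add: mult_L2_def to_L2_def zero_L2_def)
  then show ?thesis by simp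
qed

end

section \<open>Dissipativity of the Hirota--Satsuma operator\<close>

locale hirota_satsuma = X: bounded_interval L for L :: real +
  fixes h \<alpha> \<beta> :: real
  assumes h_pos: "0 < h" and \<beta>_pos: "0 < \<beta>"
begin

sublocale Z: bounded_interval 1 by unfold_locales simp

text \<open>The third-order terms of the two equations have opposite signs, so the weight must decrease for \<open>u\<close>
and increase for \<open>v\<close> to produce dissipation; \<open>z\<close> is transported to the right, which calls for a
decreasing weight. The form \<open>p + q * x\<close> is that of the multiplier identities.\<close>

definition weight_u :: "real \<Rightarrow> real \<Rightarrow> real" where "weight_u \<epsilon> x = (1 + \<epsilon> * L) + (- \<epsilon>) * x"
definition weight_v :: "real \<Rightarrow> real \<Rightarrow> real" where "weight_v \<epsilon> x = 1 + \<epsilon> * x"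
definition weight_z :: "real \<Rightarrow> real \<Rightarrow> real" where "weight_z \<epsilon> x = (1 + \<epsilon>) + (- \<epsilon>) * x"

lemma weight_cont [simp]: "continuous_on A (weight_u \<epsilon>)" "continuous_on A (weight_v \<epsilon>)" "continuous_on A (weight_z \<epsilon>)"
  unfolding weight_u_def weight_v_def weight_z_def by (intro continuous_intros)+

text \<open>Half of the quadratic form of \<open>B \<epsilon>\<close> is the Lyapunov functional; \<open>B 0\<close> is the inner product of \<open>H\<close>.\<close>

definition B :: "real \<Rightarrow> state \<Rightarrow> state \<Rightarrow> real" where
  "B \<epsilon> U V = X.cmul (weight_u \<epsilon>) (fst U) \<bullet> fst V + X.cmul (weight_v \<epsilon>) (fst (snd U)) \<bullet> fst (snd V)
    + \<beta> * h * (Z.cmul (weight_z \<epsilon>) (snd (snd U)) \<bullet> snd (snd V))"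

lemma B_sym: "B \<epsilon> U V = B \<epsilon> V U"
  unfolding B_def
  using X.cmul_sym[OF weight_cont(1), of \<epsilon> "fst U" "fst V"] X.cmul_sym[OF weight_cont(2), of \<epsilon> "fst (snd U)" "fst (snd V)"]
    Z.cmul_sym[OF weight_cont(3), of \<epsilon> "snd (snd U)" "snd (snd V)"] by simp

lemma bounded_bilinear_B: "bounded_bilinear (B \<epsilon>)"
proof -
  note lin = X.bounded_linear_cmul[OF weight_cont(1), of \<epsilon>] X.bounded_linear_cmul[OF weight_cont(2), of \<epsilon>]
    Z.bounded_linear_cmul[OF weight_cont(3), of \<epsilon>]
  obtain M1 where M1: "0 \<le> M1" "\<And>F. norm (X.cmul (weight_u \<epsilon>) F) \<le> norm F * M1"
    using bounded_linear.nonneg_bounded[OF lin(1)] by blast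
  obtain M2 where M2: "0 \<le> M2" "\<And>F. norm (X.cmul (weight_v \<epsilon>) F) \<le> norm F * M2"
    using bounded_linear.nonneg_bounded[OF lin(2)] by blast
  obtain M3 where M3: "0 \<le> M3" "\<And>F. norm (Z.cmul (weight_z \<epsilon>) F) \<le> norm F * M3"
    using bounded_linear.nonneg_bounded[OF lin(3)] by blast
  have bh: "0 \<le> \<beta> * h" using h_pos \<beta>_pos by simp
  have n: "norm (fst U) \<le> norm U" "norm (fst (snd U)) \<le> norm U" "norm (snd (snd U)) \<le> norm U" for U :: state
    by (metis norm_fst_le norm_snd_le prod.collapse order_trans)+
  have k: "norm (X.cmul (weight_u \<epsilon>) (fst U)) \<le> norm U * M1" "norm (X.cmul (weight_v \<epsilon>) (fst (snd U))) \<le> norm U * M2"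
    "norm (Z.cmul (weight_z \<epsilon>) (snd (snd U))) \<le> norm U * M3" for U
    using M1(2)[of "fst U"] mult_right_mono[OF n(1)[of U] M1(1)]
      M2(2)[of "fst (snd U)"] mult_right_mono[OF n(2)[of U] M2(1)]
      M3(2)[of "snd (snd U)"] mult_right_mono[OF n(3)[of U] M3(1)] by linarith+
  have "\<bar>B \<epsilon> U V\<bar> \<le> norm U * norm V * (M1 + M2 + \<beta> * h * M3)" for U V
  proof -
    have "\<bar>X.cmul (weight_u \<epsilon>) (fst U) \<bullet> fst V\<bar> \<le> (norm U * M1) * norm V"
      by (rule order_trans[OF Cauchy_Schwarz_ineq2], rule mult_mono)
        (use M1(1) n k in auto)
    moreover have "\<bar>X.cmul (weight_v \<epsilon>) (fst (snd U)) \<bullet> fst (snd V)\<bar> \<le> (norm U * M2) * norm V"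
      by (rule order_trans[OF Cauchy_Schwarz_ineq2], rule mult_mono)
        (use M2(1) n k in auto)
    moreover have "\<bar>Z.cmul (weight_z \<epsilon>) (snd (snd U)) \<bullet> snd (snd V)\<bar> \<le> (norm U * M3) * norm V"
      by (rule order_trans[OF Cauchy_Schwarz_ineq2], rule mult_mono)
        (use M3(1) n k in auto)
    then have "\<bar>\<beta> * h * (Z.cmul (weight_z \<epsilon>) (snd (snd U)) \<bullet> snd (snd V))\<bar> \<le> \<beta> * h * ((norm U * M3) * norm V)"
      unfolding abs_mult[of "\<beta> * h"] abs_of_nonneg[OF bh] using bh by (rule mult_left_mono)
    ultimately have "\<bar>B \<epsilon> U V\<bar> \<le> (norm U * M1) * norm V + (norm U * M2) * norm V + \<beta> * h * ((norm U * M3) * norm V)"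
      unfolding B_def by linarith
    then show ?thesis by (simp add: algebra_simps)
  qed
  then show ?thesis
    by (intro bounded_bilinear.intro exI[of _ "M1 + M2 + \<beta> * h * M3"])
      (auto simp: B_def linear_simps[OF lin(1)] linear_simps[OF lin(2)] linear_simps[OF lin(3)]
        inner_add_left inner_add_right algebra_simps)
qed

text \<open>The two inequalities say that the coefficients of \<open>u\<^sub>x(L)\<^sup>2\<close> and \<open>z(1)\<^sup>2\<close> in the boundary terms are
nonpositive.\<close>

definition admissible :: "real \<Rightarrow> bool" where
  "admissible \<epsilon> \<longleftrightarrow> 0 \<le> \<epsilon> \<and> - 1/4 + \<alpha>\<^sup>2 + \<beta> / 2 + \<epsilon> * (\<beta> / 2 + L * \<alpha>\<^sup>2) \<le> 0 \<and>
    \<beta>\<^sup>2 - \<beta> / 2 + \<epsilon> * L * \<beta>\<^sup>2 \<le> 0"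

text \<open>Here \<open>a = u\<^sub>x(L)\<close> and \<open>b = z(1)\<close>. The feedback \<open>v\<^sub>x(L) = \<alpha> a + \<beta> b\<close> has the square at most
\<open>2 \<alpha>\<^sup>2 a\<^sup>2 + 2 \<beta>\<^sup>2 b\<^sup>2\<close>, which separates the two variables.\<close>

lemma boundary_terms:
  assumes "admissible \<epsilon>"
  shows "- 1/4 * a\<^sup>2 + 1/2 * (1 + \<epsilon> * L) * (\<alpha> * a + \<beta> * b)\<^sup>2 - \<beta> / 2 * b\<^sup>2 + \<beta> / 2 * (1 + \<epsilon>) * a\<^sup>2 \<le> 0"
proof -
  have \<epsilon>: "0 \<le> \<epsilon>" using assms by (simp add: admissible_def)
  have "(\<alpha> * a + \<beta> * b)\<^sup>2 \<le> 2 * \<alpha>\<^sup>2 * a\<^sup>2 + 2 * \<beta>\<^sup>2 * b\<^sup>2"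
    using sum_squares_bound[of "\<alpha> * a" "\<beta> * b"] by (simp add: power2_sum power_mult_distrib)
  then have "1/2 * (1 + \<epsilon> * L) * (\<alpha> * a + \<beta> * b)\<^sup>2 \<le> 1/2 * (1 + \<epsilon> * L) * (2 * \<alpha>\<^sup>2 * a\<^sup>2 + 2 * \<beta>\<^sup>2 * b\<^sup>2)"
    using \<epsilon> X.L_pos by (intro mult_left_mono) auto
  moreover have "(- 1/4 + \<alpha>\<^sup>2 + \<beta> / 2 + \<epsilon> * (\<beta> / 2 + L * \<alpha>\<^sup>2)) * a\<^sup>2 \<le> 0"
    "(\<beta>\<^sup>2 - \<beta> / 2 + \<epsilon> * L * \<beta>\<^sup>2) * b\<^sup>2 \<le> 0"
    using assms by (auto simp: admissible_def intro!: mult_nonpos_nonneg)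
  moreover have "- 1/4 * a\<^sup>2 + 1/2 * (1 + \<epsilon> * L) * (2 * \<alpha>\<^sup>2 * a\<^sup>2 + 2 * \<beta>\<^sup>2 * b\<^sup>2) - \<beta> / 2 * b\<^sup>2
      + \<beta> / 2 * (1 + \<epsilon>) * a\<^sup>2
    = (- 1/4 + \<alpha>\<^sup>2 + \<beta> / 2 + \<epsilon> * (\<beta> / 2 + L * \<alpha>\<^sup>2)) * a\<^sup>2 + (\<beta>\<^sup>2 - \<beta> / 2 + \<epsilon> * L * \<beta>\<^sup>2) * b\<^sup>2"
    by (simp add: field_simps)
  ultimately show ?thesis by linarith
qed

lemma dissipative:
  assumes "(U, V) \<in> HS_operator L h \<alpha> \<beta>" and adm: "admissible \<epsilon>"
  obtains cu cv u1 v1 z where "U = (X.emb cu, X.emb cv, z)"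
    "X.H1 cu u1" "cu 0 = 0" "cu L = 0" "X.H1 cv v1" "cv 0 = 0" "cv L = 0"
    "B \<epsilon> U V \<le> - (3/4 * \<epsilon> * ((norm u1)\<^sup>2 + (norm v1)\<^sup>2) + \<beta> * \<epsilon> / 2 * (norm z)\<^sup>2)"
proof -
  from assms(1) obtain u v z u3 v3 z1 u1 u2 v1 v2 cu cu1 cv cv1 cz where
    UV: "U = (u, v, z)" "V = ((1/2) *\<^sub>R u3, - v3, - (1/h) *\<^sub>R z1)" and
    d: "weak_deriv 0 L u u1" "weak_deriv 0 L u1 u2" "weak_deriv 0 L u2 u3"
      "weak_deriv 0 L v v1" "weak_deriv 0 L v1 v2" "weak_deriv 0 L v2 v3" "weak_deriv 0 1 z z1" and
    r: "continuous_rep 0 L u cu" "continuous_rep 0 L u1 cu1" "continuous_rep 0 L v cv"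
      "continuous_rep 0 L v1 cv1" "continuous_rep 0 1 z cz" and
    bc: "cu 0 = 0" "cu L = 0" "cv 0 = 0" "cv L = 0" "cu1 0 = 0" "cz 0 = cu1 L"
      "cv1 L = \<alpha> * cu1 L + \<beta> * cz 1"
    unfolding HS_operator_def by blast
  obtain cu2 where cu2: "X.H1 cu2 u3" "u2 = X.emb cu2" using X.weak_deriv_H1[OF d(3)] by blast
  obtain cv2 where cv2: "X.H1 cv2 v3" "v2 = X.emb cv2" using X.weak_deriv_H1[OF d(6)] by blast
  note u = X.weak_deriv_rep[OF d(1) r(1)] and u1 = X.weak_deriv_rep[OF d(2) r(2)]
    and v = X.weak_deriv_rep[OF d(4) r(3)] and v1 = X.weak_deriv_rep[OF d(5) r(4)]
    and z = Z.weak_deriv_rep[OF d(7) r(5)]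
  define a b where "a = cu1 L" and "b = cz 1"
  have eu: "X.cmul (weight_u \<epsilon>) u \<bullet> u3 = - 3/2 * \<epsilon> * (norm u1)\<^sup>2 - 1/2 * a\<^sup>2"
    using X.third_order_identity[OF u(1) u1(1) cu2(1) u1(2) cu2(2) bc(1,2), of "1 + \<epsilon> * L" "- \<epsilon>"] bc u(2)
    by (simp add: weight_u_def[abs_def] a_def)
  have ev: "X.cmul (weight_v \<epsilon>) v \<bullet> v3 = 3/2 * \<epsilon> * (norm v1)\<^sup>2 - 1/2 * ((1 + \<epsilon> * L) * (\<alpha> * a + \<beta> * b)\<^sup>2 - (cv1 0)\<^sup>2)"
    using X.third_order_identity[OF v(1) v1(1) cv2(1) v1(2) cv2(2) bc(3,4), of 1 \<epsilon>] bc v(2)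
    by (simp add: weight_v_def[abs_def] a_def b_def)
  have ez: "2 * (Z.cmul (weight_z \<epsilon>) z \<bullet> z1) - \<epsilon> * (norm z)\<^sup>2 = b\<^sup>2 - (1 + \<epsilon>) * a\<^sup>2"
    using Z.first_order_identity[OF z(1), of "1 + \<epsilon>" "- \<epsilon>"] bc z(2)
    by (simp add: weight_z_def[abs_def] a_def b_def)
  have "B \<epsilon> U V = 1/2 * (X.cmul (weight_u \<epsilon>) u \<bullet> u3) - X.cmul (weight_v \<epsilon>) v \<bullet> v3 - \<beta> * (Z.cmul (weight_z \<epsilon>) z \<bullet> z1)"
    using h_pos by (simp add: B_def UV)
  also have "Z.cmul (weight_z \<epsilon>) z \<bullet> z1 = (b\<^sup>2 - (1 + \<epsilon>) * a\<^sup>2 + \<epsilon> * (norm z)\<^sup>2) / 2"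
    using ez by simp
  finally have "B \<epsilon> U V = - 3/4 * \<epsilon> * (norm u1)\<^sup>2 - 3/2 * \<epsilon> * (norm v1)\<^sup>2 - \<beta> * \<epsilon> / 2 * (norm z)\<^sup>2
      - 1/2 * (cv1 0)\<^sup>2 + (- 1/4 * a\<^sup>2 + 1/2 * (1 + \<epsilon> * L) * (\<alpha> * a + \<beta> * b)\<^sup>2 - \<beta> / 2 * b\<^sup>2 + \<beta> / 2 * (1 + \<epsilon>) * a\<^sup>2)"
    unfolding eu ev by (simp add: algebra_simps add_divide_distrib diff_divide_distrib)
  moreover have "0 \<le> \<epsilon> * (norm v1)\<^sup>2" using adm by (simp add: admissible_def)
  moreover have "0 \<le> (cv1 0)\<^sup>2" by simp
  ultimately have "B \<epsilon> U V \<le> - (3/4 * \<epsilon> * ((norm u1)\<^sup>2 + (norm v1)\<^sup>2) + \<beta> * \<epsilon> / 2 * (norm z)\<^sup>2)"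
    using boundary_terms[OF adm, of a b] by (simp only: distrib_left)
  then show ?thesis using that u(1) v(1) bc UV u(2) v(2) by blast
qed

text \<open>The coupling terms conserve the energy of \<open>H\<close>. With the weights there remain \<open>\<epsilon>\<close> times the
integral of \<open>u\<^sup>3\<close>, from the slope of the first weight, and the integral of \<open>3 \<epsilon> (L - 2 x) u v v\<^sub>x\<close>,
from the difference of the first two. In both, one factor \<open>u\<close> is estimated in the supremum norm by
its derivative.\<close>

lemma nonlinear_bound:
  assumes u: "X.H1 u ux" "u 0 = 0" "u L = 0" and v: "X.H1 v vx" "v 0 = 0" "v L = 0"
    and R: "norm (X.emb u) \<le> R" "norm (X.emb v) \<le> R" and \<epsilon>: "0 \<le> \<epsilon>"
  shows "\<bar>B \<epsilon> (X.emb u, X.emb v, z) (HS_nonlinearity (X.emb u) ux (X.emb v) vx)\<bar>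
    \<le> \<epsilon> * (5/2 * L * sqrt L * R) * ((norm ux)\<^sup>2 + (norm vx)\<^sup>2)"
proof -
  note cu = X.H1_cont[OF u(1)] and cv = X.H1_cont[OF v(1)]
  have R0: "0 \<le> R" using R(1) norm_ge_zero order_trans by blast
  note L_pos = X.L_pos
  have sup_u: "\<bar>u x\<bar> \<le> norm ux * sqrt L" if "x \<in> {0..L}" for x by (rule X.H1_0_sup[OF u(1,2) that])
  define I1 where "I1 = X.cmul u (X.emb u) \<bullet> X.emb u"
  define I2 where "I2 = X.cmul (\<lambda>x. (weight_u \<epsilon> x - weight_v \<epsilon> x) * u x) (X.emb v) \<bullet> vx"
  have e1: "3 * (X.cmul (weight_u \<epsilon>) (X.emb u) \<bullet> X.cmul u ux) = \<epsilon> * I1"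
    using X.cubic_identity[OF u, of "1 + \<epsilon> * L" "- \<epsilon>"] by (simp add: weight_u_def[abs_def] I1_def)
  have e2: "X.cmul (weight_u \<epsilon>) (X.emb u) \<bullet> X.cmul v vx - X.cmul (weight_v \<epsilon>) (X.emb v) \<bullet> X.cmul u vx = I2"
  proof -
    have "X.cmul (weight_u \<epsilon>) (X.emb u) \<bullet> X.cmul v vx = X.emb (\<lambda>x. weight_u \<epsilon> x * u x * v x) \<bullet> vx"
      using cu cv by (simp add: X.inner_cmul[symmetric] X.cmul_emb continuous_on_mult mult.commute)
    moreover have "X.cmul (weight_v \<epsilon>) (X.emb v) \<bullet> X.cmul u vx = X.emb (\<lambda>x. weight_v \<epsilon> x * u x * v x) \<bullet> vx"
      using cu cv by (simp add: X.inner_cmul[symmetric] X.cmul_emb continuous_on_mult mult.left_commute mult.assoc)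
    moreover have "X.emb (\<lambda>x. weight_u \<epsilon> x * u x * v x) - X.emb (\<lambda>x. weight_v \<epsilon> x * u x * v x)
        = X.cmul (\<lambda>x. (weight_u \<epsilon> x - weight_v \<epsilon> x) * u x) (X.emb v)"
    proof -
      have c: "X.cont (\<lambda>x. (weight_u \<epsilon> x - weight_v \<epsilon> x) * u x)" "X.cont (\<lambda>x. weight_u \<epsilon> x * u x * v x)"
        "X.cont (\<lambda>x. weight_v \<epsilon> x * u x * v x)"
        using cu cv by (auto intro!: continuous_intros)
      show ?thesis
        unfolding X.emb_diff[OF c(2,3), symmetric] X.cmul_emb[OF c(1) cv] by (simp add: left_diff_distrib)
    qed
    ultimately show ?thesis by (simp add: I2_def flip: inner_diff_left)
  qed
  have "B \<epsilon> (X.emb u, X.emb v, z) (HS_nonlinearity (X.emb u) ux (X.emb v) vx) = \<epsilon> * I1 + 3 * I2"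
    using e1 e2 by (simp add: B_def HS_nonlinearity_def X.mult_L2_emb[OF cu] X.mult_L2_emb[OF cv] inner_add_right)
  moreover have "\<bar>I1\<bar> \<le> L * sqrt L * R * (norm ux)\<^sup>2"
  proof -
    have "\<bar>I1\<bar> \<le> norm (X.cmul u (X.emb u)) * norm (X.emb u)"
      unfolding I1_def by (rule Cauchy_Schwarz_ineq2)
    also have "\<dots> \<le> ((norm ux * sqrt L) * norm (X.emb u)) * norm (X.emb u)"
      by (intro mult_right_mono X.norm_cmul_le cu sup_u) auto
    also have "\<dots> \<le> ((norm ux * sqrt L) * R) * (L * norm ux)"
      using R(1) X.Poincare[OF u(1,2)] R0 L_pos by (intro mult_mono mult_left_mono) auto
    finally show ?thesis by (simp add: power2_eq_square mult_ac)
  qed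
  moreover have "\<bar>I2\<bar> \<le> \<epsilon> * (L * sqrt L * R) * (norm ux * norm vx)"
  proof -
    have b: "\<bar>(weight_u \<epsilon> x - weight_v \<epsilon> x) * u x\<bar> \<le> (\<epsilon> * L) * (norm ux * sqrt L)" if x: "x \<in> {0..L}" for x
    proof -
      have "weight_u \<epsilon> x - weight_v \<epsilon> x = \<epsilon> * (L - 2 * x)" by (simp add: weight_u_def weight_v_def algebra_simps)
      moreover have "\<bar>L - 2 * x\<bar> \<le> L" using x by auto
      ultimately have "\<bar>weight_u \<epsilon> x - weight_v \<epsilon> x\<bar> \<le> \<epsilon> * L" using \<epsilon> by (simp add: abs_mult mult_left_mono)
      then show ?thesis
        unfolding abs_mult using sup_u[OF x] \<epsilon> L_pos by (intro mult_mono) auto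
    qed
    have "\<bar>I2\<bar> \<le> norm (X.cmul (\<lambda>x. (weight_u \<epsilon> x - weight_v \<epsilon> x) * u x) (X.emb v)) * norm vx"
      unfolding I2_def by (rule Cauchy_Schwarz_ineq2)
    also have "\<dots> \<le> (((\<epsilon> * L) * (norm ux * sqrt L)) * norm (X.emb v)) * norm vx"
      using cu by (intro mult_right_mono X.norm_cmul_le b) (auto intro!: continuous_intros)
    also have "\<dots> \<le> (((\<epsilon> * L) * (norm ux * sqrt L)) * R) * norm vx"
      using R(2) \<epsilon> L_pos by (intro mult_right_mono mult_left_mono) auto
    finally show ?thesis by (simp add: mult_ac)
  qed
  moreover have "norm ux * norm vx \<le> ((norm ux)\<^sup>2 + (norm vx)\<^sup>2) / 2"
    using sum_squares_bound[of "norm ux" "norm vx"] by simp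
  ultimately have I: "B \<epsilon> (X.emb u, X.emb v, z) (HS_nonlinearity (X.emb u) ux (X.emb v) vx) = \<epsilon> * I1 + 3 * I2"
    "\<bar>I1\<bar> \<le> L * sqrt L * R * (norm ux)\<^sup>2" "\<bar>I2\<bar> \<le> \<epsilon> * (L * sqrt L * R) * (norm ux * norm vx)"
    "norm ux * norm vx \<le> ((norm ux)\<^sup>2 + (norm vx)\<^sup>2) / 2" by blast+
  have "0 \<le> \<epsilon> * (L * sqrt L * R)" using \<epsilon> R0 L_pos by simp
  from order_trans[OF I(3) mult_left_mono[OF I(4) this]]
  have "3 * \<bar>I2\<bar> \<le> 3 * (\<epsilon> * (L * sqrt L * R) * (((norm ux)\<^sup>2 + (norm vx)\<^sup>2) / 2))" by linarith
  moreover have "\<epsilon> * \<bar>I1\<bar> \<le> \<epsilon> * (L * sqrt L * R * (norm ux)\<^sup>2)" using I(2) \<epsilon> by (rule mult_left_mono)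
  moreover have "\<bar>\<epsilon> * I1 + 3 * I2\<bar> \<le> \<epsilon> * \<bar>I1\<bar> + 3 * \<bar>I2\<bar>"
    using abs_triangle_ineq[of "\<epsilon> * I1" "3 * I2"] \<epsilon> by (simp add: abs_mult)
  ultimately have "\<bar>B \<epsilon> (X.emb u, X.emb v, z) (HS_nonlinearity (X.emb u) ux (X.emb v) vx)\<bar>
      \<le> \<epsilon> * (L * sqrt L * R * (norm ux)\<^sup>2) + 3 * (\<epsilon> * (L * sqrt L * R) * (((norm ux)\<^sup>2 + (norm vx)\<^sup>2) / 2))"
    unfolding I(1) by linarith
  also have "\<dots> \<le> \<epsilon> * (5/2 * L * sqrt L * R) * ((norm ux)\<^sup>2 + (norm vx)\<^sup>2)"
    using \<epsilon> R0 L_pos by (simp add: algebra_simps)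
  finally show ?thesis .
qed

end

section \<open>Mild solutions of the Hirota--Satsuma system\<close>

lemma AE_bounded_of_incseq:
  fixes \<phi> :: "nat \<Rightarrow> real \<Rightarrow> real"
  assumes int: "\<And>N. set_integrable lebesgue A (\<phi> N)" and nonneg: "\<And>N s. 0 \<le> \<phi> N s"
    and inc: "\<And>s. incseq (\<lambda>N. \<phi> N s)" and bd: "\<And>N. (LINT s:A|lebesgue. \<phi> N s) \<le> M"
  shows "AE s in lebesgue. s \<in> A \<longrightarrow> (\<exists>C. \<forall>N. \<phi> N s \<le> C)"
proof -
  define \<psi> where "\<psi> N s = ennreal (indicator A s * \<phi> N s)" for N s
  have int': "integrable lebesgue (\<lambda>s. indicator A s * \<phi> N s)" for N
    using int[of N] by (simp add: set_integrable_def)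
  have [measurable]: "\<psi> N \<in> borel_measurable lebesgue" for N
    unfolding \<psi>_def using borel_measurable_integrable[OF int'] by (rule measurable_compose) simp
  have eq: "(\<integral>\<^sup>+s. \<psi> N s \<partial>lebesgue) = ennreal (LINT s:A|lebesgue. \<phi> N s)" for N
    unfolding \<psi>_def set_lebesgue_integral_def real_scaleR_def
    by (rule nn_integral_eq_integral[OF int']) (simp add: nonneg)
  have "(\<integral>\<^sup>+s. (SUP N. \<psi> N s) \<partial>lebesgue) = (SUP N. \<integral>\<^sup>+s. \<psi> N s \<partial>lebesgue)"
  proof (rule nn_integral_monotone_convergence_SUP)
    show "incseq \<psi>"
    proof (rule incseq_SucI, rule le_funI)
      fix N s
      have "\<phi> N s \<le> \<phi> (Suc N) s" using incseq_SucD[OF inc] .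
      then show "\<psi> N s \<le> \<psi> (Suc N) s"
        unfolding \<psi>_def by (intro ennreal_leI mult_left_mono) auto
    qed
  qed simp
  also have "\<dots> \<le> ennreal M" by (rule SUP_least) (simp add: eq bd ennreal_leI)
  finally have "(\<integral>\<^sup>+s. (SUP N. \<psi> N s) \<partial>lebesgue) \<noteq> \<infinity>" by (auto simp: top_unique)
  then have "AE s in lebesgue. (SUP N. \<psi> N s) \<noteq> \<infinity>" by (intro nn_integral_PInf_AE) auto
  then show ?thesis
  proof eventually_elim
    case (elim s)
    show ?case
    proof
      assume s: "s \<in> A"
      obtain C where C: "0 \<le> C" "(SUP N. \<psi> N s) = ennreal C"
        using elim by (cases "SUP N. \<psi> N s") auto
      have "\<phi> N s \<le> C" for N
      proof -
        have "\<psi> N s \<le> ennreal C" unfolding C(2)[symmetric] by (rule SUP_upper) simp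
        then show ?thesis using s C(1) by (simp add: \<psi>_def)
      qed
      then show "\<exists>C. \<forall>N. \<phi> N s \<le> C" by blast
    qed
  qed
qed

lemma C0_semigroup_onD:
  assumes "C0_semigroup_on X S"
  shows "\<And>t x. 0 \<le> t \<Longrightarrow> x \<in> X \<Longrightarrow> S t x \<in> X"
    "\<And>t x y. 0 \<le> t \<Longrightarrow> x \<in> X \<Longrightarrow> y \<in> X \<Longrightarrow> S t (x + y) = S t x + S t y"
    "\<And>t c x. 0 \<le> t \<Longrightarrow> x \<in> X \<Longrightarrow> S t (c *\<^sub>R x) = c *\<^sub>R S t x"
    "\<And>t. 0 \<le> t \<Longrightarrow> \<exists>C. \<forall>x\<in>X. norm (S t x) \<le> C * norm x"
    "\<And>x. x \<in> X \<Longrightarrow> S 0 x = x"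
    "\<And>s t x. 0 \<le> s \<Longrightarrow> 0 \<le> t \<Longrightarrow> x \<in> X \<Longrightarrow> S (s + t) x = S s (S t x)"
    "\<And>x. x \<in> X \<Longrightarrow> ((\<lambda>t. S t x) \<longlongrightarrow> x) (at_right 0)"
  using assms unfolding C0_semigroup_on_def by simp_all

context hirota_satsuma
begin

definition proj :: "state \<Rightarrow> state" where
  "proj U = (X.cmul (\<lambda>_. 1) (fst U), X.cmul (\<lambda>_. 1) (fst (snd U)), Z.cmul (\<lambda>_. 1) (snd (snd U)))"

lemma proj_in: "proj U \<in> state_space L"
  by (simp add: proj_def state_space_def X.cmul_in Z.cmul_in)

lemma proj_id: "U \<in> state_space L \<Longrightarrow> proj U = U"
  by (auto simp: proj_def state_space_def X.cmul_const Z.cmul_const)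

lemma bounded_linear_proj: "bounded_linear proj"
  unfolding proj_def
  by (intro bounded_linear_Pair
      bounded_linear_compose[OF X.bounded_linear_cmul] bounded_linear_compose[OF Z.bounded_linear_cmul]
      bounded_linear_compose[OF bounded_linear_fst] bounded_linear_compose[OF bounded_linear_snd]
      bounded_linear_fst bounded_linear_snd bounded_linear_ident continuous_intros)

lemma state_space_imp:
  assumes "U \<in> state_space L"
  shows "fst U \<in> L2_on 0 L" "fst (snd U) \<in> L2_on 0 L" "snd (snd U) \<in> L2_on 0 1"
  using assms by (auto simp: state_space_def)

lemma projected_semigroup_proj:
  assumes S: "C0_semigroup_on (state_space L) S"
  shows "projected_semigroup (\<lambda>t x. S t (proj x))"
proof (rule projected_semigroup.intro)
  note S = C0_semigroup_onD[OF S]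
  interpret proj: bounded_linear proj by (rule bounded_linear_proj)
  show "bounded_linear (\<lambda>x. S t (proj x))" if t: "0 \<le> t" for t
  proof -
    obtain C where C: "\<And>x. x \<in> state_space L \<Longrightarrow> norm (S t x) \<le> C * norm x"
      using S(4)[OF t] by blast
    obtain K where K: "0 \<le> K" "\<And>x. norm (proj x) \<le> norm x * K" using proj.nonneg_bounded by blast
    show ?thesis
    proof (rule bounded_linear_intro)
      show "S t (proj (x + y)) = S t (proj x) + S t (proj y)" for x y
        unfolding proj.add by (rule S(2)[OF t proj_in proj_in])
      show "S t (proj (r *\<^sub>R x)) = r *\<^sub>R S t (proj x)" for r x
        unfolding proj.scaleR by (rule S(3)[OF t proj_in])
      show "norm (S t (proj x)) \<le> norm x * (K * \<bar>C\<bar>)" for x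
      proof -
        have "norm (S t (proj x)) \<le> C * norm (proj x)" by (rule C[OF proj_in])
        also have "\<dots> \<le> \<bar>C\<bar> * norm (proj x)" by (intro mult_right_mono) auto
        also have "\<dots> \<le> \<bar>C\<bar> * (norm x * K)" by (intro mult_left_mono K) auto
        finally show ?thesis by (simp add: mult_ac)
      qed
    qed
  qed
  show "S (s + t) (proj x) = S s (proj (S t (proj x)))" if "0 \<le> s" "0 \<le> t" for s t x
    unfolding proj_id[OF S(1)[OF that(2) proj_in]] by (rule S(6)[OF that proj_in])
  show "((\<lambda>t. S t (proj x)) \<longlongrightarrow> S 0 (proj x)) (at_right 0)" for x
    unfolding S(5)[OF proj_in] by (rule S(7)[OF proj_in])
qed

end

text \<open>A mild solution, with its semigroup and its spatial derivatives fixed.\<close>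

locale hs_solution = hirota_satsuma L h \<alpha> \<beta> for L h \<alpha> \<beta> :: real +
  fixes S :: "real \<Rightarrow> state \<Rightarrow> state" and ux vx :: "real \<Rightarrow> L2" and U0 :: state and U :: "real \<Rightarrow> state"
  assumes S: "C0_semigroup_on (state_space L) S"
    and gen: "generator_on (state_space L) S = HS_operator L h \<alpha> \<beta>"
    and cont_U: "\<And>T. 0 < T \<Longrightarrow> continuous_on {0..T} U"
    and U_in: "\<And>t. 0 \<le> t \<Longrightarrow> U t \<in> state_space L"
    and ux: "\<And>T. 0 < T \<Longrightarrow> L2_time_H1 0 L T (\<lambda>t. fst (U t)) ux"
    and vx: "\<And>T. 0 < T \<Longrightarrow> L2_time_H1 0 L T (\<lambda>t. fst (snd (U t))) vx"
    and U0_in: "U0 \<in> state_space L"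
    and duhamel: "\<And>t. 0 \<le> t \<Longrightarrow> has_bochner_integral (lebesgue_on {0..t})
      (\<lambda>s. S (t - s) (HS_nonlinearity (fst (U s)) (ux s) (fst (snd (U s))) (vx s))) (U t - S t U0)"
begin

abbreviation u :: "real \<Rightarrow> L2" where "u t \<equiv> fst (U t)"
abbreviation v :: "real \<Rightarrow> L2" where "v t \<equiv> fst (snd (U t))"
abbreviation z :: "real \<Rightarrow> L2" where "z t \<equiv> snd (snd (U t))"

definition f :: "real \<Rightarrow> state" where "f s = HS_nonlinearity (u s) (ux s) (v s) (vx s)"
definition T :: "real \<Rightarrow> state \<Rightarrow> state" where "T t x = S t (proj x)"

sublocale P: projected_semigroup T
  using projected_semigroup_proj[OF S] unfolding T_def[abs_def] .

lemma S_in: "0 \<le> t \<Longrightarrow> x \<in> state_space L \<Longrightarrow> S t x \<in> state_space L"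
  by (rule C0_semigroup_onD(1)[OF S])

lemma T_eq: "x \<in> state_space L \<Longrightarrow> T t x = S t x"
  by (simp add: T_def proj_id)

lemma T_0: "x \<in> state_space L \<Longrightarrow> T 0 x = x"
  unfolding T_eq by (rule C0_semigroup_onD(5)[OF S])

lemma T_0_imp: "T 0 x = x \<Longrightarrow> x \<in> state_space L"
  using S_in[OF _ proj_in, of 0 x] by (simp add: T_def)

lemma generator_sub: "(x, y) \<in> P.generator \<Longrightarrow> (x, y) \<in> HS_operator L h \<alpha> \<beta>"
  unfolding gen[symmetric] using T_0_imp[of x] by (auto simp: P.generator_def generator_on_def T_eq)

lemma f_in: "0 \<le> s \<Longrightarrow> f s \<in> state_space L"
  using state_space_imp[OF U_in[of s]]
  by (auto simp: f_def HS_nonlinearity_def state_space_def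
      intro!: L2_on_add L2_on_scale X.mult_L2_in L2_on_scale[of _ _ _ "- 3", simplified])

lemma duhamel_T:
  assumes "0 \<le> t"
  shows "set_integrable lebesgue {0..t} (\<lambda>s. T (t - s) (f s))"
    "(LINT s:{0..t}|lebesgue. T (t - s) (f s)) = U t - T t U0"
proof -
  have hb: "has_bochner_integral (lebesgue_on {0..t}) (\<lambda>s. S (t - s) (f s)) (U t - T t U0)"
    using duhamel[OF assms] U0_in by (simp add: T_eq f_def)
  have eq: "indicator {0..t} s *\<^sub>R T (t - s) (f s) = indicator {0..t} s *\<^sub>R S (t - s) (f s)" for s
    by (auto simp: indicator_def T_eq f_in)
  show "set_integrable lebesgue {0..t} (\<lambda>s. T (t - s) (f s))"
    using hb unfolding set_integrable_def eq
    by (simp add: has_bochner_integral_iff integrable_restrict_space)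
  show "(LINT s:{0..t}|lebesgue. T (t - s) (f s)) = U t - T t U0"
    using hb unfolding set_lebesgue_integral_def eq
    by (simp add: has_bochner_integral_iff integral_restrict_space)
qed

lemma U_0: "U 0 = U0"
proof -
  have "(LINT s:{0..0}|lebesgue. T (0 - s) (f s)) = 0"
    unfolding set_lebesgue_integral_def
  proof (rule integral_eq_zero_AE)
    show "AE s in lebesgue. indicator {0..0} s *\<^sub>R T (0 - s) (f s) = 0"
      using AE_completion[OF AE_lborel_singleton[of 0]] by eventually_elim simp
  qed
  then show ?thesis using duhamel_T(2)[of 0] T_0[OF U0_in] by simp
qed

text \<open>Duhamel's formula restarted at time \<open>c\<close>: the operator \<open>T (d - c)\<close> carries the integral over \<open>[0, c]\<close>
in the formula for \<open>U c\<close> into the corresponding part of the formula for \<open>U d\<close>.\<close>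

lemma mild_increment:
  assumes "0 \<le> c" "c \<le> d"
  shows "set_integrable lebesgue {c..d} (\<lambda>s. T (d - s) (f s))"
    "(LINT s:{c..d}|lebesgue. T (d - s) (f s)) = U d - T (d - c) (U c)"
proof -
  have d: "0 \<le> d" "0 \<le> d - c" using assms by auto
  note lin = P.lin[OF d(2)]
  show int: "set_integrable lebesgue {c..d} (\<lambda>s. T (d - s) (f s))"
    by (rule set_integrable_subset[OF duhamel_T(1)[OF d(1)]]) (use assms in auto)
  have eq: "indicator {0..c} s *\<^sub>R T (d - s) (f s) = T (d - c) (indicator {0..c} s *\<^sub>R T (c - s) (f s))" for s
    using P.semigroup[of "d - c" "c - s" "f s"] assms linear_simps[OF lin] by (auto simp: indicator_def)
  note ic = duhamel_T(1)[OF assms(1), unfolded set_integrable_def]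
  have "(LINT s:{0..c}|lebesgue. T (d - s) (f s)) = T (d - c) (U c - T c U0)"
    unfolding duhamel_T(2)[OF assms(1), symmetric] set_lebesgue_integral_def eq
    by (rule integral_bounded_linear[OF lin ic])
  also have "\<dots> = T (d - c) (U c) - T d U0"
    using P.semigroup[of "d - c" c U0] assms linear_simps[OF lin] by simp
  finally have 1: "(LINT s:{0..c}|lebesgue. T (d - s) (f s)) = T (d - c) (U c) - T d U0" .
  have int0: "set_integrable lebesgue {0..<c} (\<lambda>s. T (d - s) (f s))"
    by (rule set_integrable_subset[OF duhamel_T(1)[OF d(1)]]) (use assms in auto)
  have int1: "set_integrable lebesgue {0..c} (\<lambda>s. T (d - s) (f s))"
    by (rule set_integrable_subset[OF duhamel_T(1)[OF d(1)]]) (use assms in auto)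
  have disj: "{0..<c} \<inter> {c..d} = {}" by auto
  have "{0..d} = {0..<c} \<union> {c..d}" using assms by auto
  then have "(LINT s:{0..d}|lebesgue. T (d - s) (f s))
      = (LINT s:{0..<c}|lebesgue. T (d - s) (f s)) + (LINT s:{c..d}|lebesgue. T (d - s) (f s))"
    using set_integral_Un[OF disj int0 int] by simp
  then show "(LINT s:{c..d}|lebesgue. T (d - s) (f s)) = U d - T (d - c) (U c)"
    using 1 duhamel_T(2)[OF d(1)] set_integral_atLeastLessThan(2)[OF int1] by (simp add: algebra_simps)
qed

lemma AE_weak_deriv:
  "AE s in lebesgue. s \<in> {0..t} \<longrightarrow> weak_deriv 0 L (u s) (ux s) \<and> weak_deriv 0 L (v s) (vx s)"
proof -
  define t' where "t' = max t 1"
  have t': "0 < t'" by (simp add: t'_def)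
  have "AE s in lebesgue_on {0..t'}. weak_deriv 0 L (u s) (ux s)" "AE s in lebesgue_on {0..t'}. weak_deriv 0 L (v s) (vx s)"
    using ux[OF t'] vx[OF t'] by (auto simp: L2_time_H1_def)
  then have "AE s in lebesgue. s \<in> {0..t'} \<longrightarrow> weak_deriv 0 L (u s) (ux s)"
    "AE s in lebesgue. s \<in> {0..t'} \<longrightarrow> weak_deriv 0 L (v s) (vx s)"
    by (simp_all add: AE_restrict_space_iff)
  then show ?thesis by eventually_elim (auto simp: t'_def)
qed

lemma cont_on_U: "0 \<le> a \<Longrightarrow> continuous_on {a..b} U"
  by (rule continuous_on_subset[OF cont_U[of "max b 1"]]) auto

lemma derivatives_integrable:
  assumes "0 \<le> a"
  shows "set_integrable lebesgue {a..b} (\<lambda>s. (norm (ux s))\<^sup>2)" "set_integrable lebesgue {a..b} (\<lambda>s. (norm (vx s))\<^sup>2)"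
    "set_integrable lebesgue {a..b} (\<lambda>s. (norm (u s))\<^sup>2)" "set_integrable lebesgue {a..b} (\<lambda>s. (norm (v s))\<^sup>2)"
proof -
  define t where "t = max b 1"
  have t: "0 < t" by (simp add: t_def)
  have sub: "{a..b} \<subseteq> {0..t}" using assms by (auto simp: t_def)
  have i: "set_integrable lebesgue {0..t} (\<lambda>s. (norm (u s))\<^sup>2 + (norm (ux s))\<^sup>2)"
    "set_integrable lebesgue {0..t} (\<lambda>s. (norm (v s))\<^sup>2 + (norm (vx s))\<^sup>2)"
    using ux[OF t] vx[OF t] by (auto simp: L2_time_H1_def set_integrable_def integrable_restrict_space)
  have c: "set_integrable lebesgue {0..t} (\<lambda>s. (norm (u s))\<^sup>2)" "set_integrable lebesgue {0..t} (\<lambda>s. (norm (v s))\<^sup>2)"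
    using cont_U[OF t] by (auto intro!: absolutely_integrable_continuous_real continuous_intros)
  show "set_integrable lebesgue {a..b} (\<lambda>s. (norm (ux s))\<^sup>2)"
    by (rule set_integrable_subset[OF set_integral_diff(1)[OF i(1) c(1), simplified] _ sub]) simp
  show "set_integrable lebesgue {a..b} (\<lambda>s. (norm (vx s))\<^sup>2)"
    by (rule set_integrable_subset[OF set_integral_diff(1)[OF i(2) c(2), simplified] _ sub]) simp
  show "set_integrable lebesgue {a..b} (\<lambda>s. (norm (u s))\<^sup>2)"
    by (rule set_integrable_subset[OF c(1) _ sub]) simp
  show "set_integrable lebesgue {a..b} (\<lambda>s. (norm (v s))\<^sup>2)"
    by (rule set_integrable_subset[OF c(2) _ sub]) simp
qed

text \<open>An integrable majorant of the nonlinearity. It uses the embedding of \<open>H\<^sup>1(0, L)\<close> in the bounded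
functions for the undifferentiated factor.\<close>

definition f_bound :: "real \<Rightarrow> real" where
  "f_bound s = 9 * (1 / sqrt L + sqrt L) *
    ((norm (u s))\<^sup>2 + (norm (ux s))\<^sup>2 + (norm (v s))\<^sup>2 + (norm (vx s))\<^sup>2)"

lemma norm_f_le:
  assumes "weak_deriv 0 L (u s) (ux s)" "weak_deriv 0 L (v s) (vx s)"
  shows "norm (f s) \<le> f_bound s"
proof -
  define m where "m = 1 / sqrt L + sqrt L"
  have m: "0 < m" using X.L_pos by (simp add: m_def add_pos_pos)
  obtain cu where cu: "X.H1 cu (ux s)" "u s = X.emb cu" using X.weak_deriv_H1[OF assms(1)] by blast
  obtain cv where cv: "X.H1 cv (vx s)" "v s = X.emb cv" using X.weak_deriv_H1[OF assms(2)] by blast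
  have mult: "norm (mult_L2 (X.emb c) G) \<le> m * (norm (X.emb c) + norm g) * norm G" if c: "X.H1 c g" for c g G
    unfolding X.mult_L2_emb[OF X.H1_cont[OF c]]
  proof (rule X.norm_cmul_le[OF X.H1_cont[OF c]])
    fix x assume "x \<in> {0..L}"
    from X.H1_sup[OF c this]
    have "\<bar>c x\<bar> \<le> 1 / sqrt L * norm (X.emb c) + sqrt L * norm g" by (simp add: mult.commute)
    also have "\<dots> \<le> m * norm (X.emb c) + m * norm g"
      using X.L_pos by (intro add_mono mult_right_mono) (auto simp: m_def)
    finally show "\<bar>c x\<bar> \<le> m * (norm (X.emb c) + norm g)" by (simp add: distrib_left)
  qed
  define a b c d where "a = norm (u s)" and "b = norm (ux s)" and "c = norm (v s)" and "d = norm (vx s)"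
  have k: "norm (mult_L2 (u s) (ux s)) \<le> m * (a + b) * b" "norm (mult_L2 (v s) (vx s)) \<le> m * (c + d) * d"
    "norm (mult_L2 (u s) (vx s)) \<le> m * (a + b) * d"
    using mult[OF cu(1)] mult[OF cv(1)] by (simp_all add: a_def b_def c_def d_def flip: cu(2) cv(2))
  have n: "norm (x, y, w) \<le> norm x + norm y + norm w" for x y w :: L2
    using norm_Pair_le[of x "(y, w)"] norm_Pair_le[of y w] by linarith
  have "norm (f s) \<le> norm (3 *\<^sub>R mult_L2 (u s) (ux s) + 3 *\<^sub>R mult_L2 (v s) (vx s))
      + norm (- 3 *\<^sub>R mult_L2 (u s) (vx s)) + norm (0 :: L2)"
    unfolding f_def HS_nonlinearity_def by (rule n)
  also have "\<dots> \<le> 3 * norm (mult_L2 (u s) (ux s)) + 3 * norm (mult_L2 (v s) (vx s)) + 3 * norm (mult_L2 (u s) (vx s))"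
    using norm_triangle_ineq[of "3 *\<^sub>R mult_L2 (u s) (ux s)" "3 *\<^sub>R mult_L2 (v s) (vx s)"] by simp
  also have "\<dots> \<le> 3 * (m * (a + b) * b) + 3 * (m * (c + d) * d) + 3 * (m * (a + b) * d)"
    using k by linarith
  also have "\<dots> = m * (3 * ((a + b) * b + (c + d) * d + (a + b) * d))"
    by (simp add: algebra_simps)
  also have "\<dots> \<le> m * (9 * (a\<^sup>2 + b\<^sup>2 + c\<^sup>2 + d\<^sup>2))"
  proof (intro mult_left_mono)
    have "2 * (a * b) \<le> a\<^sup>2 + b\<^sup>2" "2 * (c * d) \<le> c\<^sup>2 + d\<^sup>2" "2 * (a * d) \<le> a\<^sup>2 + d\<^sup>2" "2 * (b * d) \<le> b\<^sup>2 + d\<^sup>2"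
      using sum_squares_bound[of a b] sum_squares_bound[of c d] sum_squares_bound[of a d] sum_squares_bound[of b d]
      by (simp_all add: mult.assoc)
    moreover have "3 * ((a + b) * b + (c + d) * d + (a + b) * d)
        = 3 * (a * b) + 3 * b\<^sup>2 + 3 * (c * d) + 3 * d\<^sup>2 + 3 * (a * d) + 3 * (b * d)"
      by (simp add: algebra_simps power2_eq_square)
    moreover have "0 \<le> a\<^sup>2" "0 \<le> b\<^sup>2" "0 \<le> c\<^sup>2" "0 \<le> d\<^sup>2" by simp_all
    ultimately show "3 * ((a + b) * b + (c + d) * d + (a + b) * d) \<le> 9 * (a\<^sup>2 + b\<^sup>2 + c\<^sup>2 + d\<^sup>2)"
      unfolding distrib_left[of 9] by argo
  qed (use m in simp)
  also have "\<dots> = f_bound s" by (simp only: f_bound_def m_def a_def b_def c_def d_def mult_ac)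
  finally show ?thesis .
qed

lemma energy_inequality:
  assumes "0 \<le> a" "a \<le> b" and G: "continuous_on UNIV G"
    and diss: "\<And>x y. (x, y) \<in> HS_operator L h \<alpha> \<beta> \<Longrightarrow> B \<epsilon> x y \<le> - G x"
  shows "set_integrable lebesgue {a..b} (\<lambda>s. B \<epsilon> (U s) (f s))"
    "B \<epsilon> (U b) (U b) / 2 - B \<epsilon> (U a) (U a) / 2 \<le> (LINT s:{a..b}|lebesgue. B \<epsilon> (U s) (f s) - G (U s))"
proof -
  have g: "set_integrable lebesgue {a..b} f_bound"
    unfolding f_bound_def using derivatives_integrable[OF assms(1)]
    by (intro set_integrable_mult_right set_integral_add)
  have fg: "AE s in lebesgue. s \<in> {a..b} \<longrightarrow> norm (f s) \<le> f_bound s"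
    using AE_weak_deriv[of b] by eventually_elim (use assms(1) norm_f_le in auto)
  note * = P.mild_energy_inequality[where U = U and f = f and a = a and b = b and g = f_bound and B = "B \<epsilon>" and G = G]
  show "set_integrable lebesgue {a..b} (\<lambda>s. B \<epsilon> (U s) (f s))"
    by (rule *(1)) (use assms g fg bounded_bilinear_B B_sym cont_on_U U_in f_in T_0 mild_increment generator_sub in auto)
  show "B \<epsilon> (U b) (U b) / 2 - B \<epsilon> (U a) (U a) / 2 \<le> (LINT s:{a..b}|lebesgue. B \<epsilon> (U s) (f s) - G (U s))"
    by (rule *(2)) (use assms g fg bounded_bilinear_B B_sym cont_on_U U_in f_in T_0 mild_increment generator_sub in auto)
qed

end

section \<open>Exponential decay of small solutions\<close>

context hirota_satsuma
begin

lemma B_zero: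
  assumes "x \<in> state_space L"
  shows "B 0 x x = (norm (fst x))\<^sup>2 + (norm (fst (snd x)))\<^sup>2 + \<beta> * h * (norm (snd (snd x)))\<^sup>2"
proof -
  have "weight_u 0 = (\<lambda>_. 1)" "weight_v 0 = (\<lambda>_. 1)" "weight_z 0 = (\<lambda>_. 1)"
    by (simp_all add: fun_eq_iff weight_u_def weight_v_def weight_z_def)
  then show ?thesis
    using state_space_imp[OF assms] by (simp add: B_def X.cmul_const Z.cmul_const power2_norm_eq_inner)
qed

lemma weight_bounds:
  assumes "0 \<le> \<epsilon>"
  shows "x \<in> {0..L} \<Longrightarrow> 1 \<le> weight_u \<epsilon> x" "x \<in> {0..L} \<Longrightarrow> weight_u \<epsilon> x \<le> 1 + \<epsilon> * (L + 1)"
    "x \<in> {0..L} \<Longrightarrow> 1 \<le> weight_v \<epsilon> x" "x \<in> {0..L} \<Longrightarrow> weight_v \<epsilon> x \<le> 1 + \<epsilon> * (L + 1)"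
    "x \<in> {0..1} \<Longrightarrow> 1 \<le> weight_z \<epsilon> x" "x \<in> {0..1} \<Longrightarrow> weight_z \<epsilon> x \<le> 1 + \<epsilon> * (L + 1)"
proof -
  have e: "weight_u \<epsilon> x = 1 + \<epsilon> * (L - x)" "weight_z \<epsilon> x = 1 + \<epsilon> * (1 - x)" by (simp_all add: weight_u_def weight_z_def algebra_simps)
  show "x \<in> {0..L} \<Longrightarrow> 1 \<le> weight_u \<epsilon> x" "x \<in> {0..L} \<Longrightarrow> 1 \<le> weight_v \<epsilon> x" "x \<in> {0..1} \<Longrightarrow> 1 \<le> weight_z \<epsilon> x"
    using assms by (simp_all add: e weight_v_def)
  show "x \<in> {0..L} \<Longrightarrow> weight_u \<epsilon> x \<le> 1 + \<epsilon> * (L + 1)" "x \<in> {0..L} \<Longrightarrow> weight_v \<epsilon> x \<le> 1 + \<epsilon> * (L + 1)"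
    "x \<in> {0..1} \<Longrightarrow> weight_z \<epsilon> x \<le> 1 + \<epsilon> * (L + 1)"
    using assms X.L_pos unfolding e weight_v_def by (auto intro!: add_left_mono mult_left_mono)
qed

lemma B_equivalent:
  assumes x: "x \<in> state_space L" and \<epsilon>: "0 \<le> \<epsilon>"
  shows "B 0 x x \<le> B \<epsilon> x x" "B \<epsilon> x x \<le> (1 + \<epsilon> * (L + 1)) * B 0 x x"
proof -
  note w = weight_bounds[OF \<epsilon>] and s = state_space_imp[OF x]
  have bh: "0 \<le> \<beta> * h" using h_pos \<beta>_pos by simp
  show "B 0 x x \<le> B \<epsilon> x x"
    unfolding B_zero[OF x] unfolding B_def
    by (intro add_mono mult_left_mono bh X.cmul_ge Z.cmul_ge s weight_cont w)
  have "B \<epsilon> x x \<le> (1 + \<epsilon> * (L + 1)) * (norm (fst x))\<^sup>2 + (1 + \<epsilon> * (L + 1)) * (norm (fst (snd x)))\<^sup>2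
      + \<beta> * h * ((1 + \<epsilon> * (L + 1)) * (norm (snd (snd x)))\<^sup>2)"
    unfolding B_def
  proof (intro add_mono mult_left_mono bh X.cmul_le Z.cmul_le weight_cont)
    show "\<bar>weight_u \<epsilon> y\<bar> \<le> 1 + \<epsilon> * (L + 1)" if "y \<in> {0..L}" for y using w(1)[OF that] w(2)[OF that] by linarith
    show "\<bar>weight_v \<epsilon> y\<bar> \<le> 1 + \<epsilon> * (L + 1)" if "y \<in> {0..L}" for y using w(3)[OF that] w(4)[OF that] by linarith
    show "\<bar>weight_z \<epsilon> y\<bar> \<le> 1 + \<epsilon> * (L + 1)" if "y \<in> {0..1}" for y using w(5)[OF that] w(6)[OF that] by linarith
  qed
  then show "B \<epsilon> x x \<le> (1 + \<epsilon> * (L + 1)) * B 0 x x"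
    unfolding B_zero[OF x] by (simp add: algebra_simps)
qed

lemma B_zero_nonneg: "x \<in> state_space L \<Longrightarrow> 0 \<le> B 0 x x"
  using h_pos \<beta>_pos by (simp add: B_zero)

lemma energy_eq:
  assumes "x \<in> state_space L"
  shows "energy L h \<beta> x = B 0 x x / 2"
proof -
  note s = state_space_imp[OF assms]
  have sq: "integrable lebesgue (\<lambda>y. (fun_of F y)\<^sup>2)" for F
    using square_integrable_fun_of[of F] by (simp add: square_integrable_def)
  have ind: "AE y in lebesgue. indicator {0..b} y *\<^sub>R (fun_of F y)\<^sup>2 = (fun_of F y)\<^sup>2" if "F \<in> L2_on 0 b" for F and b :: real
    using L2_onD[OF that] by eventually_elim (auto simp: indicator_def)
  have int: "set_integrable lebesgue {0..b} (\<lambda>y. (fun_of F y)\<^sup>2)" for F and b :: real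
    unfolding set_integrable_def using integrable_mult_indicator[OF _ sq, of "{0..b}" F] by simp
  have n: "(LINT y:{0..b}|lebesgue. (fun_of F y)\<^sup>2) = (norm F)\<^sup>2" if "F \<in> L2_on 0 b" for F and b :: real
    unfolding set_lebesgue_integral_def norm_L2_sq
    by (rule integral_cong_AE)
      (use ind[OF that] int[of b F] sq[of F] in \<open>auto simp: set_integrable_def intro: borel_measurable_integrable\<close>)
  show ?thesis
    unfolding B_zero[OF assms] energy_def
    using n[OF s(1)] n[OF s(2)] n[OF s(3)] set_integral_add(2)[OF int int, of L "fst x" "fst (snd x)"]
    by (simp add: case_prod_beta add_divide_distrib)
qed

end

context hs_solution
begin

text \<open>Membership of \<open>u\<close> and \<open>v\<close> in \<open>H\<^sub>0\<^sup>1(0, L)\<close> at time \<open>s\<close>.\<close>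

definition regular :: "real \<Rightarrow> bool" where
  "regular s \<longleftrightarrow> (\<exists>cu cv. u s = X.emb cu \<and> X.H1 cu (ux s) \<and> cu 0 = 0 \<and> cu L = 0 \<and>
     v s = X.emb cv \<and> X.H1 cv (vx s) \<and> cv 0 = 0 \<and> cv L = 0)"

definition dissipation_rate :: "real \<Rightarrow> real \<Rightarrow> real" where
  "dissipation_rate \<epsilon> s = 3/4 * \<epsilon> * ((norm (ux s))\<^sup>2 + (norm (vx s))\<^sup>2) + \<beta> * \<epsilon> / 2 * (norm (z s))\<^sup>2"

text \<open>Replacing the Dirichlet norms in the dissipation by their approximants gives continuous functionals
of the state, to which the energy inequality applies.\<close>

lemma dissipation_approximants:
  obtains G :: "real \<Rightarrow> nat \<Rightarrow> state \<Rightarrow> real" where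
    "\<And>\<epsilon> N. continuous_on UNIV (G \<epsilon> N)" "\<And>\<epsilon> N x. 0 \<le> \<epsilon> \<Longrightarrow> 0 \<le> G \<epsilon> N x" "\<And>\<epsilon> x. 0 \<le> \<epsilon> \<Longrightarrow> incseq (\<lambda>N. G \<epsilon> N x)"
    "\<And>\<epsilon> N x y. admissible \<epsilon> \<Longrightarrow> (x, y) \<in> HS_operator L h \<alpha> \<beta> \<Longrightarrow> B \<epsilon> x y \<le> - G \<epsilon> N x"
    "\<And>\<epsilon> s C. 0 < \<epsilon> \<Longrightarrow> weak_deriv 0 L (u s) (ux s) \<Longrightarrow> weak_deriv 0 L (v s) (vx s) \<Longrightarrow>
      \<forall>N. G \<epsilon> N (U s) \<le> C \<Longrightarrow> regular s"
    "\<And>\<epsilon> s. 0 \<le> \<epsilon> \<Longrightarrow> regular s \<Longrightarrow> (\<lambda>N. G \<epsilon> N (U s)) \<longlonglongrightarrow> dissipation_rate \<epsilon> s"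
    "\<And>\<epsilon> s N. 0 \<le> \<epsilon> \<Longrightarrow> regular s \<Longrightarrow> G \<epsilon> N (U s) \<le> dissipation_rate \<epsilon> s"
proof -
  obtain G :: "nat \<Rightarrow> L2 \<Rightarrow> real" where G: "\<And>N. continuous_on UNIV (G N)" "\<And>N F. 0 \<le> G N F" "\<And>F. incseq (\<lambda>N. G N F)"
    and upper: "\<And>N c g. X.H1 c g \<Longrightarrow> c 0 = 0 \<Longrightarrow> c L = 0 \<Longrightarrow> G N (X.emb c) \<le> (norm g)\<^sup>2"
    and lower: "\<And>c g M. X.H1 c g \<Longrightarrow> \<forall>N. G N (X.emb c) \<le> M \<Longrightarrow> c 0 = 0 \<and> c L = 0 \<and> (norm g)\<^sup>2 \<le> M"
    by (rule X.dirichlet_approximants, rule that)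
  have lim: "(\<lambda>N. G N (X.emb c)) \<longlonglongrightarrow> (norm g)\<^sup>2" if c: "X.H1 c g" "c 0 = 0" "c L = 0" for c g
  proof -
    obtain l where l: "(\<lambda>N. G N (X.emb c)) \<longlonglongrightarrow> l" "\<And>N. G N (X.emb c) \<le> l"
      using incseq_convergent[OF G(3)[of "X.emb c"], of "(norm g)\<^sup>2"] upper[OF c] by blast
    have "l \<le> (norm g)\<^sup>2" using LIMSEQ_le_const2[OF l(1)] upper[OF c] by blast
    moreover have "(norm g)\<^sup>2 \<le> l" using lower[OF c(1), of l] l(2) by blast
    ultimately show ?thesis using l(1) by simp
  qed
  define GG where "GG \<epsilon> N x = 3/4 * \<epsilon> * (G N (fst x) + G N (fst (snd x))) + \<beta> * \<epsilon> / 2 * (norm (snd (snd x)))\<^sup>2"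
    for \<epsilon> :: real and N and x :: state
  have contG: "continuous_on UNIV (\<lambda>x. G N (fst x))" "continuous_on UNIV (\<lambda>x. G N (fst (snd x)))" for N
    by (rule continuous_on_compose2[OF G(1)]; auto intro!: continuous_intros)+
  show ?thesis
  proof (rule that[of GG])
    show "continuous_on UNIV (GG \<epsilon> N)" for \<epsilon> N
      unfolding GG_def by (intro continuous_intros contG)
    show "0 \<le> GG \<epsilon> N x" if "0 \<le> \<epsilon>" for \<epsilon> N x
      using that G(2) \<beta>_pos by (simp add: GG_def)
    show "incseq (\<lambda>N. GG \<epsilon> N x)" if "0 \<le> \<epsilon>" for \<epsilon> x
      unfolding GG_def using that incseq_SucD[OF G(3)]
      by (intro incseq_SucI add_right_mono mult_left_mono add_mono) auto
    show "B \<epsilon> x y \<le> - GG \<epsilon> N x" if xy: "admissible \<epsilon>" "(x, y) \<in> HS_operator L h \<alpha> \<beta>" for \<epsilon> N x y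
    proof -
      obtain cu cv u1 v1 z where d: "x = (X.emb cu, X.emb cv, z)"
        "X.H1 cu u1" "cu 0 = 0" "cu L = 0" "X.H1 cv v1" "cv 0 = 0" "cv L = 0"
        "B \<epsilon> x y \<le> - (3/4 * \<epsilon> * ((norm u1)\<^sup>2 + (norm v1)\<^sup>2) + \<beta> * \<epsilon> / 2 * (norm z)\<^sup>2)"
        by (rule dissipative[OF xy(2,1)])
      have "GG \<epsilon> N x \<le> 3/4 * \<epsilon> * ((norm u1)\<^sup>2 + (norm v1)\<^sup>2) + \<beta> * \<epsilon> / 2 * (norm z)\<^sup>2"
        unfolding GG_def d(1) fst_conv snd_conv using xy(1)
        by (intro add_right_mono mult_left_mono add_mono upper[OF d(2-4)] upper[OF d(5-7)])
          (simp add: admissible_def)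
      with d(8) show ?thesis by linarith
    qed
    show "regular s" if \<epsilon>: "0 < \<epsilon>" and w: "weak_deriv 0 L (u s) (ux s)" "weak_deriv 0 L (v s) (vx s)"
      and C: "\<forall>N. GG \<epsilon> N (U s) \<le> C" for \<epsilon> s C
    proof -
      obtain cu where cu: "X.H1 cu (ux s)" "u s = X.emb cu" using X.weak_deriv_H1[OF w(1)] by blast
      obtain cv where cv: "X.H1 cv (vx s)" "v s = X.emb cv" using X.weak_deriv_H1[OF w(2)] by blast
      have le: "G N (u s) \<le> C / (3/4 * \<epsilon>)" "G N (v s) \<le> C / (3/4 * \<epsilon>)" for N
      proof -
        have "0 \<le> \<beta> * \<epsilon> / 2 * (norm (z s))\<^sup>2" "0 \<le> 3/4 * \<epsilon> * G N (u s)" "0 \<le> 3/4 * \<epsilon> * G N (v s)"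
          using \<epsilon> \<beta>_pos G(2) by simp_all
        moreover have "GG \<epsilon> N (U s) = 3/4 * \<epsilon> * G N (u s) + 3/4 * \<epsilon> * G N (v s) + \<beta> * \<epsilon> / 2 * (norm (z s))\<^sup>2"
          by (simp add: GG_def algebra_simps)
        ultimately have "3/4 * \<epsilon> * G N (u s) \<le> C" "3/4 * \<epsilon> * G N (v s) \<le> C" using spec[OF C, of N] by linarith+
        then show "G N (u s) \<le> C / (3/4 * \<epsilon>)" "G N (v s) \<le> C / (3/4 * \<epsilon>)"
          using \<epsilon> by (simp_all add: pos_le_divide_eq mult.commute)
      qed
      show ?thesis
        unfolding regular_def
        using cu cv lower[OF cu(1), of "C / (3/4 * \<epsilon>)"] lower[OF cv(1), of "C / (3/4 * \<epsilon>)"] le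
        by metis
    qed
    fix \<epsilon> :: real and s assume \<epsilon>: "0 \<le> \<epsilon>" and "regular s"
    then obtain cu cv where c: "u s = X.emb cu" "X.H1 cu (ux s)" "cu 0 = 0" "cu L = 0"
      "v s = X.emb cv" "X.H1 cv (vx s)" "cv 0 = 0" "cv L = 0"
      unfolding regular_def by blast
    show "(\<lambda>N. GG \<epsilon> N (U s)) \<longlonglongrightarrow> dissipation_rate \<epsilon> s"
      unfolding GG_def dissipation_rate_def c(1) c(5) by (intro tendsto_intros lim[OF c(2-4)] lim[OF c(6-8)])
    show "GG \<epsilon> N (U s) \<le> dissipation_rate \<epsilon> s" for N
      unfolding GG_def dissipation_rate_def c(1) c(5) using \<epsilon>
      by (intro add_right_mono mult_left_mono add_mono upper[OF c(2-4)] upper[OF c(6-8)]) simp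
  qed
qed

text \<open>As \<open>B \<epsilon>\<close> is nonnegative, the energy inequality bounds the integrals of \<open>G \<epsilon> N (U s)\<close> uniformly in
\<open>N\<close>. By monotone convergence the supremum over \<open>N\<close> is finite for almost every \<open>s\<close>, and this forces
the boundary conditions.\<close>

lemma AE_regular:
  assumes adm: "admissible \<epsilon>" and \<epsilon>: "0 < \<epsilon>" and "0 \<le> b"
  shows "AE s in lebesgue. s \<in> {0..b} \<longrightarrow> regular s"
proof -
  obtain G :: "real \<Rightarrow> nat \<Rightarrow> state \<Rightarrow> real" where
    G: "\<And>\<epsilon> N. continuous_on UNIV (G \<epsilon> N)" "\<And>\<epsilon> N x. 0 \<le> \<epsilon> \<Longrightarrow> 0 \<le> G \<epsilon> N x"
      "\<And>\<epsilon> x. 0 \<le> \<epsilon> \<Longrightarrow> incseq (\<lambda>N. G \<epsilon> N x)"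
    and diss: "\<And>\<epsilon> N x y. admissible \<epsilon> \<Longrightarrow> (x, y) \<in> HS_operator L h \<alpha> \<beta> \<Longrightarrow> B \<epsilon> x y \<le> - G \<epsilon> N x"
    and reg_I: "\<And>\<epsilon> s C. 0 < \<epsilon> \<Longrightarrow> weak_deriv 0 L (u s) (ux s) \<Longrightarrow> weak_deriv 0 L (v s) (vx s) \<Longrightarrow>
      \<forall>N. G \<epsilon> N (U s) \<le> C \<Longrightarrow> regular s"
    and lim: "\<And>\<epsilon> s. 0 \<le> \<epsilon> \<Longrightarrow> regular s \<Longrightarrow> (\<lambda>N. G \<epsilon> N (U s)) \<longlonglongrightarrow> dissipation_rate \<epsilon> s"
    and le: "\<And>\<epsilon> s N. 0 \<le> \<epsilon> \<Longrightarrow> regular s \<Longrightarrow> G \<epsilon> N (U s) \<le> dissipation_rate \<epsilon> s"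
    by (rule dissipation_approximants, rule that)
  note ei = energy_inequality[OF order_refl \<open>0 \<le> b\<close> G(1) diss[OF adm]]
  have int_G: "set_integrable lebesgue {0..b} (\<lambda>s. G \<epsilon> N (U s))" for N
    by (intro absolutely_integrable_continuous_real continuous_on_compose2[OF G(1) cont_on_U]) auto
  define M where "M = (LINT s:{0..b}|lebesgue. B \<epsilon> (U s) (f s)) + B \<epsilon> (U 0) (U 0) / 2"
  have "AE s in lebesgue. s \<in> {0..b} \<longrightarrow> (\<exists>C. \<forall>N. G \<epsilon> N (U s) \<le> C)"
  proof (rule AE_bounded_of_incseq[OF int_G])
    show "(LINT s:{0..b}|lebesgue. G \<epsilon> N (U s)) \<le> M" for N
    proof -
      have "0 \<le> B \<epsilon> (U b) (U b)"
        using B_zero_nonneg[OF U_in[OF \<open>0 \<le> b\<close>]] B_equivalent(1)[OF U_in[OF \<open>0 \<le> b\<close>], of \<epsilon>] \<epsilon>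
        by simp
      then show ?thesis
        using ei(2)[of N] set_integral_diff(2)[OF ei(1) int_G[of N]] by (simp add: M_def)
    qed
  qed (use G \<epsilon> in auto)
  with AE_weak_deriv[of b] show ?thesis
    by eventually_elim (use reg_I[OF \<epsilon>] in blast)
qed

lemma regular_energy_inequality:
  assumes adm: "admissible \<epsilon>" and ab: "0 \<le> a" "a \<le> b"
    and reg: "AE s in lebesgue. s \<in> {a..b} \<longrightarrow> regular s"
  shows "set_integrable lebesgue {a..b} (\<lambda>s. B \<epsilon> (U s) (f s) - dissipation_rate \<epsilon> s)"
    "B \<epsilon> (U b) (U b) / 2 - B \<epsilon> (U a) (U a) / 2 \<le> (LINT s:{a..b}|lebesgue. B \<epsilon> (U s) (f s) - dissipation_rate \<epsilon> s)"
proof -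
  have \<epsilon>: "0 \<le> \<epsilon>" using adm by (simp add: admissible_def)
  obtain G :: "real \<Rightarrow> nat \<Rightarrow> state \<Rightarrow> real" where
    G: "\<And>\<epsilon> N. continuous_on UNIV (G \<epsilon> N)" "\<And>\<epsilon> N x. 0 \<le> \<epsilon> \<Longrightarrow> 0 \<le> G \<epsilon> N x"
      "\<And>\<epsilon> x. 0 \<le> \<epsilon> \<Longrightarrow> incseq (\<lambda>N. G \<epsilon> N x)"
    and diss: "\<And>\<epsilon> N x y. admissible \<epsilon> \<Longrightarrow> (x, y) \<in> HS_operator L h \<alpha> \<beta> \<Longrightarrow> B \<epsilon> x y \<le> - G \<epsilon> N x"
    and reg_I: "\<And>\<epsilon> s C. 0 < \<epsilon> \<Longrightarrow> weak_deriv 0 L (u s) (ux s) \<Longrightarrow> weak_deriv 0 L (v s) (vx s) \<Longrightarrow>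
      \<forall>N. G \<epsilon> N (U s) \<le> C \<Longrightarrow> regular s"
    and lim: "\<And>\<epsilon> s. 0 \<le> \<epsilon> \<Longrightarrow> regular s \<Longrightarrow> (\<lambda>N. G \<epsilon> N (U s)) \<longlonglongrightarrow> dissipation_rate \<epsilon> s"
    and le: "\<And>\<epsilon> s N. 0 \<le> \<epsilon> \<Longrightarrow> regular s \<Longrightarrow> G \<epsilon> N (U s) \<le> dissipation_rate \<epsilon> s"
    by (rule dissipation_approximants, rule that)
  note ei = energy_inequality[OF ab G(1) diss[OF adm]]
  have int_G: "set_integrable lebesgue {a..b} (\<lambda>s. G \<epsilon> N (U s))" for N
    by (intro absolutely_integrable_continuous_real continuous_on_compose2[OF G(1) cont_on_U[OF ab(1)]]) auto
  have int_D: "set_integrable lebesgue {a..b} (dissipation_rate \<epsilon>)"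
    unfolding dissipation_rate_def
    by (intro set_integral_add set_integrable_mult_right derivatives_integrable ab
        absolutely_integrable_continuous_real continuous_intros cont_on_U)
  show int: "set_integrable lebesgue {a..b} (\<lambda>s. B \<epsilon> (U s) (f s) - dissipation_rate \<epsilon> s)"
    using ei(1) int_D by (rule set_integral_diff)
  have "(\<lambda>N. LINT s:{a..b}|lebesgue. B \<epsilon> (U s) (f s) - G \<epsilon> N (U s))
      \<longlonglongrightarrow> (LINT s:{a..b}|lebesgue. B \<epsilon> (U s) (f s) - dissipation_rate \<epsilon> s)"
    unfolding set_lebesgue_integral_def
  proof (rule integral_dominated_convergence)
    show "integrable lebesgue (\<lambda>s. indicator {a..b} s *\<^sub>R (\<bar>B \<epsilon> (U s) (f s)\<bar> + dissipation_rate \<epsilon> s))"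
      using set_integral_add(1)[OF set_integrable_abs[OF ei(1)] int_D] by (simp add: set_integrable_def)
    show "AE s in lebesgue. (\<lambda>N. indicator {a..b} s *\<^sub>R (B \<epsilon> (U s) (f s) - G \<epsilon> N (U s)))
        \<longlonglongrightarrow> indicator {a..b} s *\<^sub>R (B \<epsilon> (U s) (f s) - dissipation_rate \<epsilon> s)"
      using reg by eventually_elim (use lim[OF \<epsilon>] in \<open>auto simp: indicator_def intro!: tendsto_intros\<close>)
    show "AE s in lebesgue. norm (indicator {a..b} s *\<^sub>R (B \<epsilon> (U s) (f s) - G \<epsilon> N (U s)))
        \<le> indicator {a..b} s *\<^sub>R (\<bar>B \<epsilon> (U s) (f s)\<bar> + dissipation_rate \<epsilon> s)" for N
      using reg
    proof eventually_elim
      case (elim s)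
      then show ?case using le[OF \<epsilon>, of s N] G(2)[OF \<epsilon>, of N "U s"] by (auto simp: indicator_def)
    qed
    show "(\<lambda>s. indicator {a..b} s *\<^sub>R (B \<epsilon> (U s) (f s) - dissipation_rate \<epsilon> s)) \<in> borel_measurable lebesgue"
      using int unfolding set_integrable_def by (rule borel_measurable_integrable)
    show "(\<lambda>s. indicator {a..b} s *\<^sub>R (B \<epsilon> (U s) (f s) - G \<epsilon> N (U s))) \<in> borel_measurable lebesgue" for N
      using set_integral_diff(1)[OF ei(1) int_G[of N]] unfolding set_integrable_def by (rule borel_measurable_integrable)
  qed
  then show "B \<epsilon> (U b) (U b) / 2 - B \<epsilon> (U a) (U a) / 2 \<le> (LINT s:{a..b}|lebesgue. B \<epsilon> (U s) (f s) - dissipation_rate \<epsilon> s)"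
    by (rule LIMSEQ_le_const) (use ei(2) in auto)
qed

lemma regular_nonlinear_bound:
  assumes "regular s" "norm (u s) \<le> R" "norm (v s) \<le> R" "0 \<le> \<epsilon>"
  shows "\<bar>B \<epsilon> (U s) (f s)\<bar> \<le> \<epsilon> * (5/2 * L * sqrt L * R) * ((norm (ux s))\<^sup>2 + (norm (vx s))\<^sup>2)"
proof -
  obtain cu cv where c: "u s = X.emb cu" "X.H1 cu (ux s)" "cu 0 = 0" "cu L = 0"
    "v s = X.emb cv" "X.H1 cv (vx s)" "cv 0 = 0" "cv L = 0"
    using assms(1) unfolding regular_def by blast
  show ?thesis
    using nonlinear_bound[OF c(2-4) c(6-8) _ _ assms(4), of R "z s"] assms(2,3)
    unfolding f_def by (simp flip: c(1) c(5))
qed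

lemma regular_Poincare:
  assumes "regular s"
  shows "norm (u s) \<le> L * norm (ux s)" "norm (v s) \<le> L * norm (vx s)"
  using assms X.Poincare unfolding regular_def by metis+

text \<open>The case \<open>\<epsilon> = 0\<close> shows that the norm of \<open>H\<close> never exceeds its initial value. The smallness
condition is such that the nonlinear term uses up at most \<open>\<epsilon> / 4\<close> of the factor \<open>3 \<epsilon> / 4\<close> in the
dissipation.\<close>

lemma decay:
  assumes adm: "admissible \<epsilon>" and \<epsilon>: "0 < \<epsilon>"
    and small: "B 0 U0 U0 \<le> (1 / (10 * L * sqrt L))\<^sup>2" and "0 \<le> t"
  defines "\<kappa> \<equiv> 1 + \<epsilon> * (L + 1)"
  defines "\<nu> \<equiv> 2 * min (\<epsilon> / (2 * L\<^sup>2)) (\<epsilon> / (2 * h)) / \<kappa>"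
  shows "energy L h \<beta> (U t) \<le> \<kappa> * energy L h \<beta> (U 0) * exp (- \<nu> * t)"
proof -
  define r where "r = 1 / (10 * L * sqrt L)"
  have L_pos: "0 < L" by (rule X.L_pos)
  have r: "0 < r" "5/2 * L * sqrt L * r = 1/4" using L_pos by (simp_all add: r_def)
  have \<kappa>: "1 \<le> \<kappa>" using \<epsilon> L_pos by (simp add: \<kappa>_def)
  have adm0: "admissible 0"
  proof -
    have "0 \<le> \<epsilon> * (\<beta> / 2 + L * \<alpha>\<^sup>2)" "0 \<le> \<epsilon> * L * \<beta>\<^sup>2" using \<epsilon> L_pos \<beta>_pos by simp_all
    then show ?thesis using adm by (simp add: admissible_def)
  qed
  have reg: "AE s in lebesgue. s \<in> {a..b} \<longrightarrow> regular s" if "0 \<le> a" "a \<le> b" for a b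
    using AE_regular[OF adm \<epsilon>, of b] that by (auto elim!: eventually_mono)
  have norms: "B 0 (U s) (U s) \<le> r\<^sup>2" if "0 \<le> s" for s
  proof -
    note re = regular_energy_inequality[OF adm0 order_refl that reg[OF order_refl that]]
    have "(LINT s:{0..s}|lebesgue. B 0 (U s) (f s) - dissipation_rate 0 s) = (LINT s:{0..s}|lebesgue. 0)"
      unfolding set_lebesgue_integral_def
    proof (rule integral_cong_AE)
      show "AE x in lebesgue. indicator {0..s} x *\<^sub>R (B 0 (U x) (f x) - dissipation_rate 0 x) = indicator {0..s} x *\<^sub>R 0"
        using reg[OF order_refl that]
      proof eventually_elim
        case (elim x)
        have "\<bar>B 0 (U x) (f x)\<bar> \<le> 0" if "regular x"
          using regular_nonlinear_bound[OF that, of "max (norm (u x)) (norm (v x))" 0] by simp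
        then show ?case using elim by (auto simp: indicator_def dissipation_rate_def)
      qed
      show "(\<lambda>x. indicator {0..s} x *\<^sub>R (B 0 (U x) (f x) - dissipation_rate 0 x)) \<in> borel_measurable lebesgue"
        using re(1) unfolding set_integrable_def by (rule borel_measurable_integrable)
    qed simp
    then show ?thesis using re(2) small U_0 by (simp add: r_def)
  qed
  have uv: "norm (u s) \<le> r" "norm (v s) \<le> r" if "0 \<le> s" for s
  proof -
    have "0 \<le> \<beta> * h * (norm (z s))\<^sup>2" using \<beta>_pos h_pos by simp
    then have "(norm (u s))\<^sup>2 \<le> r\<^sup>2" "(norm (v s))\<^sup>2 \<le> r\<^sup>2"
      using norms[OF that] zero_le_power2[of "norm (u s)"] zero_le_power2[of "norm (v s)"]
      unfolding B_zero[OF U_in[OF that]] by linarith+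
    then show "norm (u s) \<le> r" "norm (v s) \<le> r" using r(1) by (auto intro: power2_le_imp_le)
  qed
  define q where "q s = B \<epsilon> (U s) (U s) / 2" for s
  define \<mu> where "\<mu> = min (\<epsilon> / (2 * L\<^sup>2)) (\<epsilon> / (2 * h))"
  have \<mu>: "0 < \<mu>" "\<mu> \<le> \<epsilon> / (2 * L\<^sup>2)" "\<mu> \<le> \<epsilon> / (2 * h)" using \<epsilon> L_pos h_pos by (simp_all add: \<mu>_def)
  have integrand: "B \<epsilon> (U s) (f s) - dissipation_rate \<epsilon> s \<le> - \<nu> * q s" if s: "0 \<le> s" and reg: "regular s" for s
  proof -
    define Y where "Y = (norm (ux s))\<^sup>2 + (norm (vx s))\<^sup>2"
    have "\<bar>B \<epsilon> (U s) (f s)\<bar> \<le> \<epsilon> * (1/4) * Y"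
      using regular_nonlinear_bound[OF reg uv[OF s], of \<epsilon>] \<epsilon> unfolding r(2) Y_def by simp
    then have 1: "B \<epsilon> (U s) (f s) - dissipation_rate \<epsilon> s \<le> - (\<epsilon> / 2 * Y + \<beta> * \<epsilon> / 2 * (norm (z s))\<^sup>2)"
      unfolding dissipation_rate_def Y_def[symmetric] by (simp add: abs_le_iff)
    have "(norm (u s))\<^sup>2 \<le> (L * norm (ux s))\<^sup>2" "(norm (v s))\<^sup>2 \<le> (L * norm (vx s))\<^sup>2"
      using regular_Poincare[OF reg] by (auto intro: power_mono)
    then have "(norm (u s))\<^sup>2 + (norm (v s))\<^sup>2 \<le> L\<^sup>2 * Y"
      by (simp add: Y_def power_mult_distrib distrib_left)
    then have "\<mu> * ((norm (u s))\<^sup>2 + (norm (v s))\<^sup>2) \<le> \<epsilon> / (2 * L\<^sup>2) * (L\<^sup>2 * Y)"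
      using \<mu> \<epsilon> by (intro mult_mono) auto
    also have "\<dots> = \<epsilon> / 2 * Y" using L_pos by simp
    finally have 2: "\<mu> * ((norm (u s))\<^sup>2 + (norm (v s))\<^sup>2) \<le> \<epsilon> / 2 * Y" .
    have "\<mu> * (\<beta> * h * (norm (z s))\<^sup>2) \<le> \<epsilon> / (2 * h) * (\<beta> * h * (norm (z s))\<^sup>2)"
      using \<mu>(3) \<beta>_pos h_pos by (intro mult_right_mono) auto
    also have "\<dots> = \<beta> * \<epsilon> / 2 * (norm (z s))\<^sup>2" using h_pos by simp
    finally have 3: "\<mu> * (\<beta> * h * (norm (z s))\<^sup>2) \<le> \<beta> * \<epsilon> / 2 * (norm (z s))\<^sup>2" .
    have "\<mu> * B 0 (U s) (U s) \<le> \<epsilon> / 2 * Y + \<beta> * \<epsilon> / 2 * (norm (z s))\<^sup>2"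
      using 2 3 unfolding B_zero[OF U_in[OF s]] by (simp add: distrib_left)
    moreover have "\<nu> * q s \<le> \<mu> * B 0 (U s) (U s)"
    proof -
      have "\<nu> * q s = \<mu> / \<kappa> * B \<epsilon> (U s) (U s)" by (simp add: \<nu>_def \<mu>_def q_def)
      also have "\<dots> \<le> \<mu> / \<kappa> * (\<kappa> * B 0 (U s) (U s))"
        using B_equivalent(2)[OF U_in[OF s], of \<epsilon>] \<epsilon> \<mu>(1) \<kappa> by (intro mult_left_mono) (auto simp: \<kappa>_def)
      also have "\<dots> = \<mu> * B 0 (U s) (U s)" using \<kappa> by simp
      finally show ?thesis .
    qed
    ultimately show ?thesis using 1 by simp
  qed
  interpret B: bounded_bilinear "B \<epsilon>" by (rule bounded_bilinear_B)
  have cont_q: "continuous_on {a..b} q" if "0 \<le> a" for a b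
    unfolding q_def by (intro continuous_intros B.continuous_on cont_on_U that) auto
  have "q t \<le> q 0 * exp (- \<nu> * t)"
  proof (rule exponential_decay[OF _ _ \<open>0 \<le> t\<close>])
    show "continuous_on {0..} q"
      unfolding continuous_on_eq_continuous_within
    proof
      fix x :: real assume x: "x \<in> {0..}"
      have "continuous (at x within {0..x + 1}) q"
        using cont_q[of 0 "x + 1"] x by (simp add: continuous_on_eq_continuous_within)
      moreover have "at x within {0..x + 1} = at x within {0..}"
        by (rule at_within_nhd[of x "{..<x + 1}"]) auto
      ultimately show "continuous (at x within {0..}) q" by (simp add: continuous_within)
    qed
    fix a b :: real assume ab: "0 \<le> a" "a \<le> b"
    note re = regular_energy_inequality[OF adm ab reg[OF ab]]
    have int_q: "set_integrable lebesgue {a..b} q"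
      by (rule absolutely_integrable_continuous_real[OF cont_q[OF ab(1)]])
    have "q b - q a \<le> (LINT s:{a..b}|lebesgue. B \<epsilon> (U s) (f s) - dissipation_rate \<epsilon> s)"
      using re(2) by (simp add: q_def)
    also have "\<dots> \<le> (LINT s:{a..b}|lebesgue. - \<nu> * q s)"
    proof (rule set_integral_mono_AE)
      show "set_integrable lebesgue {a..b} (\<lambda>s. - \<nu> * q s)" using int_q by (rule set_integrable_mult_right)
      show "AE s \<in> {a..b} in lebesgue. B \<epsilon> (U s) (f s) - dissipation_rate \<epsilon> s \<le> - \<nu> * q s"
        using reg[OF ab] by eventually_elim (use integrand ab in auto)
    qed (rule re(1))
    also have "\<dots> = - \<nu> * (LINT s:{a..b}|lebesgue. q s)" by (rule set_integral_mult_right)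
    also have "\<dots> = - \<nu> * integral {a..b} q"
      unfolding set_lebesgue_integral_eq_integral(2)[OF int_q] ..
    finally show "q b - q a \<le> - \<nu> * integral {a..b} q" .
  qed
  moreover have "energy L h \<beta> (U t) \<le> q t"
    using B_equivalent(1)[OF U_in[OF \<open>0 \<le> t\<close>], of \<epsilon>] \<epsilon> energy_eq[OF U_in[OF \<open>0 \<le> t\<close>]] by (simp add: q_def)
  moreover have "q 0 \<le> \<kappa> * energy L h \<beta> (U 0)"
    using B_equivalent(2)[OF U_in[OF order_refl], of \<epsilon>] \<epsilon>
    unfolding energy_eq[OF U_in[OF order_refl]] q_def \<kappa>_def by simp
  then have "q 0 * exp (- \<nu> * t) \<le> \<kappa> * energy L h \<beta> (U 0) * exp (- \<nu> * t)" by (rule mult_right_mono) simp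
  ultimately show ?thesis by linarith
qed

end

lemma restrict_to_L2_in:
  assumes "square_integrable_on a b g"
  shows "restrict_to_L2 a b g \<in> L2_on a b"
  unfolding L2_on_def mem_Collect_eq restrict_to_L2_def
  using fun_of_to_L2[OF assms[unfolded square_integrable_on_def]]
  by (rule eventually_mono) (auto simp: indicator_def)

theorem theorem1p2:
  fixes L h \<alpha> \<beta> :: real
  assumes "L > 0" and "h > 0" and "\<beta> > 0"
    and "0 < 2 * \<alpha>\<^sup>2 + 3/2 * \<beta>" and "2 * \<alpha>\<^sup>2 + 3/2 * \<beta> < 1/2"
  shows "\<exists>r>0. \<exists>kappa0>0. \<exists>lambda0>0. \<forall>u0 v0 z0 U.
    data_in_H L h u0 v0 z0 \<longrightarrow>
    norm_H h \<beta> (initial_state L h u0 v0 z0) \<le> r \<longrightarrow>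
    HS_mild_solution L h \<alpha> \<beta> (initial_state L h u0 v0 z0) U \<longrightarrow>
    (\<forall>t\<ge>0. energy L h \<beta> (U t) \<le> kappa0 * energy L h \<beta> (U 0) * exp (- lambda0 * t))"
proof -
  interpret H: hirota_satsuma L h \<alpha> \<beta> by unfold_locales (use assms in auto)
  \<comment> \<open>The largest \<open>\<epsilon>\<close> for which both boundary coefficients stay nonpositive.\<close>
  define k1 k2 \<epsilon> where "k1 = \<beta> / 2 + L * \<alpha>\<^sup>2" and "k2 = L * \<beta>\<^sup>2"
    and "\<epsilon> = min ((1/4 - \<alpha>\<^sup>2 - \<beta> / 2) / k1) ((\<beta> / 2 - \<beta>\<^sup>2) / k2)"
  have k: "0 < k1" "0 < k2" using assms by (simp_all add: k1_def k2_def add_pos_nonneg)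
  have "\<beta> < 1/3" using assms(5) zero_le_power2[of \<alpha>] by linarith
  then have "\<beta>\<^sup>2 < \<beta> / 2" using assms(3) by (simp add: power2_eq_square)
  then have \<epsilon>: "0 < \<epsilon>" using k assms(3,5) by (simp add: \<epsilon>_def)
  have "\<epsilon> \<le> (1/4 - \<alpha>\<^sup>2 - \<beta> / 2) / k1" "\<epsilon> \<le> (\<beta> / 2 - \<beta>\<^sup>2) / k2" by (simp_all add: \<epsilon>_def)
  then have "\<epsilon> * k1 \<le> 1/4 - \<alpha>\<^sup>2 - \<beta> / 2" "\<epsilon> * k2 \<le> \<beta> / 2 - \<beta>\<^sup>2"
    using k by (simp_all add: pos_le_divide_eq)
  then have adm: "H.admissible \<epsilon>" using \<epsilon> by (simp add: H.admissible_def k1_def k2_def mult.assoc)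
  define r where "r = 1 / (10 * L * sqrt L)"
  define \<kappa> where "\<kappa> = 1 + \<epsilon> * (L + 1)"
  define \<nu> where "\<nu> = 2 * min (\<epsilon> / (2 * L\<^sup>2)) (\<epsilon> / (2 * h)) / \<kappa>"
  have pos: "0 < r" "0 < \<kappa>" "0 < \<nu>"
    using assms(1,2) \<epsilon> by (simp_all add: r_def \<kappa>_def \<nu>_def add_pos_pos)
  have "energy L h \<beta> (U t) \<le> \<kappa> * energy L h \<beta> (U 0) * exp (- \<nu> * t)"
    if data: "data_in_H L h u0 v0 z0" and small: "norm_H h \<beta> (initial_state L h u0 v0 z0) \<le> r"
      and sol: "HS_mild_solution L h \<alpha> \<beta> (initial_state L h u0 v0 z0) U" and t: "0 \<le> t"
    for u0 v0 z0 U t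
  proof -
    let ?U0 = "initial_state L h u0 v0 z0"
    have U0: "?U0 \<in> state_space L"
      using data by (simp add: initial_state_def state_space_def data_in_H_def restrict_to_L2_in)
    obtain S ux vx where S: "C0_semigroup_on (state_space L) S"
      "generator_on (state_space L) S = HS_operator L h \<alpha> \<beta>"
      and reg: "\<And>T. 0 < T \<Longrightarrow> continuous_on {0..T} U \<and> U ` {0..T} \<subseteq> state_space L \<and>
           L2_time_H1 0 L T (\<lambda>t. fst (U t)) ux \<and> L2_time_H1 0 L T (\<lambda>t. fst (snd (U t))) vx"
      and duhamel: "\<And>t. 0 \<le> t \<Longrightarrow> has_bochner_integral (lebesgue_on {0..t})
           (\<lambda>s. S (t - s) (HS_nonlinearity (fst (U s)) (ux s) (fst (snd (U s))) (vx s)))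
           (U t - S t ?U0)"
      using sol unfolding HS_mild_solution_def by blast
    have in_X: "U s \<in> state_space L" if "0 \<le> s" for s
      using reg[of "s + 1"] that by (auto simp: image_subset_iff)
    interpret M: hs_solution L h \<alpha> \<beta> S ux vx ?U0 U
      by unfold_locales (use S reg duhamel in_X U0 in auto)
    have nonneg: "0 \<le> H.B 0 ?U0 ?U0" by (rule H.B_zero_nonneg[OF U0])
    have "norm_H h \<beta> ?U0 = sqrt (H.B 0 ?U0 ?U0)"
      by (simp add: norm_H_def H.B_zero[OF U0] case_prod_beta)
    then have "sqrt (H.B 0 ?U0 ?U0) \<le> r" using small by simp
    then have "(sqrt (H.B 0 ?U0 ?U0))\<^sup>2 \<le> r\<^sup>2" using nonneg by (intro power_mono) auto
    then have "H.B 0 ?U0 ?U0 \<le> r\<^sup>2" using nonneg by simp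
    then show ?thesis
      using M.decay[OF adm \<epsilon> _ t] by (simp add: r_def \<kappa>_def \<nu>_def)
  qed
  with pos show ?thesis by blast
qed

end
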